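(* Let $h\colon[n]\to[n]$ be an indecomposable Hessenberg function. Let $D=n(n-1)/2$, let $u_0,u_1,\dots,u_D\in\mathfrak{S}_n$ be the sequence of permutations defined in the context, and let $\mathcal{N}_{w_0,h}=\mathrm{Hess}(N,h)\cap\mathcal{N}_{w_0}$ be the open affine chart of $\mathrm{Hess}(N,h)$ around $w_0B$. Then the subvarieties $$\mathcal{N}_{w_0,h}=\Omega_{u_0}\cap\mathcal{N}_{w_0,h}\supseteq\Omega_{u_1}\cap\mathcal{N}_{w_0,h}\supseteq\cdots\supseteq\Omega_{u_D}\cap\mathcal{N}_{w_0,h}=\{w_0B\}$$ satisfy the following. (1) For $1\le\ell\le D$: if the lowest lower-right corner of the Young diagram formed by $D(u_\ell^{-1})$ is located at the position of a free variable, then $\Omega_{u_{\ell-1}}\cap\mathcal{N}_{w_0,h}\neq\Omega_{u_\ell}\cap\mathcal{N}_{w_0,h}$ and $$\dim\Omega_{u_\ell}\cap\mathcal{N}_{w_0,h}=\dim\Omega_{u_{\ell-1}}\cap\mathcal{N}_{w_0,h}-1;$$ otherwise, $\Omega_{u_{\ell-1}}\cap\mathcal{N}_{w_0,h}=\Omega_{u_\ell}\cap\mathcal{N}_{w_0,h}$. (2) Each $\Omega_{u_\ell}\cap\mathcal{N}_{w_0,h}$ ($0\le\ell\le D$) is isomorphic to an affine space, and in particular is non-singular and irreducible in $\mathcal{N}_{w_0,h}$.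
   Context: Write $[n]=\{1,\dots,n\}$. A Hessenberg function is a function $h\colon[n]\to[n]$ with $h(i)\ge i$ for all $i$ and $h(i+1)\ge h(i)$ for $1\le i<n$. It is indecomposable if $h(j)\ge j+1$ for $j\in\{1,\dots,n-1\}$. Set $H(h)=\{(a_{i,j})\in\mathfrak{gl}_n(\mathbb{C})\mid a_{i,j}=0\text{ if }i>h(j)\}$. Let $B\subset\mathrm{GL}_n(\mathbb{C})$ be the upper-triangular matrices; $\mathrm{GL}_n(\mathbb{C})/B$ is identified with the variety $\mathrm{Flags}(\mathbb{C}^n)$ of full flags $V_\bullet=(V_1\subset\cdots\subset V_n=\mathbb{C}^n)$ by sending $MB$ to the flag with $V_i$ the span of the first $i$ columns of $M$. Let $N$ be the $n\times n$ nilpotent matrix with $1$'s on the superdiagonal and $0$'s elsewhere, and let $\mathrm{Hess}(N,h)=\{MB\mid M^{-1}NM\in H(h)\}$, a closed subvariety of $\mathrm{Flags}(\mathbb{C}^n)$. Chart: let $w_0\in\mathfrak{S}_n$ be the longest element, $w_0(i)=n+1-i$. $\mathcal{N}_{w_0}\subset\mathrm{Flags}(\mathbb{C}^n)$ is the open set of cosets $XB$ with $X=(x_{i,j})$ satisfying $x_{i,n+1-i}=1$ and $x_{i,j}=0$ for $i+j>n+1$; the entries $x_{i,j}$ with $i+j\le n$ are coordinates giving $\mathcal{N}_{w_0}\cong\mathbb{A}^{n(n-1)/2}$. The non-free variables are the $x_{i,j}$ with $1\le i,j\le n-1$ and $i\in\{2,3,\dots,n+1-h(j)\}$; all other coordinates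 $x_{i,j}$ ($i+j\le n$) are the free variables. The position of $x_{i,j}$ is $(i,j)$ (row $i$, column $j$). Dual Schubert varieties: for $w\in\mathfrak{S}_n$, $\Omega_w$ is the set of $V_\bullet\in\mathrm{Flags}(\mathbb{C}^n)$ such that $\dim(V_p\cap\widetilde F_{n-q})\ge|\{i\le p\mid w(i)\ge q+1\}|$ for all $p,q\in[n]$, where $\widetilde F_j=\mathrm{span}(e_{n+1-j},\dots,e_n)$. Diagrams: the permutation matrix of $w$ has $1$'s in positions $(w(j),j)$. The diagram $D(w)$ is the set of cells of the $n\times n$ array that remain after removing, for each $1$ of the permutation matrix of $w^{-1}$, that cell, all cells to its right in the same row, and all cells below it in the same column. (So $D(w^{-1})$ is computed from the permutation matrix of $w$.) The permutations: $u_0=\mathrm{id}$ and, for $1\le\ell\le D$, $u_\ell$ is the product of the right-most $\ell$ simple transpositions of the word $(s_1)(s_2s_1)(s_3s_2s_1)\cdots(s_{n-1}s_{n-2}\cdots s_2s_1)$, where $s_i$ exchanges $i$ and $i+1$ and products are composed from left to right, i.e. $(uv)(i)=v(u(i))$. With this convention, $D(u_\ell^{-1})$ is the Young diagram consisting of the first $\ell$ positions in the list $(1,1),(1,2),\dots,(1,n-1),(2,1),\dots,(2,n-2),\dots,(n-1,1)$, and its lowest lower-right corner is the $\ell$-th position in this list. *)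

theory Defs
  imports
    "Jordan_Normal_Form.DL_Rank"
    "Jordan_Normal_Form.Jordan_Normal_Form"
    "HOL-Analysis.Abstract_Topology"
    "HOL-Library.Extended_Real"
    "HOL-Combinatorics.Transposition"
begin

section \<open>Affine varieties over the complex numbers\<close>

text \<open>
  Affine \<open>m\<close>-space is \<open>carrier_vec m\<close>. Its coordinate ring is the ring of polynomial functions:
  a polynomial over an infinite field is determined by its values on \<open>carrier_vec m\<close>.
  (Only the values of these functions on \<open>carrier_vec m\<close> matter.)
\<close>

inductive_set poly_funs :: "nat \<Rightarrow> (complex vec \<Rightarrow> complex) set" for m :: nat where
  const: "(\<lambda>x. c) \<in> poly_funs m"
| coord: "i < m \<Longrightarrow> (\<lambda>x. x $ i) \<in> poly_funs m"
| add: "f \<in> poly_funs m \<Longrightarrow> g \<in> poly_funs m \<Longrightarrow> (\<lambda>x. f x + g x) \<in> poly_funs m"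
| mult: "f \<in> poly_funs m \<Longrightarrow> g \<in> poly_funs m \<Longrightarrow> (\<lambda>x. f x * g x) \<in> poly_funs m"

definition zero_locus :: "nat \<Rightarrow> (complex vec \<Rightarrow> complex) set \<Rightarrow> complex vec set" where
  "zero_locus m F = {x \<in> carrier_vec m. \<forall>f\<in>F. f x = 0}"

definition zariski :: "nat \<Rightarrow> complex vec topology" where
  "zariski m = topology (\<lambda>U. \<exists>F \<subseteq> poly_funs m. U = carrier_vec m - zero_locus m F)"

lemma istopology_zariski:
  "istopology (\<lambda>U. \<exists>F \<subseteq> poly_funs m. U = carrier_vec m - zero_locus m F)"
  unfolding istopology_def
proof (intro conjI allI impI)
  fix S T
  assume "\<exists>F \<subseteq> poly_funs m. S = carrier_vec m - zero_locus m F"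
    and "\<exists>F \<subseteq> poly_funs m. T = carrier_vec m - zero_locus m F"
  then obtain F G where F: "F \<subseteq> poly_funs m" "S = carrier_vec m - zero_locus m F"
    and G: "G \<subseteq> poly_funs m" "T = carrier_vec m - zero_locus m G"
    by blast
  let ?H = "{\<lambda>x. f x * g x | f g. f \<in> F \<and> g \<in> G}"
  have "?H \<subseteq> poly_funs m"
    using F(1) G(1) by (auto intro: poly_funs.mult)
  moreover have "S \<inter> T = carrier_vec m - zero_locus m ?H"
    unfolding F(2) G(2) zero_locus_def by (fastforce simp: fun_eq_iff)
  ultimately show "\<exists>H \<subseteq> poly_funs m. S \<inter> T = carrier_vec m - zero_locus m H"
    by blast
next
  fix K :: "complex vec set set"
  assume "\<forall>S\<in>K. \<exists>F \<subseteq> poly_funs m. S = carrier_vec m - zero_locus m F"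
  then obtain F where F: "\<And>S. S \<in> K \<Longrightarrow> F S \<subseteq> poly_funs m"
      "\<And>S. S \<in> K \<Longrightarrow> S = carrier_vec m - zero_locus m (F S)"
    by metis
  have "\<Union> K = (\<Union>S\<in>K. carrier_vec m - zero_locus m (F S))"
    using F(2) by auto
  also have "\<dots> = carrier_vec m - zero_locus m (\<Union>S\<in>K. F S)"
    by (auto simp: zero_locus_def)
  finally show "\<exists>H \<subseteq> poly_funs m. \<Union> K = carrier_vec m - zero_locus m H"
    using F(1) by (metis UN_least)
qed

lemma openin_zariski:
  "openin (zariski m) U \<longleftrightarrow> (\<exists>F \<subseteq> poly_funs m. U = carrier_vec m - zero_locus m F)"
  unfolding zariski_def by (simp add: topology_inverse'[OF istopology_zariski])

lemma topspace_zariski: "topspace (zariski m) = carrier_vec m"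
proof -
  have "carrier_vec m - zero_locus m {\<lambda>x. 1} = carrier_vec m"
    by (auto simp: zero_locus_def)
  then have "openin (zariski m) (carrier_vec m)"
    unfolding openin_zariski by (metis empty_subsetI insert_subset poly_funs.const)
  moreover have "U \<subseteq> carrier_vec m" if "openin (zariski m) U" for U
    using that by (auto simp: openin_zariski)
  ultimately show ?thesis
    by (metis openin_subset openin_topspace subset_antisym)
qed

lemma closedin_zariski:
  "closedin (zariski m) Z \<longleftrightarrow> (\<exists>F \<subseteq> poly_funs m. Z = zero_locus m F)"
proof -
  have "zero_locus m F \<subseteq> carrier_vec m" for F
    by (auto simp: zero_locus_def)
  then show ?thesis
    unfolding closedin_def topspace_zariski openin_zariski by (metis double_diff subset_refl)
qed

definition irreducible_space :: "'a topology \<Rightarrow> bool" where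
  "irreducible_space X \<longleftrightarrow> topspace X \<noteq> {} \<and>
     (\<forall>A B. closedin X A \<and> closedin X B \<and> A \<union> B = topspace X \<longrightarrow> A = topspace X \<or> B = topspace X)"

definition irreducible_chain :: "'a topology \<Rightarrow> nat \<Rightarrow> (nat \<Rightarrow> 'a set) \<Rightarrow> bool" where
  "irreducible_chain X k Z \<longleftrightarrow>
     (\<forall>i\<le>k. closedin X (Z i) \<and> irreducible_space (subtopology X (Z i))) \<and>
     (\<forall>i<k. Z i \<subset> Z (Suc i))"

text \<open>Krull dimension; the values in \<open>ereal\<close> make the empty space have dimension \<open>-\<infinity>\<close>.\<close>

definition krull_dim :: "'a topology \<Rightarrow> ereal" where
  "krull_dim X = Sup {ereal (real k) | k Z. irreducible_chain X k Z}"

text \<open>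
  The Krull dimension of the local ring at \<open>p\<close>, whose primes correspond to the irreducible closed
  subsets containing \<open>p\<close>.
\<close>

definition local_dim :: "'a topology \<Rightarrow> 'a \<Rightarrow> ereal" where
  "local_dim X p = Sup {ereal (real k) | k Z. irreducible_chain X k Z \<and> p \<in> Z 0}"

definition variety_dim :: "nat \<Rightarrow> complex vec set \<Rightarrow> ereal" where
  "variety_dim m Z = krull_dim (subtopology (zariski m) Z)"

definition subspace_dim :: "nat \<Rightarrow> complex vec set \<Rightarrow> nat" where
  "subspace_dim n W = vectorspace.dim class_ring ((module_vec TYPE(complex) n)\<lparr>carrier := W\<rparr>)"

text \<open>
  The vectors annihilated by the differentials \<open>d\<^sub>p f\<close> of all \<open>f\<close> in the vanishing ideal of \<open>Z\<close>;
  \<open>d\<^sub>p f (v)\<close> is the derivative of \<open>f (p + t v)\<close> at \<open>t = 0\<close>.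
\<close>

definition tangent_space :: "nat \<Rightarrow> complex vec set \<Rightarrow> complex vec \<Rightarrow> complex vec set" where
  "tangent_space m Z p = {v \<in> carrier_vec m. \<forall>f\<in>poly_funs m. (\<forall>z\<in>Z. f z = 0) \<longrightarrow>
     ((\<lambda>t. f (p + t \<cdot>\<^sub>v v)) has_field_derivative 0) (at 0)}"

definition nonsingular :: "nat \<Rightarrow> complex vec set \<Rightarrow> bool" where
  "nonsingular m Z \<longleftrightarrow> (\<forall>p\<in>Z.
     ereal (real (subspace_dim m (tangent_space m Z p))) = local_dim (subtopology (zariski m) Z) p)"

text \<open>Isomorphism of closed subvarieties: regular maps are restrictions of polynomial maps.\<close>

definition isomorphic_varieties :: "nat \<Rightarrow> complex vec set \<Rightarrow> nat \<Rightarrow> complex vec set \<Rightarrow> bool" where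
  "isomorphic_varieties m X k Y \<longleftrightarrow> (\<exists>f g.
     (\<forall>i<k. f i \<in> poly_funs m) \<and> (\<forall>j<m. g j \<in> poly_funs k) \<and>
     (\<forall>x\<in>X. vec k (\<lambda>i. f i x) \<in> Y \<and> vec m (\<lambda>j. g j (vec k (\<lambda>i. f i x))) = x) \<and>
     (\<forall>y\<in>Y. vec m (\<lambda>j. g j y) \<in> X \<and> vec k (\<lambda>i. f i (vec m (\<lambda>j. g j y))) = y))"


section \<open>Flags, Hessenberg varieties and dual Schubert varieties\<close>

text \<open>
  Rows, columns and flag members are numbered from 1, whereas the library numbers vector and matrix
  entries from 0.
\<close>

abbreviation entry :: "complex mat \<Rightarrow> nat \<Rightarrow> nat \<Rightarrow> complex" where
  "entry A i j \<equiv> A $$ (i - 1, j - 1)"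

abbreviation span_vec :: "nat \<Rightarrow> complex vec set \<Rightarrow> complex vec set" where
  "span_vec n S \<equiv> LinearCombinations.module.span class_ring (module_vec TYPE(complex) n) S"

definition hessenberg_function :: "nat \<Rightarrow> (nat \<Rightarrow> nat) \<Rightarrow> bool" where
  "hessenberg_function n h \<longleftrightarrow> h ` {1..n} \<subseteq> {1..n} \<and> (\<forall>i\<in>{1..n}. i \<le> h i) \<and>
     (\<forall>i\<in>{1..<n}. h i \<le> h (i + 1))"

definition indecomposable :: "nat \<Rightarrow> (nat \<Rightarrow> nat) \<Rightarrow> bool" where
  "indecomposable n h \<longleftrightarrow> (\<forall>j\<in>{1..n - 1}. j + 1 \<le> h j)"

definition hessenberg_space :: "nat \<Rightarrow> (nat \<Rightarrow> nat) \<Rightarrow> complex mat set" where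
  "hessenberg_space n h =
     {A \<in> carrier_mat n n. \<forall>i\<in>{1..n}. \<forall>j\<in>{1..n}. h j < i \<longrightarrow> entry A i j = 0}"

definition flags :: "nat \<Rightarrow> (nat \<Rightarrow> complex vec set) set" where
  "flags n = {V \<in> extensional {1..n}.
     (\<forall>i\<in>{1..n}. VectorSpace.subspace class_ring (V i) (module_vec TYPE(complex) n) \<and>
                 subspace_dim n (V i) = i) \<and>
     (\<forall>i\<in>{1..<n}. V i \<subset> V (i + 1))}"

text \<open>
  The flag of the coset \<open>M B\<close>. Subsets of \<open>GL\<^sub>n / B\<close> are represented by the corresponding sets of
  flags.
\<close>

definition flag_of :: "nat \<Rightarrow> complex mat \<Rightarrow> nat \<Rightarrow> complex vec set" where
  "flag_of n M = (\<lambda>i\<in>{1..n}. span_vec n ((\<lambda>j. col M (j - 1)) ` {1..i}))"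

definition hess :: "nat \<Rightarrow> complex mat \<Rightarrow> (nat \<Rightarrow> nat) \<Rightarrow> (nat \<Rightarrow> complex vec set) set" where
  "hess n A h = flag_of n ` {M \<in> carrier_mat n n.
     \<exists>M'\<in>carrier_mat n n. inverts_mat M M' \<and> inverts_mat M' M \<and> M' * A * M \<in> hessenberg_space n h}"

definition dual_flag :: "nat \<Rightarrow> nat \<Rightarrow> complex vec set" where
  "dual_flag n j = span_vec n ((\<lambda>k. unit_vec n (k - 1)) ` {n + 1 - j..n})"

definition dual_schubert :: "nat \<Rightarrow> (nat \<Rightarrow> nat) \<Rightarrow> (nat \<Rightarrow> complex vec set) set" where
  "dual_schubert n w = {V \<in> flags n. \<forall>p\<in>{1..n}. \<forall>q\<in>{1..n}.
     card {i \<in> {1..p}. q + 1 \<le> w i} \<le> subspace_dim n (V p \<inter> dual_flag n (n - q))}"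


section \<open>The chart around the longest element\<close>

definition longest :: "nat \<Rightarrow> nat \<Rightarrow> nat" where
  "longest n i = (if i \<in> {1..n} then n + 1 - i else i)"

definition perm_matrix :: "nat \<Rightarrow> (nat \<Rightarrow> nat) \<Rightarrow> complex mat" where
  "perm_matrix n w = mat n n (\<lambda>(i, j). if i + 1 = w (j + 1) then 1 else 0)"

definition chart_matrices :: "nat \<Rightarrow> complex mat set" where
  "chart_matrices n = {X \<in> carrier_mat n n.
     (\<forall>i\<in>{1..n}. entry X i (n + 1 - i) = 1) \<and>
     (\<forall>i\<in>{1..n}. \<forall>j\<in>{1..n}. n + 1 < i + j \<longrightarrow> entry X i j = 0)}"

definition chart :: "nat \<Rightarrow> (nat \<Rightarrow> complex vec set) set" where
  "chart n = flag_of n ` chart_matrices n"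

definition num_coords :: "nat \<Rightarrow> nat" where
  "num_coords n = n * (n - 1) div 2"

text \<open>The positions \<open>(1,1), \<dots>, (1,n-1), (2,1), \<dots>, (2,n-2), \<dots>, (n-1,1)\<close>, in this order.\<close>

definition positions :: "nat \<Rightarrow> (nat \<times> nat) list" where
  "positions n = concat (map (\<lambda>i. map (\<lambda>j. (i, j)) [1..<n + 1 - i]) [1..<n])"

text \<open>
  The coordinates \<open>x\<^bsub>i,j\<^esub>\<close>, \<open>i + j \<le> n\<close>, listed in the order of \<^const>\<open>positions\<close>. They identify the
  chart with affine space, and through them every subset of the chart is viewed as a subset of
  affine space; the geometry of such subsets is defined on that side.
\<close>

definition coordinates :: "nat \<Rightarrow> complex mat \<Rightarrow> complex vec" where
  "coordinates n X = vec (num_coords n) (\<lambda>k. case positions n ! k of (i, j) \<Rightarrow> entry X i j)"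

definition in_coords :: "nat \<Rightarrow> (nat \<Rightarrow> complex vec set) set \<Rightarrow> complex vec set" where
  "in_coords n Z = coordinates n ` {X \<in> chart_matrices n. flag_of n X \<in> Z}"

text \<open>\<open>jordan_block n 0\<close> is the nilpotent matrix with ones on the superdiagonal.\<close>

definition hess_chart :: "nat \<Rightarrow> (nat \<Rightarrow> nat) \<Rightarrow> (nat \<Rightarrow> complex vec set) set" where
  "hess_chart n h = hess n (jordan_block n 0) h \<inter> chart n"

definition nonfree_positions :: "nat \<Rightarrow> (nat \<Rightarrow> nat) \<Rightarrow> (nat \<times> nat) set" where
  "nonfree_positions n h = {(i, j). i \<in> {1..n - 1} \<and> j \<in> {1..n - 1} \<and> i \<in> {2..n + 1 - h j}}"

definition free_positions :: "nat \<Rightarrow> (nat \<Rightarrow> nat) \<Rightarrow> (nat \<times> nat) set" where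
  "free_positions n h = {(i, j). 1 \<le> i \<and> 1 \<le> j \<and> i + j \<le> n} - nonfree_positions n h"


section \<open>The sequence of permutations and diagrams\<close>

definition diagram :: "nat \<Rightarrow> (nat \<Rightarrow> nat) \<Rightarrow> (nat \<times> nat) set" where
  "diagram n w = {1..n} \<times> {1..n} -
     (\<Union>k\<in>{1..n}. let r = inv_into UNIV w k
       in {(i, j). i = r \<and> k \<le> j} \<union> {(i, j). j = k \<and> r \<le> i})"

definition corners :: "(nat \<times> nat) set \<Rightarrow> (nat \<times> nat) set" where
  "corners Y = {(i, j) \<in> Y. (i + 1, j) \<notin> Y \<and> (i, j + 1) \<notin> Y}"

definition lowest_corner :: "(nat \<times> nat) set \<Rightarrow> nat \<times> nat" where
  "lowest_corner Y = (THE c. c \<in> corners Y \<and> (\<forall>c'\<in>corners Y. fst c' \<le> fst c))"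

text \<open>The word \<open>(s\<^sub>1)(s\<^sub>2 s\<^sub>1) \<dots> (s\<^bsub>n-1\<^esub> \<dots> s\<^sub>2 s\<^sub>1)\<close>, given by the indices of its letters.\<close>

definition full_word :: "nat \<Rightarrow> nat list" where
  "full_word n = concat (map (\<lambda>k. rev [1..<k + 1]) [1..<n])"

text \<open>Products are composed from left to right: the left-most letter acts first.\<close>

definition word_perm :: "nat list \<Rightarrow> nat \<Rightarrow> nat" where
  "word_perm ks = foldl (\<lambda>v k. Transposition.transpose k (k + 1) \<circ> v) id ks"

definition u_perm :: "nat \<Rightarrow> nat \<Rightarrow> nat \<Rightarrow> nat" where
  "u_perm n l = word_perm (drop (num_coords n - l) (full_word n))"

definition stratum :: "nat \<Rightarrow> (nat \<Rightarrow> nat) \<Rightarrow> nat \<Rightarrow> (nat \<Rightarrow> complex vec set) set" where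
  "stratum n h l = dual_schubert n (u_perm n l) \<inter> hess_chart n h"

end

(*
  On the chart, the condition N X_j in span(X_1, ..., X_h(j)) solves each non-free coordinate
  x_(i+1,j) as a polynomial sum_t c_t x_(i,t) over j < t <= h(j), where the c_t involve only columns to the
  right of j and free entries of column j. So the Hessenberg chart is the graph of a polynomial map over the
  space of free coordinates. The Schubert condition for u_l on the chart says that the first l coordinates
  vanish, by a rank count. When the next coordinate is non-free, all x_(i,t) in its equation are already
  zero, so it vanishes automatically; when it is free, it is one more independent linear equation.
  Hence every stratum is a graph over a coordinate subspace. That affine d-space has Krull dimension d
  is proved with algebraically independent polynomial functions.
*)
theory Submission
  imports Defs
begin

section \<open>Polynomial functions and algebraic independence\<close>

text \<open>One inequality makes the bookkeeping work. If i \<le> n - h(j) and t \<le> h(j), then i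
  + t \<le> n, so every x_(i,t) in the equation of x_(i+1,j) is a genuine coordinate, never a 1 of
  the antidiagonal, and it stands one row higher, hence earlier in the list of positions. The same
  equations are solved in another order, by columns from the right: the coefficient c_t is read off
  in row n + 1 - t and brings in x_(n+2-t,j), whose row lies below the last non-free row n + 1 -
  h(j) of column j. Indecomposability guarantees that each solved entry (i+1,j) lies strictly above
  the antidiagonal.

  The obstacle is dimension theory: Krull dimension is defined by chains of irreducible closed sets,
  so an upper bound has to control arbitrary chains. Each proper inclusion yields one more
  independent function, and more than d functions on affine d-space are dependent because there are
  too few monomials of bounded degree. The lower bound uses coordinate slices through a prescribed
  point, so that the same chain also gives the local dimension needed for non-singularity.\<close>

lemma poly_funs_sum:
  "finite A \<Longrightarrow> (\<And>a. a \<in> A \<Longrightarrow> f a \<in> poly_funs m) \<Longrightarrow> (\<lambda>x. \<Sum>a\<in>A. f a x) \<in> poly_funs m"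
  by (induction A rule: finite_induct) (auto intro: poly_funs.const poly_funs.add)

lemma poly_funs_power: "f \<in> poly_funs m \<Longrightarrow> (\<lambda>x. f x ^ e) \<in> poly_funs m"
  by (induction e) (auto intro: poly_funs.const poly_funs.mult)

lemma poly_funs_prod:
  "finite A \<Longrightarrow> (\<And>a. a \<in> A \<Longrightarrow> f a \<in> poly_funs m) \<Longrightarrow> (\<lambda>x. \<Prod>a\<in>A. f a x) \<in> poly_funs m"
  by (induction A rule: finite_induct) (auto intro: poly_funs.const poly_funs.mult)

lemma poly_funs_diff:
  assumes "f \<in> poly_funs m" "g \<in> poly_funs m"
  shows "(\<lambda>x. f x - g x) \<in> poly_funs m"
proof -
  have "(\<lambda>x. f x + (- 1) * g x) \<in> poly_funs m"
    by (intro poly_funs.add poly_funs.mult poly_funs.const assms)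
  then show ?thesis by simp
qed

lemma poly_funs_comp:
  assumes "f \<in> poly_funs m" "\<And>k. k < m \<Longrightarrow> G k \<in> poly_funs d"
  shows "(\<lambda>y. f (vec m (\<lambda>k. G k y))) \<in> poly_funs d"
  using assms(1)
proof induction
  case (coord i)
  then show ?case using assms(2)[of i] by simp
qed (auto intro: poly_funs.intros)

lemma poly_funs_cong:
  assumes "f \<in> poly_funs m" "\<And>i. i < m \<Longrightarrow> x $ i = y $ i"
  shows "f x = f y"
  using assms(1) by induction (auto simp: assms(2))

text \<open>Restriction to a polynomial curve reduces questions about several variables to
  univariate polynomials, for which degree and absence of zero divisors are available.\<close>

lemma poly_funs_along_curve:
  assumes "f \<in> poly_funs m" "\<And>i. i < m \<Longrightarrow> \<exists>r. \<forall>t. \<gamma> t $ i = poly r t"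
  shows "\<exists>r. \<forall>t. f (\<gamma> t) = poly r t"
  using assms(1)
proof induction
  case (const c)
  show ?case by (rule exI[of _ "[:c:]"]) simp
next
  case (coord i)
  then show ?case using assms(2) by simp
next
  case (add f g)
  then show ?case by (metis poly_add)
next
  case (mult f g)
  then show ?case by (metis poly_mult)
qed

text \<open>On the line joining a point where \<open>f\<close> does not vanish to a point where
  \<open>g\<close> does not vanish, both functions become non-zero univariate polynomials, and the
  product of these is not zero.\<close>

lemma poly_funs_no_zero_divisors:
  assumes f: "f \<in> poly_funs d" and g: "g \<in> poly_funs d"
    and fg: "\<And>y. y \<in> carrier_vec d \<Longrightarrow> f y * g y = 0"
  shows "(\<forall>y\<in>carrier_vec d. f y = 0) \<or> (\<forall>y\<in>carrier_vec d. g y = 0)"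
proof (rule ccontr)
  assume "\<not> ?thesis"
  then obtain p q where p: "p \<in> carrier_vec d" "f p \<noteq> 0" and q: "q \<in> carrier_vec d" "g q \<noteq> 0"
    by blast
  define \<gamma> where "\<gamma> t = vec d (\<lambda>i. p $ i + t * (q $ i - p $ i))" for t
  have curve: "\<exists>r. \<forall>t. \<gamma> t $ i = poly r t" if "i < d" for i
    using that by (intro exI[of _ "[:p $ i, q $ i - p $ i:]"]) (simp add: \<gamma>_def)
  obtain a where a: "\<And>t. f (\<gamma> t) = poly a t"
    using poly_funs_along_curve[OF f curve] by blast
  obtain b where b: "\<And>t. g (\<gamma> t) = poly b t"
    using poly_funs_along_curve[OF g curve] by blast
  have ends: "\<gamma> 0 = p" "\<gamma> 1 = q"
    using p(1) q(1) by (auto simp: \<gamma>_def)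
  have "a \<noteq> 0" "b \<noteq> 0"
    using a[of 0] b[of 1] p q by (auto simp: ends)
  moreover have "poly (a * b) t = 0" for t
    using fg[of "\<gamma> t"] by (simp flip: a b add: \<gamma>_def)
  then have "a * b = 0" using poly_all_0_iff_0 by blast
  ultimately show False by simp
qed

section \<open>Irreducible sets in the Zariski topology\<close>

lemma closedin_subtopology_zariski:
  "closedin (subtopology (zariski m) S) Z \<longleftrightarrow> (\<exists>F \<subseteq> poly_funs m. Z = zero_locus m F \<inter> S)"
  by (auto simp: closedin_subtopology closedin_zariski)

text \<open>If the image were covered by two proper closed subsets, one polynomial from each would
  pull back to a non-zero function on affine space, while the product of the two pullbacks vanishes
  everywhere.\<close>

lemma irreducible_image:
  assumes G: "\<And>k. k < m \<Longrightarrow> G k \<in> poly_funs d"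
  shows "irreducible_space (subtopology (zariski m) ((\<lambda>y. vec m (\<lambda>k. G k y)) ` carrier_vec d))"
    (is "irreducible_space (subtopology _ (?\<phi> ` _))")
proof -
  have top: "topspace (subtopology (zariski m) (?\<phi> ` carrier_vec d)) = ?\<phi> ` carrier_vec d"
    by (auto simp: topspace_zariski)
  have ne: "carrier_vec d \<noteq> ({} :: complex vec set)"
    using zero_carrier_vec by blast
  show ?thesis
    unfolding irreducible_space_def top
  proof (intro conjI allI impI)
    show "?\<phi> ` carrier_vec d \<noteq> {}" using ne by blast
  next
    fix A B
    assume *: "closedin (subtopology (zariski m) (?\<phi> ` carrier_vec d)) A \<and>
      closedin (subtopology (zariski m) (?\<phi> ` carrier_vec d)) B \<and> A \<union> B = ?\<phi> ` carrier_vec d"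
    then obtain F H where F: "F \<subseteq> poly_funs m" "A = zero_locus m F \<inter> ?\<phi> ` carrier_vec d"
      and H: "H \<subseteq> poly_funs m" "B = zero_locus m H \<inter> ?\<phi> ` carrier_vec d"
      unfolding closedin_subtopology_zariski by blast
    show "A = ?\<phi> ` carrier_vec d \<or> B = ?\<phi> ` carrier_vec d"
    proof (rule ccontr)
      assume "\<not> ?thesis"
      then obtain p q where p: "p \<in> carrier_vec d" "?\<phi> p \<notin> A" and q: "q \<in> carrier_vec d" "?\<phi> q \<notin> B"
        using F(2) H(2) by blast
      obtain f where f: "f \<in> F" "f (?\<phi> p) \<noteq> 0"
        using p F(2) by (auto simp: zero_locus_def)
      obtain h where h: "h \<in> H" "h (?\<phi> q) \<noteq> 0"
        using q H(2) by (auto simp: zero_locus_def)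
      have "f (?\<phi> y) * h (?\<phi> y) = 0" if "y \<in> carrier_vec d" for y
      proof -
        have "?\<phi> y \<in> A \<or> ?\<phi> y \<in> B" using * that by blast
        then show ?thesis using f(1) h(1) F(2) H(2) by (auto simp: zero_locus_def)
      qed
      then have "(\<forall>y\<in>carrier_vec d. f (?\<phi> y) = 0) \<or> (\<forall>y\<in>carrier_vec d. h (?\<phi> y) = 0)"
        using poly_funs_no_zero_divisors[OF poly_funs_comp poly_funs_comp, of f m G d h m G] f(1) h(1) F(1) H(1) G
        by blast
      then show False using f h p q by blast
    qed
  qed
qed

text \<open>The zero sets of \<open>f\<close> and of \<open>g\<close> in \<open>Z\<close> are closed
  and cover \<open>Z\<close>, so one of them is all of \<open>Z\<close>.\<close>

lemma irreducible_no_zero_divisors: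
  assumes irr: "irreducible_space (subtopology (zariski m) Z)" and Z: "Z \<subseteq> carrier_vec m"
    and f: "f \<in> poly_funs m" and g: "g \<in> poly_funs m" and fg: "\<And>z. z \<in> Z \<Longrightarrow> f z * g z = 0"
  shows "(\<forall>z\<in>Z. f z = 0) \<or> (\<forall>z\<in>Z. g z = 0)"
proof -
  have top: "topspace (subtopology (zariski m) Z) = Z"
    using Z by (auto simp: topspace_zariski)
  have cl: "closedin (subtopology (zariski m) Z) (zero_locus m {h} \<inter> Z)" if "h \<in> poly_funs m" for h
    unfolding closedin_subtopology_zariski using that by blast
  have "(zero_locus m {f} \<inter> Z) \<union> (zero_locus m {g} \<inter> Z) = Z"
    using fg Z by (fastforce simp: zero_locus_def)
  then have "zero_locus m {f} \<inter> Z = Z \<or> zero_locus m {g} \<inter> Z = Z"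
    using irr cl[OF f] cl[OF g] unfolding irreducible_space_def top by blast
  then show ?thesis by (auto simp: zero_locus_def)
qed

text \<open>A relation counts as trivial when it vanishes as a function on affine
  \<open>r\<close>-space. For \<open>r = 0\<close> the condition says exactly that \<open>Z\<close>
  is non-empty.\<close>

definition alg_indep :: "nat \<Rightarrow> (nat \<Rightarrow> complex vec \<Rightarrow> complex) \<Rightarrow> complex vec set \<Rightarrow> bool" where
  "alg_indep r f Z \<longleftrightarrow>
     (\<forall>a\<in>poly_funs r. (\<forall>z\<in>Z. a (vec r (\<lambda>i. f i z)) = 0) \<longrightarrow> (\<forall>y\<in>carrier_vec r. a y = 0))"

text \<open>With \<open>y\<close> fixed, the last entry \<open>t\<close> parametrizes a line; a
  polynomial function becomes a univariate polynomial in \<open>t\<close>, whose degree is the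
  degree in the last variable.\<close>

definition snoc_vec :: "nat \<Rightarrow> complex vec \<Rightarrow> complex \<Rightarrow> complex vec" where
  "snoc_vec r y t = vec (Suc r) (\<lambda>i. if i < r then y $ i else t)"

lemma snoc_vec_last [simp]: "snoc_vec r y t $ r = t"
  by (simp add: snoc_vec_def)

lemma snoc_vec_cases:
  assumes "x \<in> carrier_vec (Suc r)"
  obtains y t where "y \<in> carrier_vec r" "x = snoc_vec r y t"
proof
  show "vec r (\<lambda>i. x $ i) \<in> carrier_vec r" by simp
  show "x = snoc_vec r (vec r (\<lambda>i. x $ i)) (x $ r)"
    using assms by (auto simp: snoc_vec_def less_Suc_eq)
qed

lemma snoc_vec_curve: "i < Suc r \<Longrightarrow> \<exists>p. \<forall>t. snoc_vec r y t $ i = poly p t"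
  by (cases "i < r") (auto simp: snoc_vec_def intro: exI[of _ "[:y $ i:]"] exI[of _ "[:0, 1:]"])

text \<open>The bound \<open>N\<close> must not depend on \<open>y\<close>: it is the quantity on
  which a relation between functions is later reduced by induction.\<close>

lemma poly_funs_snoc_degree:
  assumes "a \<in> poly_funs (Suc r)"
  shows "\<exists>N. \<forall>y. \<exists>p. degree p \<le> N \<and> (\<forall>t. a (snoc_vec r y t) = poly p t)"
  using assms
proof induction
  case (const c)
  show ?case by (rule exI[of _ 0]) (auto intro: exI[of _ "[:c:]"])
next
  case (coord i)
  have "\<exists>p. degree p \<le> 1 \<and> (\<forall>t. snoc_vec r y t $ i = poly p t)" for y
    using coord by (cases "i < r") (auto simp: snoc_vec_def intro: exI[of _ "[:y $ i:]"] exI[of _ "[:0, 1:]"])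
  then show ?case by blast
next
  case (add f g)
  then obtain N M where "\<forall>y. \<exists>p. degree p \<le> N \<and> (\<forall>t. f (snoc_vec r y t) = poly p t)"
    "\<forall>y. \<exists>p. degree p \<le> M \<and> (\<forall>t. g (snoc_vec r y t) = poly p t)" by blast
  then have "\<forall>y. \<exists>p. degree p \<le> max N M \<and> (\<forall>t. f (snoc_vec r y t) + g (snoc_vec r y t) = poly p t)"
    by (metis degree_add_le max.coboundedI1 max.coboundedI2 poly_add)
  then show ?case by blast
next
  case (mult f g)
  then obtain N M where "\<forall>y. \<exists>p. degree p \<le> N \<and> (\<forall>t. f (snoc_vec r y t) = poly p t)"
    "\<forall>y. \<exists>p. degree p \<le> M \<and> (\<forall>t. g (snoc_vec r y t) = poly p t)" by blast
  then have "\<forall>y. \<exists>p. degree p \<le> N + M \<and> (\<forall>t. f (snoc_vec r y t) * g (snoc_vec r y t) = poly p t)"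
    by (metis degree_mult_le add_mono le_trans poly_mult)
  then show ?case by blast
qed

lemma poly_funs_Suc_mono: "a \<in> poly_funs r \<Longrightarrow> a \<in> poly_funs (Suc r)"
  by (induction rule: poly_funs.induct) (auto intro: poly_funs.intros)

text \<open>Division with remainder by the last variable. That the remainder \<open>a0\<close> lies
  in \<open>poly_funs r\<close> expresses that it does not read coordinate \<open>r\<close>.\<close>

lemma poly_funs_split_last:
  assumes "a \<in> poly_funs (Suc r)"
  shows "\<exists>a0 b. a0 \<in> poly_funs r \<and> b \<in> poly_funs (Suc r) \<and> (\<forall>x. a x = a0 x + x $ r * b x)"
  using assms
proof induction
  case (const c)
  show ?case by (intro exI[of _ "\<lambda>x. c"] exI[of _ "\<lambda>x. 0"]) (auto intro: poly_funs.const)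
next
  case (coord i)
  show ?case
  proof (cases "i = r")
    case True
    then show ?thesis by (intro exI[of _ "\<lambda>x. 0"] exI[of _ "\<lambda>x. 1"]) (auto intro: poly_funs.const)
  next
    case False
    with coord show ?thesis
      by (intro exI[of _ "\<lambda>x. x $ i"] exI[of _ "\<lambda>x. 0"]) (auto intro: poly_funs.const poly_funs.coord)
  qed
next
  case (add f g)
  then obtain f0 f1 g0 g1 where
    f: "f0 \<in> poly_funs r" "f1 \<in> poly_funs (Suc r)" "\<And>x. f x = f0 x + x $ r * f1 x" and
    g: "g0 \<in> poly_funs r" "g1 \<in> poly_funs (Suc r)" "\<And>x. g x = g0 x + x $ r * g1 x" by metis
  show ?case
    by (intro exI[of _ "\<lambda>x. f0 x + g0 x"] exI[of _ "\<lambda>x. f1 x + g1 x"])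
      (auto intro: poly_funs.intros f g simp: f(3) g(3) algebra_simps)
next
  case (mult f g)
  then obtain f0 f1 g0 g1 where
    f: "f0 \<in> poly_funs r" "f1 \<in> poly_funs (Suc r)" "\<And>x. f x = f0 x + x $ r * f1 x" and
    g: "g0 \<in> poly_funs r" "g1 \<in> poly_funs (Suc r)" "\<And>x. g x = g0 x + x $ r * g1 x" by metis
  show ?case
  proof (intro exI conjI allI)
    show "(\<lambda>x. f0 x * g0 x) \<in> poly_funs r"
      by (intro poly_funs.mult f g)
    show "(\<lambda>x. f1 x * g x + f0 x * g1 x) \<in> poly_funs (Suc r)"
      by (intro poly_funs.add poly_funs.mult poly_funs_Suc_mono[OF f(1)] f(2) g(2) mult.hyps)
    show "f x * g x = f0 x * g0 x + x $ r * (f1 x * g x + f0 x * g1 x)" for x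
      unfolding f(3) g(3) by (simp add: algebra_simps)
  qed
qed

text \<open>
  Every proper inclusion of irreducible closed sets raises the transcendence degree: a function \<open>g\<close>
  vanishing on the smaller set can be adjoined. In a relation between \<open>f\<close> and \<open>g\<close> the part constant
  in \<open>g\<close> is a relation between the \<open>f i\<close> on the smaller set, hence zero, and then \<open>g\<close> can be cancelled;
  this lowers the degree in \<open>g\<close>.
\<close>

lemma alg_indep_extend:
  assumes indep: "alg_indep r f Z" and f: "\<And>i. i < r \<Longrightarrow> f i \<in> poly_funs m"
    and ZZ': "Z \<subseteq> Z'" "Z' \<subseteq> carrier_vec m"
    and irr: "irreducible_space (subtopology (zariski m) Z')"
    and g: "g \<in> poly_funs m" "\<And>z. z \<in> Z \<Longrightarrow> g z = 0" "w \<in> Z'" "g w \<noteq> 0"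
  shows "alg_indep (Suc r) (f(r := g)) Z'"
proof -
  let ?F = "\<lambda>z. snoc_vec r (vec r (\<lambda>i. f i z)) (g z)"
  have F: "vec (Suc r) (\<lambda>i. (f(r := g)) i z) = ?F z" for z
    by (auto simp: snoc_vec_def less_Suc_eq)
  have main: "\<forall>y\<in>carrier_vec r. \<forall>t. a (snoc_vec r y t) = 0"
    if "a \<in> poly_funs (Suc r)" "\<forall>y. \<exists>p. degree p \<le> N \<and> (\<forall>t. a (snoc_vec r y t) = poly p t)"
      "\<forall>z\<in>Z'. a (?F z) = 0" for a N
    using that
  proof (induction N arbitrary: a)
    case (0 a)
    obtain a0 b where ab: "a0 \<in> poly_funs r" "b \<in> poly_funs (Suc r)" "\<And>x. a x = a0 x + x $ r * b x"
      using poly_funs_split_last[OF 0(1)] by blast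
    have a0: "a0 (snoc_vec r y t) = a0 y" for y t
      by (rule poly_funs_cong[OF ab(1)]) (simp add: snoc_vec_def)
    have "a0 (vec r (\<lambda>i. f i z)) = 0" if "z \<in> Z" for z
    proof -
      have "z \<in> Z'" using that ZZ'(1) by blast
      then have "a (?F z) = 0" using 0(3) by blast
      then show ?thesis using g(2)[OF that] ab(3)[of "?F z"] by (simp add: a0)
    qed
    then have a0z: "a0 y = 0" if "y \<in> carrier_vec r" for y
      using indep[unfolded alg_indep_def, rule_format, OF ab(1)] that by simp
    show ?case
    proof (intro ballI allI)
      fix y :: "complex vec" and t assume y: "y \<in> carrier_vec r"
      obtain p where p: "degree p = 0" "\<And>t. a (snoc_vec r y t) = poly p t"
        using 0(2) by (metis le_zero_eq)
      moreover obtain c where "p = [:c:]" using p(1) degree_eq_zeroE by blast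
      ultimately have "a (snoc_vec r y t) = a (snoc_vec r y 0)" by simp
      also have "\<dots> = 0" using a0z[OF y] ab(3) a0 by simp
      finally show "a (snoc_vec r y t) = 0" .
    qed
  next
    case (Suc N a)
    obtain a0 b where ab: "a0 \<in> poly_funs r" "b \<in> poly_funs (Suc r)" "\<And>x. a x = a0 x + x $ r * b x"
      using poly_funs_split_last[OF Suc(2)] by blast
    have a0: "a0 (snoc_vec r y t) = a0 y" for y t
      by (rule poly_funs_cong[OF ab(1)]) (simp add: snoc_vec_def)
    have "a0 (vec r (\<lambda>i. f i z)) = 0" if "z \<in> Z" for z
    proof -
      have "z \<in> Z'" using that ZZ'(1) by blast
      then have "a (?F z) = 0" using Suc(4) by blast
      then show ?thesis using g(2)[OF that] ab(3)[of "?F z"] by (simp add: a0)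
    qed
    then have a0z: "a0 y = 0" if "y \<in> carrier_vec r" for y
      using indep[unfolded alg_indep_def, rule_format, OF ab(1)] that by simp
    have at: "a (snoc_vec r y t) = t * b (snoc_vec r y t)" if "y \<in> carrier_vec r" for y t
      using a0z[OF that] ab(3) a0 by simp
    have bF: "(\<lambda>z. b (vec (Suc r) (\<lambda>i. (f(r := g)) i z))) \<in> poly_funs m"
      by (rule poly_funs_comp[OF ab(2)]) (auto simp: less_Suc_eq f g)
    have "g z * b (?F z) = 0" if "z \<in> Z'" for z
      using Suc(4) that at by simp
    then have bz: "\<forall>z\<in>Z'. b (?F z) = 0"
      using irreducible_no_zero_divisors[OF irr ZZ'(2) g(1) bF] g(3,4) F by auto
    \<comment> \<open>\<open>snoc_vec\<close> reads only the first \<open>r\<close> entries of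
      \<open>y\<close>, so an arbitrary \<open>y\<close> may be replaced by a vector of length
      \<open>r\<close>, for which the factorization \<open>at\<close> is available.\<close>
    have carr: "snoc_vec r y t = snoc_vec r (vec r (\<lambda>i. y $ i)) t" for y t
      by (auto simp: snoc_vec_def)
    have bdeg: "\<exists>p. degree p \<le> N \<and> (\<forall>t. b (snoc_vec r y t) = poly p t)" for y
    proof -
      let ?y = "vec r (\<lambda>i. y $ i)"
      obtain p where p: "degree p \<le> Suc N" "\<And>t. a (snoc_vec r ?y t) = poly p t"
        using Suc(3) by blast
      obtain q where q: "\<And>t. b (snoc_vec r ?y t) = poly q t"
        using poly_funs_along_curve[OF ab(2) snoc_vec_curve] by blast
      have "poly p t = poly (pCons 0 q) t" for t
        using at[of ?y t] p(2) q by simp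
      then have "p = pCons 0 q" by (simp add: poly_eq_poly_eq_iff[symmetric] fun_eq_iff)
      then have "degree q \<le> N" using p(1) by (auto split: if_splits)
      moreover have "\<forall>t. b (snoc_vec r y t) = poly q t" using q by (simp flip: carr)
      ultimately show ?thesis by blast
    qed
    have "\<forall>y\<in>carrier_vec r. \<forall>t. b (snoc_vec r y t) = 0"
      by (rule Suc(1)[OF ab(2) _ bz]) (use bdeg in blast)
    then show ?case using at by simp
  qed
  show ?thesis
    unfolding alg_indep_def F
  proof (intro ballI impI)
    fix a and x :: "complex vec"
    assume a: "a \<in> poly_funs (Suc r)" "\<forall>z\<in>Z'. a (?F z) = 0" and x: "x \<in> carrier_vec (Suc r)"
    obtain N where "\<forall>y. \<exists>p. degree p \<le> N \<and> (\<forall>t. a (snoc_vec r y t) = poly p t)"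
      using poly_funs_snoc_degree[OF a(1)] by blast
    from main[OF a(1) this a(2)] show "a x = 0"
      using x by (metis snoc_vec_cases)
  qed
qed

section \<open>Krull dimension of affine space\<close>

text \<open>Gaussian elimination, by induction on the equations: a pivot in equation
  \<open>b\<close> removes the unknown \<open>p\<close> from the others, the smaller system still
  has more unknowns than equations, and the value of \<open>p\<close> is then recovered from
  equation \<open>b\<close>.\<close>

lemma homogeneous_system_nontrivial:
  fixes A :: "'b \<Rightarrow> 'k \<Rightarrow> complex"
  assumes "finite B" "finite J" "card B < card J"
  shows "\<exists>c. (\<exists>k\<in>J. c k \<noteq> 0) \<and> (\<forall>b\<in>B. (\<Sum>k\<in>J. A b k * c k) = 0)"
  using assms
proof (induction B arbitrary: J A rule: finite_induct)
  case empty
  then obtain k where "k \<in> J" by (metis card.empty card_gt_0_iff ex_in_conv)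
  then show ?case by (intro exI[of _ "\<lambda>_. 1"]) auto
next
  case (insert b B J A)
  show ?case
  proof (cases "\<forall>k\<in>J. A b k = 0")
    case True
    obtain c where "\<exists>k\<in>J. c k \<noteq> 0" "\<forall>b\<in>B. (\<Sum>k\<in>J. A b k * c k) = 0"
      using insert.IH[of J A] insert.prems insert.hyps by auto
    with True show ?thesis by (intro exI[of _ c]) simp
  next
    case False
    then obtain p where p: "p \<in> J" "A b p \<noteq> 0" by blast
    let ?J = "J - {p}"
    let ?A = "\<lambda>b' k. A b' k - A b' p * A b k / A b p"
    have "card B < card ?J"
      using insert.prems insert.hyps p by (simp add: card_Diff_singleton)
    then obtain c where c: "\<exists>k\<in>?J. c k \<noteq> 0" "\<forall>b'\<in>B. (\<Sum>k\<in>?J. ?A b' k * c k) = 0"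
      using insert.IH[of ?J ?A] insert.prems by auto
    define s where "s = (\<Sum>k\<in>?J. A b k * c k)"
    define c' where "c' = c(p := - s / A b p)"
    have split: "(\<Sum>k\<in>J. A b' k * c' k) = A b' p * (- s / A b p) + (\<Sum>k\<in>?J. A b' k * c k)" for b'
    proof -
      have "(\<Sum>k\<in>J. A b' k * c' k) = A b' p * c' p + (\<Sum>k\<in>?J. A b' k * c' k)"
        by (rule sum.remove) (use insert.prems p in auto)
      moreover have "(\<Sum>k\<in>?J. A b' k * c' k) = (\<Sum>k\<in>?J. A b' k * c k)"
        by (rule sum.cong) (auto simp: c'_def)
      ultimately show ?thesis by (simp add: c'_def)
    qed
    have "(\<Sum>k\<in>J. A b' k * c' k) = 0" if "b' \<in> B" for b'
    proof -
      have "(\<Sum>k\<in>?J. ?A b' k * c k) = (\<Sum>k\<in>?J. A b' k * c k) - A b' p / A b p * s"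
        by (simp add: s_def sum_distrib_left left_diff_distrib sum_subtractf algebra_simps)
      then show ?thesis using c(2) that split[of b'] by (simp add: field_simps)
    qed
    moreover have "(\<Sum>k\<in>J. A b k * c' k) = 0"
      using split[of b] p(2) by (simp add: s_def)
    moreover have "\<exists>k\<in>J. c' k \<noteq> 0" using c(1) by (auto simp: c'_def)
    ultimately show ?thesis by blast
  qed
qed

section \<open>Linear spans of functions and the count of monomials\<close>

inductive_set fun_span :: "(complex vec \<Rightarrow> complex) set \<Rightarrow> (complex vec \<Rightarrow> complex) set"
  for B where
  zero: "(\<lambda>x. 0) \<in> fun_span B"
| step: "b \<in> B \<Longrightarrow> f \<in> fun_span B \<Longrightarrow> (\<lambda>x. c * b x + f x) \<in> fun_span B"

lemma fun_span_base: "b \<in> B \<Longrightarrow> b \<in> fun_span B"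
  using fun_span.step[of b B "\<lambda>x. 0" 1] fun_span.zero by simp

lemma fun_span_mono: "f \<in> fun_span B \<Longrightarrow> B \<subseteq> C \<Longrightarrow> f \<in> fun_span C"
  by (induction rule: fun_span.induct) (auto intro: fun_span.intros)

lemma fun_span_add:
  assumes "f \<in> fun_span B" "g \<in> fun_span B"
  shows "(\<lambda>x. f x + g x) \<in> fun_span B"
  using assms(1)
proof induction
  case (step b f c)
  then show ?case using fun_span.step[of b B "\<lambda>x. f x + g x" c] by (simp add: add.assoc)
qed (use assms(2) in simp)

lemma fun_span_scale: "f \<in> fun_span B \<Longrightarrow> (\<lambda>x. c * f x) \<in> fun_span B"
proof (induction rule: fun_span.induct)
  case (step b f c')
  then show ?case using fun_span.step[of b B "\<lambda>x. c * f x" "c * c'"] by (simp add: algebra_simps)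
qed (simp add: fun_span.zero)

lemma fun_span_mult:
  assumes "f \<in> fun_span B" "g \<in> fun_span C"
    and BC: "\<And>b c. b \<in> B \<Longrightarrow> c \<in> C \<Longrightarrow> (\<lambda>x. b x * c x) \<in> D"
  shows "(\<lambda>x. f x * g x) \<in> fun_span D"
  using assms(1)
proof induction
  case zero
  show ?case by (simp add: fun_span.zero)
next
  case (step b f c)
  have "(\<lambda>x. b x * g x) \<in> fun_span D"
    using assms(2)
  proof induction
    case zero
    show ?case by (simp add: fun_span.zero)
  next
    case (step c' g a)
    then show ?case
      using fun_span.step[OF BC[OF \<open>b \<in> B\<close> step(1)], of "\<lambda>x. b x * g x" a] by (simp add: algebra_simps)
  qed
  from fun_span_add[OF fun_span_scale[OF this, of c] step(3)]
  show ?case by (simp add: algebra_simps)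
qed

lemma fun_span_coefficients:
  assumes "finite B" "f \<in> fun_span B"
  shows "\<exists>c. \<forall>x. f x = (\<Sum>b\<in>B. c b * b x)"
  using assms(2)
proof induction
  case zero
  show ?case by (rule exI[of _ "\<lambda>_. 0"]) simp
next
  case (step b f a)
  then obtain c where c: "\<And>x. f x = (\<Sum>b\<in>B. c b * b x)" by blast
  have "a * b x + f x = (\<Sum>b'\<in>B. (c(b := c b + a)) b' * b' x)" for x
    using assms(1) step(1) by (simp add: c sum.remove[of B b] algebra_simps)
  then show ?case by blast
qed

text \<open>The coefficients with respect to \<open>B\<close> form a homogeneous system of
  \<open>card B\<close> equations in \<open>card K\<close> unknowns. The relation is indexed by
  \<open>K\<close> and not by the functions themselves, so two indices with the same function also
  count as dependent.\<close>

lemma fun_span_dependent: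
  assumes B: "finite B" "card B < card K" "finite K" and g: "\<And>k. k \<in> K \<Longrightarrow> g k \<in> fun_span B"
  shows "\<exists>c. (\<exists>k\<in>K. c k \<noteq> 0) \<and> (\<forall>x. (\<Sum>k\<in>K. c k * g k x) = 0)"
proof -
  have "\<forall>k\<in>K. \<exists>a. \<forall>x. g k x = (\<Sum>b\<in>B. a b * b x)"
    using fun_span_coefficients[OF B(1)] g by blast
  then obtain a where a: "\<And>k x. k \<in> K \<Longrightarrow> g k x = (\<Sum>b\<in>B. a k b * b x)" by metis
  obtain c where c: "\<exists>k\<in>K. c k \<noteq> 0" "\<forall>b\<in>B. (\<Sum>k\<in>K. a k b * c k) = 0"
    using homogeneous_system_nontrivial[OF B(1,3,2), of "\<lambda>b k. a k b"] by blast
  have "(\<Sum>k\<in>K. c k * g k x) = 0" for x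
  proof -
    have "(\<Sum>k\<in>K. c k * g k x) = (\<Sum>k\<in>K. \<Sum>b\<in>B. a k b * c k * b x)"
      by (simp add: a sum_distrib_left algebra_simps)
    also have "\<dots> = (\<Sum>b\<in>B. (\<Sum>k\<in>K. a k b * c k) * b x)"
      by (subst sum.swap) (simp add: sum_distrib_right)
    also have "\<dots> = 0" using c(2) by simp
    finally show ?thesis .
  qed
  with c(1) show ?thesis by blast
qed

text \<open>The exponents are bounded separately rather than by total degree. The exponent vectors
  then form a product set, which is immediate to count, and the bounds simply add under
  multiplication.\<close>

definition monomials :: "nat \<Rightarrow> nat \<Rightarrow> (complex vec \<Rightarrow> complex) set" where
  "monomials d D = (\<lambda>e y. \<Prod>i<d. y $ i ^ e i) ` ({..<d} \<rightarrow>\<^sub>E {..D})"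

lemma monomials_memI:
  assumes "\<And>i. i < d \<Longrightarrow> e i \<le> D"
  shows "(\<lambda>y. \<Prod>i<d. y $ i ^ e i) \<in> monomials d D"
  unfolding monomials_def
  by (rule image_eqI[of _ _ "restrict e {..<d}"]) (use assms in \<open>auto simp: fun_eq_iff\<close>)

lemma finite_monomials: "finite (monomials d D)"
  by (simp add: monomials_def finite_PiE)

lemma card_monomials: "card (monomials d D) \<le> (D + 1) ^ d"
proof -
  have "card (monomials d D) \<le> card ({..<d} \<rightarrow>\<^sub>E {..D})"
    unfolding monomials_def by (rule card_image_le) (simp add: finite_PiE)
  then show ?thesis by (simp add: card_PiE)
qed

lemma monomials_mono: "D \<le> D' \<Longrightarrow> monomials d D \<subseteq> monomials d D'"
  unfolding monomials_def by (intro image_mono PiE_mono) auto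

lemma monomials_mult:
  assumes "b \<in> monomials d D" "c \<in> monomials d D'"
  shows "(\<lambda>x. b x * c x) \<in> monomials d (D + D')"
proof -
  obtain e e' where e: "e \<in> {..<d} \<rightarrow>\<^sub>E {..D}" "b = (\<lambda>y. \<Prod>i<d. y $ i ^ e i)"
    and e': "e' \<in> {..<d} \<rightarrow>\<^sub>E {..D'}" "c = (\<lambda>y. \<Prod>i<d. y $ i ^ e' i)"
    using assms unfolding monomials_def by blast
  have "(\<lambda>x. b x * c x) = (\<lambda>y. \<Prod>i<d. y $ i ^ (e i + e' i))"
    unfolding e(2) e'(2) by (simp add: power_add prod.distrib)
  also have "\<dots> \<in> monomials d (D + D')"
    by (rule monomials_memI) (use e(1) e'(1) in \<open>fastforce simp: PiE_iff intro: add_mono\<close>)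
  finally show ?thesis .
qed

lemma one_in_monomials: "(\<lambda>x. 1) \<in> monomials d D"
  using monomials_memI[of d "\<lambda>_. 0" D] by simp

lemma poly_funs_degree_bound:
  assumes "f \<in> poly_funs d"
  shows "\<exists>D. f \<in> fun_span (monomials d D)"
  using assms
proof induction
  case (const c)
  show ?case
    using fun_span_scale[OF fun_span_base[OF one_in_monomials[of d 0]], of c] by auto
next
  case (coord i)
  have "(\<lambda>y. \<Prod>j<d. y $ j ^ (if j = i then 1 else 0)) = (\<lambda>y :: complex vec. y $ i)"
    using coord by (simp add: if_distrib[of "\<lambda>e. _ ^ e"] prod.delta cong: if_cong)
  moreover have "(\<lambda>y. \<Prod>j<d. y $ j ^ (if j = i then 1 else 0)) \<in> fun_span (monomials d 1)"
    by (intro fun_span_base monomials_memI) simp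
  ultimately have "(\<lambda>y. y $ i) \<in> fun_span (monomials d 1)"
    by (rule subst[where P = "\<lambda>g. g \<in> fun_span (monomials d 1)"])
  then show ?case by blast
next
  case (add f g)
  then obtain D D' where "f \<in> fun_span (monomials d D)" "g \<in> fun_span (monomials d D')" by blast
  then have "f \<in> fun_span (monomials d (max D D'))" "g \<in> fun_span (monomials d (max D D'))"
    by (meson fun_span_mono monomials_mono max.cobounded1 max.cobounded2)+
  then show ?case using fun_span_add by blast
next
  case (mult f g)
  then obtain D D' where "f \<in> fun_span (monomials d D)" "g \<in> fun_span (monomials d D')" by blast
  from fun_span_mult[OF this monomials_mult] show ?case by blast
qed

lemma power_in_fun_span:
  assumes "f \<in> fun_span (monomials d D)"
  shows "(\<lambda>x. f x ^ e) \<in> fun_span (monomials d (e * D))"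
proof (induction e)
  case 0
  show ?case using fun_span_base[OF one_in_monomials] by simp
next
  case (Suc e)
  then show ?case using fun_span_mult[OF assms Suc monomials_mult] by simp
qed

lemma prod_powers_in_fun_span:
  assumes f: "\<And>i. i < r \<Longrightarrow> f i \<in> fun_span (monomials d D)" and e: "\<And>i. i < r \<Longrightarrow> e i \<le> (N :: nat)"
  shows "(\<lambda>x. \<Prod>i<r. f i x ^ e i) \<in> fun_span (monomials d (r * (N * D)))"
  using assms
proof (induction r)
  case 0
  show ?case using fun_span_base[OF one_in_monomials] by simp
next
  case (Suc r)
  have "(\<lambda>x. f r x ^ e r) \<in> fun_span (monomials d (N * D))"
    using fun_span_mono[OF power_in_fun_span[OF Suc.prems(1), of r "e r"] monomials_mono] Suc.prems(2)
    by simp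
  moreover have "(\<lambda>x. \<Prod>i<r. f i x ^ e i) \<in> fun_span (monomials d (r * (N * D)))"
    using Suc by simp
  ultimately show ?case
    using fun_span_mult[OF _ _ monomials_mult] by (fastforce simp: mult.commute)
qed

lemma sum_digits: "(\<Sum>i<r. (k div b ^ i mod b) * b ^ i) = k mod (b ^ r :: nat)"
proof (induction r)
  case (Suc r)
  have "k mod (b ^ r * b) = b ^ r * (k div b ^ r mod b) + k mod b ^ r"
    by (rule mod_mult2_eq)
  with Suc show ?case by (simp add: mult.commute)
qed simp

text \<open>
  There are \<open>b ^ r\<close> monomials in \<open>r\<close> variables with exponents below \<open>b\<close>. Evaluated at \<open>f\<close> they lie in a space
  of dimension \<open>O(b ^ d)\<close>, so they satisfy a linear relation. It is non-trivial as a polynomial function: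
  with the exponents taken to be the base \<open>b\<close> digits of \<open>k\<close>, the substitution \<open>y\<^sub>i = t ^ (b ^ i)\<close> turns
  the \<open>k\<close>-th monomial into \<open>t ^ k\<close>.
\<close>

lemma not_alg_indep_many:
  assumes f: "\<And>i. i < r \<Longrightarrow> f i \<in> poly_funs d" and r: "d < r"
  shows "\<not> alg_indep r f (carrier_vec d)"
proof
  assume indep: "alg_indep r f (carrier_vec d)"
  have "\<forall>i<r. \<exists>D. f i \<in> fun_span (monomials d D)"
    using poly_funs_degree_bound f by blast
  then obtain E where E: "\<And>i. i < r \<Longrightarrow> f i \<in> fun_span (monomials d (E i))" by metis
  define D where "D = (\<Sum>i<r. E i)"
  have fD: "f i \<in> fun_span (monomials d D)" if "i < r" for i
    by (rule fun_span_mono[OF E[OF that]], rule monomials_mono)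
      (use that in \<open>auto simp: D_def intro!: member_le_sum\<close>)
  \<comment> \<open>The constants come from the estimate
    \<open>(r * N * D + 1) ^ d \<le> ((r * D + 1) * b) ^ d = N * b ^ d\<close>, which is below
    \<open>b ^ (d + 1) \<le> b ^ r\<close> as soon as \<open>b\<close> exceeds \<open>N\<close>. The
    base-\<open>b\<close> digits are then bounded by \<open>N\<close>.\<close>
  define N where "N = (r * D + 1) ^ d"
  define b where "b = N + 1"
  have bpos: "b > 0" by (simp add: b_def)
  define K where "K = {..<b ^ r}"
  define dig where "dig k i = k div b ^ i mod b" for k i
  define mon where "mon k y = (\<Prod>i<r. y $ i ^ dig k i)" for k and y :: "complex vec"
  have dig: "dig k i \<le> N" for k i
    using mod_less_divisor[OF bpos, of "k div b ^ i"] by (simp add: dig_def b_def)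
  have "card (monomials d (r * (N * D))) \<le> (r * (N * D) + 1) ^ d" by (rule card_monomials)
  also have "\<dots> \<le> ((r * D + 1) * b) ^ d"
    by (rule power_mono) (auto simp: b_def algebra_simps)
  also have "\<dots> = N * b ^ d" by (simp add: N_def flip: power_mult_distrib)
  also have "\<dots> < b * b ^ d" using bpos by (simp add: b_def)
  also have "\<dots> = b ^ Suc d" by simp
  also have "\<dots> \<le> b ^ r" using r bpos by (intro power_increasing) auto
  finally have "card (monomials d (r * (N * D))) < card K" by (simp add: K_def)
  moreover have "(\<lambda>x. \<Prod>i<r. f i x ^ dig k i) \<in> fun_span (monomials d (r * (N * D)))" for k
    by (rule prod_powers_in_fun_span) (use fD dig in auto)
  ultimately obtain c where c: "\<exists>k\<in>K. c k \<noteq> 0"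
      "\<And>x. (\<Sum>k\<in>K. c k * (\<Prod>i<r. f i x ^ dig k i)) = 0"
    using fun_span_dependent[OF finite_monomials, of d "r * (N * D)" K "\<lambda>k x. \<Prod>i<r. f i x ^ dig k i"]
    by (auto simp: K_def)
  have "(\<lambda>y. \<Sum>k\<in>K. c k * mon k y) \<in> poly_funs r"
    unfolding mon_def K_def
    by (intro poly_funs_sum poly_funs.mult poly_funs.const poly_funs_prod poly_funs_power poly_funs.coord) auto
  moreover have "(\<Sum>k\<in>K. c k * mon k (vec r (\<lambda>i. f i z))) = 0" for z
    using c(2)[of z] by (simp add: mon_def)
  ultimately have z: "(\<Sum>k\<in>K. c k * mon k y) = 0" if "y \<in> carrier_vec r" for y
    using indep[unfolded alg_indep_def, rule_format, of "\<lambda>y. \<Sum>k\<in>K. c k * mon k y" y] that by simp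
  have "(\<Sum>k<b ^ r. c k * t ^ k) = 0" for t
  proof -
    have "mon k (vec r (\<lambda>i. t ^ (b ^ i))) = t ^ k" if "k < b ^ r" for k
    proof -
      have "mon k (vec r (\<lambda>i. t ^ (b ^ i))) = t ^ (\<Sum>i<r. dig k i * b ^ i)"
        by (simp add: mon_def power_sum mult.commute flip: power_mult)
      also have "(\<Sum>i<r. dig k i * b ^ i) = k"
        unfolding dig_def sum_digits using that by simp
      finally show ?thesis .
    qed
    then show ?thesis using z[of "vec r (\<lambda>i. t ^ (b ^ i))"] by (simp add: K_def)
  qed
  moreover have K': "{..<b ^ r} = {..b ^ r - 1}"
    using zero_less_power[OF bpos, of r] unfolding lessThan_Suc_atMost[symmetric] by simp
  ultimately have "\<forall>k\<le>b ^ r - 1. c k = 0"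
    using polyfun_eq_0[of c "b ^ r - 1"] by simp
  then show False using c(1) unfolding K_def K' by blast
qed

text \<open>Each step of the chain adjoins one function: \<open>Z j\<close> is cut out of
  \<open>S\<close> by polynomials, so some polynomial vanishes on it but not at a chosen point of
  the next set. The induction starts with no functions at all, where independence is the
  non-emptiness of \<open>Z 0\<close>.\<close>

lemma alg_indep_along_chain:
  assumes chain: "irreducible_chain (subtopology (zariski m) S) k Z" and S: "S \<subseteq> carrier_vec m"
  shows "\<exists>f. (\<forall>i<k. f i \<in> poly_funs m) \<and> alg_indep k f (Z k)"
proof -
  have irr: "irreducible_space (subtopology (zariski m) (Z j))" "Z j \<subseteq> S" if "j \<le> k" for j
  proof -
    have cl: "closedin (subtopology (zariski m) S) (Z j)"
      and "irreducible_space (subtopology (subtopology (zariski m) S) (Z j))"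
      using chain that unfolding irreducible_chain_def by blast+
    then show "Z j \<subseteq> S" by (auto simp: closedin_subtopology)
    then show "irreducible_space (subtopology (zariski m) (Z j))"
      using \<open>irreducible_space (subtopology (subtopology (zariski m) S) (Z j))\<close>
      by (simp add: subtopology_subtopology inf.absorb2)
  qed
  have "\<exists>f. (\<forall>i<j. f i \<in> poly_funs m) \<and> alg_indep j f (Z j)" if "j \<le> k" for j
    using that
  proof (induction j)
    case 0
    have "Z 0 \<noteq> {}"
      using irr(1)[of 0] by (auto simp: irreducible_space_def)
    moreover have "a x = a y" if "a \<in> poly_funs 0" for a and x y :: "complex vec"
      by (rule poly_funs_cong[OF that]) simp
    ultimately show ?case unfolding alg_indep_def by (metis all_not_in_conv not_less0)
  next
    case (Suc j)
    then obtain f where f: "\<forall>i<j. f i \<in> poly_funs m" "alg_indep j f (Z j)" by auto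
    have sub: "Z j \<subset> Z (Suc j)" and "closedin (subtopology (zariski m) S) (Z j)"
      using chain Suc.prems unfolding irreducible_chain_def by auto
    then obtain F where F: "F \<subseteq> poly_funs m" "Z j = zero_locus m F \<inter> S"
      unfolding closedin_subtopology_zariski by blast
    obtain w where w: "w \<in> Z (Suc j)" "w \<notin> Z j" using sub by blast
    then have "w \<in> S" "w \<in> carrier_vec m" using irr(2)[OF Suc.prems] S by auto
    with w F obtain g where g: "g \<in> F" "g w \<noteq> 0" by (auto simp: zero_locus_def)
    have "alg_indep (Suc j) (f(j := g)) (Z (Suc j))"
    proof (rule alg_indep_extend[OF f(2) _ _ _ irr(1)[OF Suc.prems]])
      show "g z = 0" if "z \<in> Z j" for z using that F(2) g(1) by (auto simp: zero_locus_def)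
      show "Z (Suc j) \<subseteq> carrier_vec m" using irr(2)[OF Suc.prems] S by auto
    qed (use f(1) sub F(1) g w in auto)
    moreover have "\<forall>i<Suc j. (f(j := g)) i \<in> poly_funs m" using f(1) g(1) F(1) by auto
    ultimately show ?case by blast
  qed
  then show ?thesis by blast
qed

text \<open>The \<open>k\<close> functions that are independent on the top of the chain pull back
  along the parametrization to \<open>k\<close> independent functions on affine
  \<open>d\<close>-space, of which there are at most \<open>d\<close>.\<close>

lemma irreducible_chain_length:
  assumes chain: "irreducible_chain (subtopology (zariski m) S) k Z"
    and G: "\<And>j. j < m \<Longrightarrow> G j \<in> poly_funs d" and S: "S = (\<lambda>y. vec m (\<lambda>j. G j y)) ` carrier_vec d"
  shows "k \<le> d"
proof (rule ccontr)
  assume "\<not> k \<le> d"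
  have "S \<subseteq> carrier_vec m" unfolding S by auto
  from alg_indep_along_chain[OF chain this]
  obtain f where f: "\<forall>i<k. f i \<in> poly_funs m" "alg_indep k f (Z k)" by blast
  have sub: "Z k \<subseteq> S"
    using chain unfolding irreducible_chain_def by (auto simp: closedin_subtopology)
  let ?f = "\<lambda>i y. f i (vec m (\<lambda>j. G j y))"
  have "alg_indep k ?f (carrier_vec d)"
    unfolding alg_indep_def
  proof (intro ballI impI)
    fix a and y :: "complex vec"
    assume a: "a \<in> poly_funs k" "\<forall>z\<in>carrier_vec d. a (vec k (\<lambda>i. ?f i z)) = 0" and y: "y \<in> carrier_vec k"
    have "\<forall>z\<in>Z k. a (vec k (\<lambda>i. f i z)) = 0" using sub S a(2) by blast
    then show "a y = 0" using f(2) a(1) y unfolding alg_indep_def by blast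
  qed
  moreover have "\<not> alg_indep k ?f (carrier_vec d)"
  proof (rule not_alg_indep_many)
    show "?f i \<in> poly_funs d" if "i < k" for i
      by (rule poly_funs_comp[OF _ G]) (use f(1) that in auto)
  qed (use \<open>\<not> k \<le> d\<close> in simp)
  ultimately show False by blast
qed

section \<open>Ranges and kernels of matrices\<close>

abbreviation mat_range :: "complex mat \<Rightarrow> complex vec set" where
  "mat_range B \<equiv> (\<lambda>c. B *\<^sub>v c) ` carrier_vec (dim_col B)"

lemma linear_map_mult_mat_vec:
  assumes "B \<in> carrier_mat n d"
  shows "linear_map class_ring (module_vec TYPE(complex) d) (module_vec TYPE(complex) n) (\<lambda>c. B *\<^sub>v c)"
  unfolding linear_map_def mod_hom_def mod_hom_axioms_def LinearCombinations.module_hom_def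
  using assms
  by (auto simp: vec_vs vec_module module_vec_simps mult_add_distrib_mat_vec mult_mat_vec)

lemma span_cols: "span_vec (dim_row B) (set (cols B)) = mat_range B"
proof -
  have B: "B \<in> carrier_mat (dim_row B) (dim_col B)" by simp
  show ?thesis
    using vec_space.col_space_eq[OF B]
    unfolding vec_space.col_space_def using mult_mat_vec_carrier[OF B] by (auto simp: image_iff)
qed

lemma subspace_mat_range:
  assumes "B \<in> carrier_mat n d"
  shows "VectorSpace.subspace class_ring (mat_range B) (module_vec TYPE(complex) n)"
  using linear_map.imT_is_subspace[OF linear_map_mult_mat_vec[OF assms]] assms
  by (simp add: mod_hom.im_def[OF linear_map.axioms(3)[OF linear_map_mult_mat_vec[OF assms]]] module_vec_simps)

lemma subspace_dim_mat_range:
  assumes B: "B \<in> carrier_mat n d"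
    and inj: "\<And>c. c \<in> carrier_vec d \<Longrightarrow> B *\<^sub>v c = 0\<^sub>v n \<Longrightarrow> c = 0\<^sub>v d"
  shows "subspace_dim n (mat_range B) = d"
proof -
  interpret T: linear_map class_ring "module_vec TYPE(complex) d" "module_vec TYPE(complex) n" "\<lambda>c. B *\<^sub>v c"
    by (rule linear_map_mult_mat_vec[OF B])
  have im: "T.im = mat_range B" using B by (simp add: T.im_def module_vec_simps)
  have "T.ker = {0\<^sub>v d}"
    using inj B by (auto simp: T.ker_def module_vec_simps)
  then have "inj_on (\<lambda>c. B *\<^sub>v c) (carrier (module_vec TYPE(complex) d))"
    by (intro T.Ke0_imp_inj) (simp add: module_vec_simps)
  then have "T.V.dim = vectorspace.dim class_ring (module_vec TYPE(complex) n\<lparr>carrier := T.im\<rparr>) + 0"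
    using T.rank_nullity[OF vec_space.fin_dim] T.inj_imp_dim_ker0 by simp
  then show ?thesis
    by (simp add: subspace_dim_def im vec_space.dim_is_n)
qed

lemma linear_map_on_subspace:
  assumes T: "linear_map K V W T" and S: "VectorSpace.subspace K S V"
  shows "linear_map K (V\<lparr>carrier := S\<rparr>) W T"
proof -
  have V: "vectorspace K V" and W: "vectorspace K W" and hom: "mod_hom K V W T"
    using T by (auto simp: linear_map_def)
  have S': "S \<subseteq> carrier V"
    using S by (auto simp: VectorSpace.subspace_def LinearCombinations.submodule_def)
  have VS: "vectorspace K (V\<lparr>carrier := S\<rparr>)"
    by (rule vectorspace.subspace_is_vs[OF V S])
  show ?thesis
    unfolding linear_map_def mod_hom_def mod_hom_axioms_def
    using VS W hom S'
    by (auto simp: vectorspace_def LinearCombinations.module_hom_def mod_hom_def mod_hom_axioms_def subset_iff)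
qed

text \<open>Rank-nullity for the restriction of \<open>A\<close> to the range of \<open>B\<close>, a
  space of dimension \<open>p\<close> by injectivity. With \<open>A\<close> selecting coordinates,
  the kernel is the intersection of a flag member with a coordinate subspace.\<close>

lemma rank_nullity_mat:
  assumes B: "B \<in> carrier_mat n p"
    and inj: "\<And>c. c \<in> carrier_vec p \<Longrightarrow> B *\<^sub>v c = 0\<^sub>v n \<Longrightarrow> c = 0\<^sub>v p"
    and A: "A \<in> carrier_mat r n"
  shows "subspace_dim r (mat_range (A * B)) + subspace_dim n {v \<in> mat_range B. A *\<^sub>v v = 0\<^sub>v r} = p"
proof -
  let ?V = "module_vec TYPE(complex) n\<lparr>carrier := mat_range B\<rparr>"
  interpret T: linear_map class_ring ?V "module_vec TYPE(complex) r" "\<lambda>v. A *\<^sub>v v"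
    by (rule linear_map_on_subspace[OF linear_map_mult_mat_vec[OF A] subspace_mat_range[OF B]])
  have "B \<in> carrier_mat n (dim_col B)" using B by simp
  then have "T.V.fin_dim"
    using vec_space.fin_dim_span_cols[of B n] span_cols[of B] B by simp
  from T.rank_nullity[OF this]
  have "vectorspace.dim class_ring (module_vec TYPE(complex) r\<lparr>carrier := T.im\<rparr>) +
      vectorspace.dim class_ring (module_vec TYPE(complex) n\<lparr>carrier := T.ker\<rparr>) = p"
    using subspace_dim_mat_range[OF B inj] by (simp add: subspace_dim_def)
  moreover have "T.im = mat_range (A * B)"
    using A B by (auto simp: T.im_def image_image intro!: image_cong)
  moreover have "T.ker = {v \<in> mat_range B. A *\<^sub>v v = 0\<^sub>v r}"
    by (simp add: T.ker_def module_vec_simps)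
  ultimately show ?thesis by (simp add: subspace_dim_def)
qed

lemma fin_dim_mat_range:
  assumes "C \<in> carrier_mat r p"
  shows "vectorspace.fin_dim class_ring (module_vec TYPE(complex) r\<lparr>carrier := mat_range C\<rparr>)"
  using vec_space.fin_dim_span_cols[OF assms] span_cols[of C] assms by simp

lemma subspace_dim_mat_range_le:
  assumes C: "C \<in> carrier_mat r p"
  shows "subspace_dim r (mat_range C) \<le> r"
  using vectorspace.subspace_dim[OF vec_vs subspace_mat_range[OF C] vec_space.fin_dim fin_dim_mat_range[OF C]]
  by (simp add: subspace_dim_def vec_space.dim_is_n)

lemma subspace_dim_mat_range_0:
  assumes C: "C \<in> carrier_mat r p" and 0: "subspace_dim r (mat_range C) = 0" and v: "v \<in> mat_range C"
  shows "v = 0\<^sub>v r"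
proof -
  let ?V = "module_vec TYPE(complex) r\<lparr>carrier := mat_range C\<rparr>"
  interpret V: vectorspace class_ring ?V
    by (rule vectorspace.subspace_is_vs[OF vec_vs subspace_mat_range[OF C]])
  obtain b where b: "finite b" "V.basis b"
    using V.finite_basis_exists fin_dim_mat_range[OF C] by auto
  then have "card b = 0" using V.dim_basis 0 by (simp add: subspace_dim_def)
  then have "V.span {} = mat_range C" using b by (auto simp: V.basis_def)
  then show ?thesis using v by (auto simp: V.span_empty module_vec_simps)
qed

text \<open>The conditions are the kernel of the matrix that selects the coordinates in
  \<open>R\<close>, and its image has dimension at most \<open>card R\<close>. This bounds from
  below the intersections in the Schubert conditions.\<close>

lemma subspace_dim_kernel_ge:
  assumes B: "B \<in> carrier_mat n p"
    and inj: "\<And>c. c \<in> carrier_vec p \<Longrightarrow> B *\<^sub>v c = 0\<^sub>v n \<Longrightarrow> c = 0\<^sub>v p"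
    and R: "finite R" "R \<subseteq> {..<n}"
  shows "p \<le> subspace_dim n {v \<in> mat_range B. \<forall>i\<in>R. v $ i = 0} + card R"
proof -
  obtain f where f: "bij_betw f {0..<card R} R" using ex_bij_betw_nat_finite[OF R(1)] by blast
  define A :: "complex mat" where "A = mat_of_rows n (map (\<lambda>k. unit_vec n (f k)) [0..<card R])"
  have A: "A \<in> carrier_mat (card R) n" by (auto simp: A_def)
  have fR: "f k \<in> R" "f k < n" if "k < card R" for k
    using f R(2) that by (auto simp: bij_betw_def)
  have "(A *\<^sub>v v) $ k = v $ f k" if "k < card R" "v \<in> carrier_vec n" for k v
    using that fR by (simp add: A_def)
  then have "A *\<^sub>v v = 0\<^sub>v (card R) \<longleftrightarrow> (\<forall>k<card R. v $ f k = 0)" if "v \<in> carrier_vec n" for v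
    using A that by (auto simp: vec_eq_iff simp del: index_mult_mat_vec)
  moreover have "(\<forall>k<card R. v $ f k = 0) \<longleftrightarrow> (\<forall>i\<in>R. v $ i = 0)" for v :: "complex vec"
    using f unfolding bij_betw_def by (metis fR(1) atLeastLessThan_iff imageE)
  ultimately have "A *\<^sub>v v = 0\<^sub>v (card R) \<longleftrightarrow> (\<forall>i\<in>R. v $ i = 0)" if "v \<in> carrier_vec n" for v
    using that by simp
  then have "{v \<in> mat_range B. A *\<^sub>v v = 0\<^sub>v (card R)} = {v \<in> mat_range B. \<forall>i\<in>R. v $ i = 0}"
    using B by auto
  then have "subspace_dim (card R) (mat_range (A * B)) + subspace_dim n {v \<in> mat_range B. \<forall>i\<in>R. v $ i = 0} = p"
    using rank_nullity_mat[OF B inj A] by simp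
  moreover have "subspace_dim (card R) (mat_range (A * B)) \<le> card R"
    by (rule subspace_dim_mat_range_le[OF mult_carrier_mat[OF A B]])
  ultimately show ?thesis by simp
qed

text \<open>When the vectors with vanishing first \<open>q\<close> coordinates already have
  dimension \<open>p\<close>, the projection of the range to these coordinates has rank zero. This
  turns a Schubert condition into the vanishing of entries.\<close>

lemma kernel_full_dim:
  assumes B: "B \<in> carrier_mat n p"
    and inj: "\<And>c. c \<in> carrier_vec p \<Longrightarrow> B *\<^sub>v c = 0\<^sub>v n \<Longrightarrow> c = 0\<^sub>v p"
    and q: "q \<le> n" and dim: "p \<le> subspace_dim n {v \<in> mat_range B. \<forall>i<q. v $ i = 0}"
    and v: "v \<in> mat_range B" and i: "i < q"
  shows "v $ i = 0"
proof -
  define A :: "complex mat" where "A = mat_of_rows n (map (unit_vec n) [0..<q])"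
  have A: "A \<in> carrier_mat q n" by (auto simp: A_def)
  have Av: "(A *\<^sub>v v) $ k = v $ k" if "k < q" "v \<in> carrier_vec n" for k v
    using that q by (simp add: A_def)
  then have "A *\<^sub>v v = 0\<^sub>v q \<longleftrightarrow> (\<forall>i<q. v $ i = 0)" if "v \<in> carrier_vec n" for v
    using A that by (auto simp: vec_eq_iff simp del: index_mult_mat_vec)
  then have "{v \<in> mat_range B. A *\<^sub>v v = 0\<^sub>v q} = {v \<in> mat_range B. \<forall>i<q. v $ i = 0}"
    using B by auto
  then have "subspace_dim q (mat_range (A * B)) = 0"
    using rank_nullity_mat[OF B inj A] dim by simp
  moreover have "A *\<^sub>v v \<in> mat_range (A * B)" using v A B by (auto intro!: image_eqI)
  ultimately have "A *\<^sub>v v = 0\<^sub>v q"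
    using subspace_dim_mat_range_0[OF mult_carrier_mat[OF A B]] by blast
  moreover have "v \<in> carrier_vec n" using v B by auto
  ultimately show ?thesis using Av[OF i, of v] i by simp
qed

section \<open>Graphs of polynomial maps\<close>

text \<open>Differentiability in the form of the chain rule along every curve through
  \<open>p\<close>. The sum and product rules pass through this form, and it allows a curve inside a
  variety to be compared with the straight line of the same velocity.\<close>

definition has_gradient :: "nat \<Rightarrow> (complex vec \<Rightarrow> complex) \<Rightarrow> complex vec \<Rightarrow> (nat \<Rightarrow> complex) \<Rightarrow> bool" where
  "has_gradient m f p a \<longleftrightarrow> (\<forall>\<gamma> v. (\<forall>i<m. \<gamma> 0 $ i = p $ i) \<longrightarrow>
     (\<forall>i<m. ((\<lambda>t. \<gamma> t $ i) has_field_derivative v $ i) (at 0)) \<longrightarrow>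
     ((\<lambda>t. f (\<gamma> t)) has_field_derivative (\<Sum>i<m. a i * (v :: complex vec) $ i)) (at 0))"

lemma has_gradientI:
  assumes "\<And>\<gamma> v :: complex vec. (\<And>i. i < m \<Longrightarrow> \<gamma> 0 $ i = p $ i) \<Longrightarrow>
    (\<And>i. i < m \<Longrightarrow> ((\<lambda>t. \<gamma> t $ i) has_field_derivative v $ i) (at 0)) \<Longrightarrow>
    ((\<lambda>t. f (\<gamma> t)) has_field_derivative (\<Sum>i<m. a i * v $ i)) (at 0)"
  shows "has_gradient m f p a"
  using assms unfolding has_gradient_def by simp

lemma has_gradientD:
  assumes "has_gradient m f p a" "\<And>i. i < m \<Longrightarrow> \<gamma> 0 $ i = p $ i"
    "\<And>i. i < m \<Longrightarrow> ((\<lambda>t. \<gamma> t $ i) has_field_derivative v $ i) (at 0)"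
  shows "((\<lambda>t. f (\<gamma> t)) has_field_derivative (\<Sum>i<m. a i * v $ i)) (at 0)"
  using assms unfolding has_gradient_def by simp

lemma poly_funs_has_gradient:
  assumes "f \<in> poly_funs m"
  shows "\<exists>a. has_gradient m f p a"
  using assms
proof induction
  case (const c)
  have "has_gradient m (\<lambda>x. c) p (\<lambda>_. 0)" by (rule has_gradientI) simp
  then show ?case by blast
next
  case (coord i)
  have "(\<Sum>j<m. (if j = i then 1 else 0) * v $ j) = v $ i" for v :: "complex vec"
    using coord by (simp add: if_distrib[of "\<lambda>c. c * _"] cong: if_cong)
  then have "has_gradient m (\<lambda>x. x $ i) p (\<lambda>j. if j = i then 1 else 0)"
    using coord by (intro has_gradientI) simp
  then show ?case by blast
next
  case (add f g)
  then obtain a b where a: "has_gradient m f p a" and b: "has_gradient m g p b" by blast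
  have "has_gradient m (\<lambda>x. f x + g x) p (\<lambda>i. a i + b i)"
  proof (rule has_gradientI)
    fix \<gamma> :: "complex \<Rightarrow> complex vec" and v :: "complex vec"
    assume "\<And>i. i < m \<Longrightarrow> \<gamma> 0 $ i = p $ i"
      and "\<And>i. i < m \<Longrightarrow> ((\<lambda>t. \<gamma> t $ i) has_field_derivative v $ i) (at 0)"
    from DERIV_add[OF has_gradientD[OF a this] has_gradientD[OF b this]]
    show "((\<lambda>t. f (\<gamma> t) + g (\<gamma> t)) has_field_derivative (\<Sum>i<m. (a i + b i) * v $ i)) (at 0)"
      by (simp add: sum.distrib distrib_right)
  qed
  then show ?case by blast
next
  case (mult f g)
  then obtain a b where a: "has_gradient m f p a" and b: "has_gradient m g p b" by blast
  have "has_gradient m (\<lambda>x. f x * g x) p (\<lambda>i. a i * g p + b i * f p)"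
  proof (rule has_gradientI)
    fix \<gamma> :: "complex \<Rightarrow> complex vec" and v :: "complex vec"
    assume *: "\<And>i. i < m \<Longrightarrow> \<gamma> 0 $ i = p $ i"
      "\<And>i. i < m \<Longrightarrow> ((\<lambda>t. \<gamma> t $ i) has_field_derivative v $ i) (at 0)"
    have "f (\<gamma> 0) = f p" "g (\<gamma> 0) = g p"
      by (rule poly_funs_cong[OF mult.hyps(1)] poly_funs_cong[OF mult.hyps(2)], rule *(1), assumption)+
    with DERIV_mult[OF has_gradientD[OF a *] has_gradientD[OF b *]]
    show "((\<lambda>t. f (\<gamma> t) * g (\<gamma> t)) has_field_derivative
        (\<Sum>i<m. (a i * g p + b i * f p) * v $ i)) (at 0)"
      by (simp add: sum.distrib distrib_right sum_distrib_left sum_distrib_right mult.assoc mult.commute[of "g p"] mult.left_commute[of _ "g p"] mult.commute[of "f p"] mult.left_commute[of _ "f p"])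
  qed
  then show ?case by blast
qed

text \<open>\<open>b i\<close> is the index of the ambient coordinate that carries the
  \<open>i\<close>-th parameter; through these \<open>d\<close> coordinates the parametrization has
  a polynomial inverse on \<open>S\<close>.\<close>

locale graph_variety =
  fixes m d :: nat and b :: "nat \<Rightarrow> nat" and G :: "nat \<Rightarrow> complex vec \<Rightarrow> complex"
    and S :: "complex vec set"
  assumes G: "k < m \<Longrightarrow> G k \<in> poly_funs d"
    and b: "i < d \<Longrightarrow> b i < m"
    and Gb: "i < d \<Longrightarrow> y \<in> carrier_vec d \<Longrightarrow> G (b i) y = y $ i"
    and S: "S = (\<lambda>y. vec m (\<lambda>k. G k y)) ` carrier_vec d"
begin

definition param :: "complex vec \<Rightarrow> complex vec" where
  "param y = vec m (\<lambda>k. G k y)"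

definition proj :: "complex vec \<Rightarrow> complex vec" where
  "proj x = vec d (\<lambda>i. x $ b i)"

lemma param_carrier [simp]: "param y \<in> carrier_vec m"
  by (simp add: param_def)

lemma proj_carrier [simp]: "proj x \<in> carrier_vec d"
  by (simp add: proj_def)

lemma S_param: "S = param ` carrier_vec d"
  by (simp add: S param_def)

lemma S_carrier: "S \<subseteq> carrier_vec m"
  by (auto simp: S_param)

lemma proj_param [simp]: "y \<in> carrier_vec d \<Longrightarrow> proj (param y) = y"
  by (auto simp: proj_def param_def b Gb)

lemma param_proj [simp]: "x \<in> S \<Longrightarrow> param (proj x) = x"
  by (auto simp: S_param)

text \<open>A point of \<open>S\<close> is recovered from its parameters, so the equations
  \<open>x $ k = G k (proj x)\<close> cut out \<open>S\<close>; for \<open>k = b i\<close> they are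
  trivial. They give both closedness and the linear conditions on tangent vectors.\<close>

lemma S_iff: "x \<in> S \<longleftrightarrow> x \<in> carrier_vec m \<and> (\<forall>k<m. x $ k - G k (proj x) = 0)"
proof
  assume "x \<in> S"
  then show "x \<in> carrier_vec m \<and> (\<forall>k<m. x $ k - G k (proj x) = 0)"
    using param_proj[of x] S_carrier by (auto simp: param_def vec_eq_iff)
next
  assume *: "x \<in> carrier_vec m \<and> (\<forall>k<m. x $ k - G k (proj x) = 0)"
  then have "x = param (proj x)" by (auto simp: param_def)
  then show "x \<in> S" unfolding S_param by (metis imageI proj_carrier)
qed

lemma equation_poly:
  assumes "k < m"
  shows "(\<lambda>x. x $ k - G k (proj x)) \<in> poly_funs m"
proof -
  have "(\<lambda>x. G k (vec d (\<lambda>i. x $ b i))) \<in> poly_funs m"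
    by (rule poly_funs_comp[OF G[OF assms]]) (simp add: b poly_funs.coord)
  then show ?thesis
    unfolding proj_def by (intro poly_funs_diff poly_funs.coord assms)
qed

lemma closedin_zariski_S: "closedin (zariski m) S"
proof -
  have "S = zero_locus m ((\<lambda>k x. x $ k - G k (proj x)) ` {..<m})"
    by (auto simp: zero_locus_def S_iff)
  moreover have "(\<lambda>k x. x $ k - G k (proj x)) ` {..<m} \<subseteq> poly_funs m"
    using equation_poly by auto
  ultimately show ?thesis unfolding closedin_zariski by blast
qed

lemma isomorphic_affine_space: "isomorphic_varieties m S d (carrier_vec d)"
  unfolding isomorphic_varieties_def
proof (intro exI conjI allI impI ballI)
  show "(\<lambda>x. x $ b i) \<in> poly_funs m" if "i < d" for i
    using that by (simp add: b poly_funs.coord)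
  show "G j \<in> poly_funs d" if "j < m" for j
    using that by (rule G)
  show "vec d (\<lambda>i. x $ b i) \<in> carrier_vec d" for x :: "complex vec"
    by simp
  show "vec m (\<lambda>j. G j (vec d (\<lambda>i. x $ b i))) = x" if "x \<in> S" for x
    using param_proj[OF that] by (simp add: param_def proj_def)
  show "vec m (\<lambda>j. G j y) \<in> S" if "y \<in> carrier_vec d" for y
    using that S by blast
  show "vec d (\<lambda>i. vec m (\<lambda>j. G j y) $ b i) = y" if "y \<in> carrier_vec d" for y
    using proj_param[OF that] by (simp add: param_def proj_def)
qed

lemma irreducible_S: "irreducible_space (subtopology (zariski m) S)"
  unfolding S by (rule irreducible_image) (rule G)

text \<open>The parameters from index \<open>i\<close> on are frozen at the values of
  \<open>q\<close> and the first \<open>i\<close> remain free. For \<open>q\<close> of length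
  \<open>d\<close> the slices grow from the single point \<open>param q\<close> at
  \<open>i = 0\<close> to all of \<open>S\<close> at \<open>i = d\<close>.\<close>

definition coord_slice :: "complex vec \<Rightarrow> nat \<Rightarrow> complex vec set" where
  "coord_slice q i = param ` {y \<in> carrier_vec d. \<forall>j\<in>{i..<d}. y $ j = q $ j}"

lemma coord_slice_chain:
  assumes q: "q \<in> carrier_vec d"
  shows "irreducible_chain (subtopology (zariski m) S) d (coord_slice q)"
  unfolding irreducible_chain_def
proof (intro conjI allI impI)
  fix i
  let ?F = "(\<lambda>j x. x $ b j - q $ j) ` {i..<d}"
  have sub: "coord_slice q i \<subseteq> S" by (auto simp: coord_slice_def S_param)
  have "coord_slice q i = zero_locus m ?F \<inter> S"
  proof (intro equalityI subsetI)
    fix x assume "x \<in> coord_slice q i"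
    then obtain y where y: "y \<in> carrier_vec d" "\<forall>j\<in>{i..<d}. y $ j = q $ j" "x = param y"
      by (auto simp: coord_slice_def)
    then have "x $ b j = q $ j" if "j \<in> {i..<d}" for j
      using that by (simp add: param_def b Gb)
    then show "x \<in> zero_locus m ?F \<inter> S" using y by (auto simp: zero_locus_def S_param)
  next
    fix x assume x: "x \<in> zero_locus m ?F \<inter> S"
    then have "\<forall>j\<in>{i..<d}. proj x $ j = q $ j" by (auto simp: zero_locus_def proj_def)
    then show "x \<in> coord_slice q i"
      unfolding coord_slice_def using x by (intro image_eqI[of _ _ "proj x"]) auto
  qed
  moreover have "?F \<subseteq> poly_funs m"
    by (auto intro!: poly_funs_diff poly_funs.coord poly_funs.const b)
  ultimately show "closedin (subtopology (zariski m) S) (coord_slice q i)"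
    unfolding closedin_subtopology_zariski by blast
  let ?H = "\<lambda>j y. if j < i then y $ j else q $ j"
  have H: "(\<lambda>y. ?H j y) \<in> poly_funs d" if "j < d" for j
    using that by (cases "j < i") (auto intro: poly_funs.coord poly_funs.const)
  have "coord_slice q i = (\<lambda>y. vec m (\<lambda>k. G k (vec d (\<lambda>j. ?H j y)))) ` carrier_vec d"
  proof (intro equalityI subsetI)
    fix x assume "x \<in> coord_slice q i"
    then obtain y where y: "y \<in> carrier_vec d" "\<forall>j\<in>{i..<d}. y $ j = q $ j" "x = param y"
      by (auto simp: coord_slice_def)
    then have "vec d (\<lambda>j. ?H j y) = y" by auto
    then show "x \<in> (\<lambda>y. vec m (\<lambda>k. G k (vec d (\<lambda>j. ?H j y)))) ` carrier_vec d"
      using y by (intro image_eqI[of _ _ y]) (auto simp: param_def)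
  next
    fix x assume "x \<in> (\<lambda>y. vec m (\<lambda>k. G k (vec d (\<lambda>j. ?H j y)))) ` carrier_vec d"
    then obtain y where "x = param (vec d (\<lambda>j. ?H j y))" by (auto simp: param_def)
    then show "x \<in> coord_slice q i" unfolding coord_slice_def by (intro image_eqI) auto
  qed
  then have "irreducible_space (subtopology (zariski m) (coord_slice q i))"
    using irreducible_image[of m "\<lambda>k y. G k (vec d (\<lambda>j. ?H j y))" d] poly_funs_comp[OF G, of _ "\<lambda>j y. ?H j y" d] H
    by simp
  then show "irreducible_space (subtopology (subtopology (zariski m) S) (coord_slice q i))"
    using sub by (simp add: subtopology_subtopology inf.absorb2)
next
  fix i assume i: "i < d"
  \<comment> \<open>Moving the parameter \<open>i\<close> away from its value in \<open>q\<close>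
    leaves the smaller slice but stays in the next one.\<close>
  let ?y = "vec d (\<lambda>j. if j = i then q $ i + 1 else q $ j)"
  have "param ?y \<in> coord_slice q (Suc i)" unfolding coord_slice_def by (intro imageI) auto
  moreover have "param ?y \<notin> coord_slice q i"
  proof
    assume "param ?y \<in> coord_slice q i"
    then obtain z where z: "z \<in> carrier_vec d" "\<forall>j\<in>{i..<d}. z $ j = q $ j" "param ?y = param z"
      by (auto simp: coord_slice_def)
    have "proj (param ?y) = proj (param z)" using z(3) by simp
    then have "?y = z" using z(1) by simp
    then have "?y $ i = q $ i" using z(2) i by simp
    then show False using i by simp
  qed
  moreover have "coord_slice q i \<subseteq> coord_slice q (Suc i)"
    unfolding coord_slice_def by (intro image_mono) auto
  ultimately show "coord_slice q i \<subset> coord_slice q (Suc i)" by blast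
qed

lemma chain_length_le: "irreducible_chain (subtopology (zariski m) S) k Z \<Longrightarrow> k \<le> d"
  by (rule irreducible_chain_length[OF _ G S])

text \<open>The slices through \<open>proj p\<close> form a chain of length \<open>d\<close> whose
  smallest member contains \<open>p\<close>; the upper bound holds for every chain in
  \<open>S\<close>.\<close>

lemma local_dim_S:
  assumes "p \<in> S"
  shows "local_dim (subtopology (zariski m) S) p = d"
  unfolding local_dim_def
proof (rule antisym)
  show "Sup {ereal (real k) | k Z. irreducible_chain (subtopology (zariski m) S) k Z \<and> p \<in> Z 0} \<le> ereal d"
    by (rule Sup_least) (auto dest: chain_length_le)
  have "p \<in> coord_slice (proj p) 0"
    unfolding coord_slice_def using assms by (intro image_eqI[of _ _ "proj p"]) auto
  then show "ereal d \<le> Sup {ereal (real k) | k Z. irreducible_chain (subtopology (zariski m) S) k Z \<and> p \<in> Z 0}"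
    using coord_slice_chain[OF proj_carrier] by (intro Sup_upper) blast
qed

lemma variety_dim_S: "variety_dim m S = d"
  unfolding variety_dim_def krull_dim_def
proof (rule antisym)
  show "Sup {ereal (real k) | k Z. irreducible_chain (subtopology (zariski m) S) k Z} \<le> ereal d"
    by (rule Sup_least) (auto dest: chain_length_le)
  show "ereal d \<le> Sup {ereal (real k) | k Z. irreducible_chain (subtopology (zariski m) S) k Z}"
    using coord_slice_chain[OF zero_carrier_vec] by (intro Sup_upper) blast
qed

text \<open>The tangent space at \<open>p\<close> is the range of the Jacobian matrix
  \<open>A\<close> of the parametrization. As \<open>A\<close> is injective, its dimension is
  \<open>d\<close>, which is the local dimension.\<close>

lemma nonsingular_S: "nonsingular m S"
  unfolding nonsingular_def
proof
  fix p assume p: "p \<in> S"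
  then have pc: "p \<in> carrier_vec m" using S_carrier by blast
  define q where "q = proj p"
  have q: "q \<in> carrier_vec d" and pq: "param q = p" using p by (auto simp: q_def)
  have "\<forall>k<m. \<exists>a. has_gradient d (G k) q a"
    using poly_funs_has_gradient[OF G] by blast
  then obtain a where a: "\<And>k. k < m \<Longrightarrow> has_gradient d (G k) q (a k)" by metis
  define A where "A = mat m d (\<lambda>(k, i). a k i)"
  have A: "A \<in> carrier_mat m d" by (simp add: A_def)
  have Aw: "(A *\<^sub>v w) $ k = (\<Sum>i<d. a k i * w $ i)" if "k < m" "w \<in> carrier_vec d" for k w
    using that by (simp add: A_def scalar_prod_def atLeast0LessThan)
  have line: "\<forall>i<d. ((\<lambda>t. (q + t \<cdot>\<^sub>v w) $ i) has_field_derivative w $ i) (at 0)"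
    and line0: "\<forall>i<d. (q + 0 \<cdot>\<^sub>v w) $ i = q $ i" if "w \<in> carrier_vec d" for w
  proof -
    have "((\<lambda>t. q $ i + t * w $ i) has_field_derivative w $ i) (at 0)" for i
      by (auto intro!: derivative_eq_intros)
    then show "\<forall>i<d. ((\<lambda>t. (q + t \<cdot>\<^sub>v w) $ i) has_field_derivative w $ i) (at 0)"
      using q that by simp
    show "\<forall>i<d. (q + 0 \<cdot>\<^sub>v w) $ i = q $ i" using q that by simp
  qed
  have G': "((\<lambda>t. G k (q + t \<cdot>\<^sub>v w)) has_field_derivative (A *\<^sub>v w) $ k) (at 0)"
    if "k < m" "w \<in> carrier_vec d" for k w
    using has_gradientD[OF a[OF that(1)], of "\<lambda>t. q + t \<cdot>\<^sub>v w" w] line0[OF that(2)] line[OF that(2)] that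
    by (simp add: Aw)
  \<comment> \<open>On parameter vectors \<open>G (b i)\<close> is the \<open>i\<close>-th
    coordinate, so row \<open>b i\<close> of \<open>A\<close> returns \<open>w $ i\<close>.\<close>
  have inj: "w = 0\<^sub>v d" if "w \<in> carrier_vec d" "A *\<^sub>v w = 0\<^sub>v m" for w
  proof
    fix i assume "i < dim_vec (0\<^sub>v d :: complex vec)"
    then have i: "i < d" by simp
    have "((\<lambda>t. (q + t \<cdot>\<^sub>v w) $ i) has_field_derivative 0) (at 0)"
      using G'[OF b[OF i] that(1)] Gb[OF i] q that b[OF i] by simp
    with line[OF that(1)] i have "w $ i = 0" using DERIV_unique by blast
    then show "w $ i = 0\<^sub>v d $ i" using i by simp
  qed (use that in simp)
  have "tangent_space m S p = mat_range A"
  proof (intro equalityI subsetI)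
    fix v assume v: "v \<in> tangent_space m S p"
    then have vc: "v \<in> carrier_vec m" and tangent: "\<forall>f\<in>poly_funs m. (\<forall>z\<in>S. f z = 0) \<longrightarrow>
        ((\<lambda>t. f (p + t \<cdot>\<^sub>v v)) has_field_derivative 0) (at 0)"
      by (simp_all add: tangent_space_def)
    have "v $ k = (A *\<^sub>v proj v) $ k" if k: "k < m" for k
    proof -
      \<comment> \<open>The equation of \<open>S\<close> for coordinate \<open>k\<close> lies in the
        vanishing ideal. Its derivative along the line with velocity \<open>v\<close> is the
        difference of the \<open>k\<close>-th entries of \<open>v\<close> and of \<open>A\<close>
        applied to \<open>proj v\<close>.\<close>
      have "z $ k - G k (proj z) = 0" if "z \<in> S" for z using k S_iff that by blast
      then have "((\<lambda>t. (p + t \<cdot>\<^sub>v v) $ k - G k (proj (p + t \<cdot>\<^sub>v v))) has_field_derivative 0) (at 0)"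
        by (rule tangent[rule_format, OF equation_poly[OF k]])
      moreover have "proj (p + t \<cdot>\<^sub>v v) = q + t \<cdot>\<^sub>v proj v" for t
        using pc vc by (auto simp: q_def proj_def b)
      moreover have "(p + t \<cdot>\<^sub>v v) $ k = p $ k + t * v $ k" for t
        using k pc vc by simp
      ultimately have "((\<lambda>t. p $ k + t * v $ k - G k (q + t \<cdot>\<^sub>v proj v)) has_field_derivative 0) (at 0)"
        by simp
      moreover have "((\<lambda>t. p $ k + t * v $ k - G k (q + t \<cdot>\<^sub>v proj v)) has_field_derivative
          v $ k - (A *\<^sub>v proj v) $ k) (at 0)"
        by (rule DERIV_diff[OF _ G'[OF k proj_carrier]]) (auto intro!: derivative_eq_intros)
      ultimately have "0 = v $ k - (A *\<^sub>v proj v) $ k" by (rule DERIV_unique)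
      then show ?thesis by simp
    qed
    then have "v = A *\<^sub>v proj v" using vc A by (intro eq_vecI) auto
    then show "v \<in> mat_range A" using A proj_carrier by (metis carrier_matD(2) imageI)
  next
    fix v assume "v \<in> mat_range A"
    then obtain w where w: "w \<in> carrier_vec d" "v = A *\<^sub>v w" using A by auto
    then have vc: "v \<in> carrier_vec m" using A by simp
    have "((\<lambda>t. f (p + t \<cdot>\<^sub>v v)) has_field_derivative 0) (at 0)"
      if f: "f \<in> poly_funs m" "\<forall>z\<in>S. f z = 0" for f
    proof -
      obtain c where c: "has_gradient m f p c"
        using poly_funs_has_gradient[OF f(1)] by blast
      \<comment> \<open>The curve \<open>param (q + t w)\<close> stays in \<open>S\<close>, where
        \<open>f\<close> vanishes, and passes through \<open>p\<close> with velocity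
        \<open>v\<close>. The gradient sees only the velocity, so the derivative along the straight
        line is zero as well.\<close>
      have "((\<lambda>t. f (param (q + t \<cdot>\<^sub>v w))) has_field_derivative (\<Sum>i<m. c i * v $ i)) (at 0)"
      proof (rule has_gradientD[OF c])
        have "q + 0 \<cdot>\<^sub>v w = q" using q w(1) by auto
        then show "param (q + 0 \<cdot>\<^sub>v w) $ i = p $ i" for i using pq by simp
        show "((\<lambda>t. param (q + t \<cdot>\<^sub>v w) $ i) has_field_derivative v $ i) (at 0)" if "i < m" for i
          using G'[OF that w(1)] w that by (simp add: param_def)
      qed
      moreover have "f (param (q + t \<cdot>\<^sub>v w)) = 0" for t
        using f(2) w(1) q by (simp add: S_param)
      ultimately have "(\<Sum>i<m. c i * v $ i) = 0"
        using DERIV_unique[OF _ DERIV_const[of 0]] by simp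
      moreover have "((\<lambda>t. f (p + t \<cdot>\<^sub>v v)) has_field_derivative (\<Sum>i<m. c i * v $ i)) (at 0)"
      proof (rule has_gradientD[OF c])
        have "((\<lambda>t. p $ i + t * v $ i) has_field_derivative v $ i) (at 0)" for i
          by (auto intro!: derivative_eq_intros)
        then show "((\<lambda>t. (p + t \<cdot>\<^sub>v v) $ i) has_field_derivative v $ i) (at 0)" if "i < m" for i
          using pc vc that by simp
      qed (use pc vc in simp)
      ultimately show ?thesis by simp
    qed
    then show "v \<in> tangent_space m S p" using vc by (simp add: tangent_space_def)
  qed
  then show "ereal (real (subspace_dim m (tangent_space m S p))) = local_dim (subtopology (zariski m) S) p"
    using subspace_dim_mat_range[OF A inj] local_dim_S[OF p] by simp
qed

end

text \<open>The coordinates in \<open>F\<close> serve as parameters. Each other equation reads only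
  coordinates of smaller rank \<open>r\<close>, so the system is solved rank by rank through
  substitution, and substituting polynomials into polynomials again gives polynomials.\<close>

lemma triangular_system_graph:
  fixes r :: "nat \<Rightarrow> nat"
  assumes F: "F \<subseteq> {..<m}"
    and P: "\<And>k. k < m \<Longrightarrow> k \<notin> F \<Longrightarrow> P k \<in> poly_funs m"
    and dep: "\<And>k x y. k < m \<Longrightarrow> k \<notin> F \<Longrightarrow> (\<And>j. j < m \<Longrightarrow> r j < r k \<Longrightarrow> x $ j = y $ j) \<Longrightarrow> P k x = P k y"
  shows "\<exists>b G. graph_variety m (card F) b G {x \<in> carrier_vec m. \<forall>k<m. k \<notin> F \<longrightarrow> x $ k = P k x}"
proof -
  define d where "d = card F"
  have "finite F" using F finite_subset by blast
  then obtain b where b: "bij_betw b {0..<d} F" unfolding d_def using ex_bij_betw_nat_finite by blast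
  define c where "c = the_inv_into {0..<d} b"
  have c: "c k < d" "b (c k) = k" if "k \<in> F" for k
  proof -
    have "k \<in> b ` {0..<d}" "inj_on b {0..<d}" using b that by (auto simp: bij_betw_def)
    then show "c k < d" "b (c k) = k"
      using the_inv_into_into[of b "{0..<d}" k "{0..<d}"] f_the_inv_into_f[of b "{0..<d}" k] by (auto simp: c_def)
  qed
  have bF: "b i \<in> F" "c (b i) = i" if "i < d" for i
    using b that by (auto simp: bij_betw_def c_def the_inv_into_f_f)
  have "\<exists>G. (\<forall>k<m. G k \<in> poly_funs d) \<and> (\<forall>k\<in>F. G k = (\<lambda>y. y $ c k)) \<and>
      (\<forall>k<m. k \<notin> F \<longrightarrow> r k < R \<longrightarrow> (\<forall>y. G k y = P k (vec m (\<lambda>k. G k y))))" for R :: nat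
  proof (induction R)
    case 0
    show ?case
      by (rule exI[of _ "\<lambda>k. if k \<in> F then (\<lambda>y. y $ c k) else (\<lambda>y. 0)"])
        (auto intro: poly_funs.coord poly_funs.const c)
  next
    case (Suc R)
    then obtain G where G: "\<forall>k<m. G k \<in> poly_funs d" "\<forall>k\<in>F. G k = (\<lambda>y. y $ c k)"
      "\<forall>k<m. k \<notin> F \<longrightarrow> r k < R \<longrightarrow> (\<forall>y. G k y = P k (vec m (\<lambda>k. G k y)))" by blast
    \<comment> \<open>Only coordinates of rank exactly \<open>R\<close> are redefined. Equations of
      rank at most \<open>R\<close> read coordinates of rank below \<open>R\<close>, so the ones
      solved before stay solved.\<close>
    define G' where "G' k = (if k \<notin> F \<and> r k = R then \<lambda>y. P k (vec m (\<lambda>k. G k y)) else G k)" for k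
    have eq: "P k (vec m (\<lambda>k. G' k y)) = P k (vec m (\<lambda>k. G k y))"
      if "k < m" "k \<notin> F" "r k \<le> R" for k y
      by (rule dep[OF that(1,2)]) (use that(3) in \<open>auto simp: G'_def\<close>)
    have "(\<lambda>y. P k (vec m (\<lambda>k. G k y))) \<in> poly_funs d" if "k < m" "k \<notin> F" for k
      by (rule poly_funs_comp[OF P[OF that]]) (use G(1) in blast)
    then have "\<forall>k<m. G' k \<in> poly_funs d"
      using G(1) by (simp add: G'_def)
    moreover have "\<forall>k\<in>F. G' k = (\<lambda>y. y $ c k)" using G(2) by (simp add: G'_def)
    moreover have "\<forall>k<m. k \<notin> F \<longrightarrow> r k < Suc R \<longrightarrow> (\<forall>y. G' k y = P k (vec m (\<lambda>k. G' k y)))"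
    proof (intro allI impI)
      fix k y assume k: "k < m" "k \<notin> F" "r k < Suc R"
      then have "G' k y = P k (vec m (\<lambda>k. G k y))" using G(3) by (auto simp: G'_def less_Suc_eq)
      then show "G' k y = P k (vec m (\<lambda>k. G' k y))" using eq k by simp
    qed
    ultimately show ?case by blast
  qed
  \<comment> \<open>The sum of all ranks bounds each single rank, so at this stage every equation
    has been solved.\<close>
  from this[of "Suc (\<Sum>k<m. r k)"] obtain G where
    G: "\<forall>k<m. G k \<in> poly_funs d" "\<forall>k\<in>F. G k = (\<lambda>y. y $ c k)"
    "\<forall>k<m. k \<notin> F \<longrightarrow> r k < Suc (\<Sum>k<m. r k) \<longrightarrow> (\<forall>y. G k y = P k (vec m (\<lambda>k. G k y)))" by blast
  have GP: "G k y = P k (vec m (\<lambda>k. G k y))" if "k < m" "k \<notin> F" for k y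
    using G(3) that member_le_sum[of k "{..<m}" r] by (simp add: less_Suc_eq_le)
  let ?S = "{x \<in> carrier_vec m. \<forall>k<m. k \<notin> F \<longrightarrow> x $ k = P k x}"
  have "graph_variety m d b G ?S"
  proof
    show "G k \<in> poly_funs d" if "k < m" for k using G(1) that by blast
    show "b i < m" if "i < d" for i using bF(1)[OF that] F by blast
    show "G (b i) y = y $ i" if "i < d" for i y using bF[OF that] G(2) by simp
    show "?S = (\<lambda>y. vec m (\<lambda>k. G k y)) ` carrier_vec d"
    proof (intro equalityI subsetI)
      fix x assume x: "x \<in> ?S"
      let ?y = "vec d (\<lambda>i. x $ b i)"
      \<comment> \<open>Uniqueness of the solution with given parameters, by induction on the
        rank.\<close>
      have "G k ?y = x $ k" if "k < m" for k
        using that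
      proof (induction "r k" arbitrary: k rule: less_induct)
        case less
        show ?case
        proof (cases "k \<in> F")
          case True
          then show ?thesis using c[OF True] G(2) by simp
        next
          case False
          have "P k (vec m (\<lambda>k. G k ?y)) = P k x"
            by (rule dep[OF less.prems False]) (use less.hyps in simp)
          then show ?thesis using GP[OF less.prems False] x less.prems False by simp
        qed
      qed
      then have "x = vec m (\<lambda>k. G k ?y)" using x by auto
      then show "x \<in> (\<lambda>y. vec m (\<lambda>k. G k y)) ` carrier_vec d" by (rule image_eqI) simp
    next
      fix x assume "x \<in> (\<lambda>y. vec m (\<lambda>k. G k y)) ` carrier_vec d"
      then show "x \<in> ?S" using GP by auto
    qed
  qed
  then show ?thesis unfolding d_def by blast
qed

section \<open>Positions, permutations and diagrams\<close>

definition lex_less :: "nat \<times> nat \<Rightarrow> nat \<times> nat \<Rightarrow> bool" where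
  "lex_less p q \<longleftrightarrow> fst p < fst q \<or> fst p = fst q \<and> snd p < snd q"

lemma set_positions: "set (positions n) = {(i, j). 1 \<le> i \<and> 1 \<le> j \<and> i + j \<le> n}"
  by (force simp: positions_def)

lemma sorted_positions: "sorted_wrt lex_less (positions n)"
proof -
  have row: "sorted_wrt lex_less (map (\<lambda>j. (i, j)) [1..<n + 1 - i])" for i
    by (simp add: sorted_wrt_map lex_less_def)
  have "sorted_wrt lex_less (concat (map (\<lambda>i. map (\<lambda>j. (i, j)) [1..<n + 1 - i]) [1..<k]))" for k
  proof (induction k)
    case (Suc k)
    show ?case
    proof (cases "1 \<le> k")
      case True
      have "lex_less x y"
        if "x \<in> set (concat (map (\<lambda>i. map (\<lambda>j. (i, j)) [1..<n + 1 - i]) [1..<k]))"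
          "y \<in> set (map (\<lambda>j. (k, j)) [1..<n + 1 - k])" for x y
        using that by (auto simp: lex_less_def)
      then show ?thesis using Suc row[of k] True by (simp add: sorted_wrt_append del: map_map)
    qed simp
  qed simp
  then show ?thesis by (simp add: positions_def)
qed

lemma distinct_positions: "distinct (positions n)"
  using sorted_positions[of n] by (auto simp: distinct_conv_nth nat_neq_iff lex_less_def dest: sorted_wrt_nth_less)

lemma length_positions: "length (positions n) = num_coords n"
proof -
  have "length (positions n) = (\<Sum>i\<leftarrow>[1..<n]. n - i)"
    by (simp add: positions_def length_concat comp_def)
  also have "\<dots> = (\<Sum>i=1..<n. n - i)"
    by (simp add: sum_list_distinct_conv_sum_set)
  also have "\<dots> = (\<Sum>i=1..<n. i)"
    by (rule sum.reindex_bij_witness[of _ "\<lambda>i. n - i" "\<lambda>i. n - i"]) auto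
  also have "\<dots> = num_coords n" by (simp add: Sum_Ico_nat num_coords_def)
  finally show ?thesis .
qed

text \<open>The block \<open>s_(n-i) ... s_1\<close> read backwards is \<open>1, ..., n - i\<close>,
  the columns of row \<open>i\<close>. Taking letters of the word from the right thus means walking
  along \<open>positions\<close>.\<close>

lemma rev_full_word: "rev (full_word n) = map snd (positions n)"
proof -
  have "rev [1..<n] = map (\<lambda>i. n - i) [1..<n]"
    by (intro nth_equalityI) (auto simp: rev_nth)
  then have "rev (full_word n) = concat (map (\<lambda>i. [1..<n - i + 1]) [1..<n])"
    by (simp add: full_word_def rev_concat rev_map comp_def)
  also have "\<dots> = concat (map (\<lambda>i. [1..<n + 1 - i]) [1..<n])"
    by (intro arg_cong[where f = concat] map_cong) (auto simp: Suc_diff_le)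
  also have "\<dots> = map snd (positions n)"
    by (simp add: positions_def map_concat comp_def)
  finally show ?thesis .
qed

text \<open>The left-most letter acts first, so a letter added on the left is composed on the
  inside. This is the direction in which \<open>u_perm\<close> grows with \<open>l\<close>.\<close>

lemma word_perm_Cons: "word_perm (k # ks) = word_perm ks \<circ> Transposition.transpose k (k + 1)"
proof -
  have "foldl (\<lambda>v k. Transposition.transpose k (k + 1) \<circ> v) w ks =
      foldl (\<lambda>v k. Transposition.transpose k (k + 1) \<circ> v) id ks \<circ> w" for w :: "nat \<Rightarrow> nat" and ks
  proof (induction ks arbitrary: w)
    case (Cons k ks)
    show ?case
      using Cons[of "Transposition.transpose k (k + 1) \<circ> w"] Cons[of "Transposition.transpose k (k + 1)"]
      by (simp add: comp_assoc)
  qed simp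
  from this[of "Transposition.transpose k (k + 1)" ks] show ?thesis
    by (simp add: word_perm_def)
qed

lemma bij_word_perm: "bij (word_perm ks)"
proof (induction ks)
  case (Cons k ks)
  then show ?case unfolding word_perm_Cons by (intro bij_comp) auto
next
  case Nil
  show ?case unfolding word_perm_def foldl.simps by (rule bij_id)
qed

lemma u_perm_eq: "u_perm n l = word_perm (rev (map snd (take l (positions n))))"
proof -
  have "drop (num_coords n - l) (full_word n) = rev (take l (rev (full_word n)))"
    using arg_cong[OF rev_full_word, of length n] by (simp add: rev_take length_positions)
  then show ?thesis by (simp add: u_perm_def rev_full_word take_map)
qed

lemma u_perm_Suc:
  assumes "l < num_coords n"
  shows "u_perm n (Suc l) =
    u_perm n l \<circ> Transposition.transpose (snd (positions n ! l)) (snd (positions n ! l) + 1)"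
  using assms by (simp add: u_perm_eq take_Suc_conv_app_nth length_positions word_perm_Cons)

text \<open>
  The permutation \<open>k+1, \<dots>, k+a, k, k+a+1, \<dots>, n, k-1, \<dots>, 1\<close> in one-line notation; it is \<open>u\<^sub>\<ell>\<close> when the
  \<open>\<ell>\<close>-th position is \<open>(k, a)\<close>.
\<close>

definition u_explicit :: "nat \<Rightarrow> nat \<Rightarrow> nat \<Rightarrow> nat \<Rightarrow> nat" where
  "u_explicit n k a i =
    (if i < 1 \<or> n < i then i else if i \<le> a then i + k else if i = a + 1 then k
     else if i \<le> n - k + 1 then i + k - 1 else n + 1 - i)"

text \<open>The cells up to \<open>(k, a)\<close> in reading order. The value \<open>a = 0\<close>
  is allowed and stands for \<open>k - 1\<close> complete rows and nothing in row
  \<open>k\<close>.\<close>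

definition lead :: "nat \<Rightarrow> nat \<Rightarrow> nat \<Rightarrow> (nat \<times> nat) set" where
  "lead n k a = {(i, j). 1 \<le> i \<and> 1 \<le> j \<and> i + j \<le> n \<and> (i < k \<or> i = k \<and> j \<le> a)}"

lemma u_explicit_step:
  assumes "1 \<le> k" "k \<le> n" "a < n - k"
  shows "u_explicit n k a \<circ> Transposition.transpose (a + 1) (a + 1 + 1) = u_explicit n k (a + 1)"
  using assms by (auto simp: fun_eq_iff u_explicit_def Transposition.transpose_def)

text \<open>The end of row \<open>k\<close> and the empty beginning of row \<open>k + 1\<close> are
  the same moment in the walk; this identity carries the induction across a change of rows.\<close>

lemma u_explicit_next_row:
  assumes "1 \<le> k" "k < n"
  shows "u_explicit n k (n - k) = u_explicit n (k + 1) 0"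
  using assms by (auto simp: fun_eq_iff u_explicit_def)

text \<open>The permutation, the set of visited cells and the last cell are followed simultaneously,
  starting from \<open>(k, a) = (1, 0)\<close>. The next cell is \<open>(k, a + 1)\<close> while row
  \<open>k\<close> has room, and \<open>(k + 1, 1)\<close> otherwise.\<close>

lemma first_positions:
  assumes "1 \<le> n" "l \<le> num_coords n"
  shows "\<exists>k a. 1 \<le> k \<and> k \<le> n \<and> a \<le> n - k \<and> u_perm n l = u_explicit n k a \<and>
    set (take l (positions n)) = lead n k a \<and> (0 < l \<longrightarrow> 0 < a \<and> positions n ! (l - 1) = (k, a))"
  using assms(2)
proof (induction l)
  case 0
  have "u_perm n 0 = u_explicit n 1 0"
    using assms(1) by (auto simp: u_perm_eq word_perm_def u_explicit_def fun_eq_iff)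
  then show ?case using assms(1) by (intro exI[of _ 1] exI[of _ 0]) (auto simp: lead_def)
next
  case (Suc l)
  then obtain k a where ka: "1 \<le> k" "k \<le> n" "a \<le> n - k" "u_perm n l = u_explicit n k a"
    "set (take l (positions n)) = lead n k a" by auto
  define p where "p = positions n ! l"
  have l: "l < length (positions n)" using Suc.prems by (simp add: length_positions)
  have p: "p \<in> set (positions n)" using l by (simp add: p_def)
  have "p \<notin> set (take l (positions n))"
    using distinct_positions[of n] l by (auto simp: p_def in_set_conv_nth nth_eq_iff_index_eq)
  then have p_lead: "p \<notin> lead n k a" by (simp add: ka)
  have "p \<in> {(i, j). 1 \<le> i \<and> 1 \<le> j \<and> i + j \<le> n}" using p by (simp only: set_positions)
  then obtain k' a' where p': "p = (k', a')" "1 \<le> k'" "1 \<le> a'" "k' + a' \<le> n" by blast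
  with p_lead have np: "\<not> k' < k" "k' = k \<Longrightarrow> a < a'" by (auto simp: lead_def)
  \<comment> \<open>Since the list is strictly sorted, its entry at index \<open>l\<close> is the
    smallest position not among the first \<open>l\<close>.\<close>
  have least: "p = x \<or> lex_less p x" if x: "x \<in> set (positions n)" "x \<notin> lead n k a" for x
  proof -
    obtain l' where l': "l' < length (positions n)" "x = positions n ! l'"
      using x(1) by (auto simp: in_set_conv_nth)
    have "\<not> l' < l"
      using x(2) l' l unfolding ka(5)[symmetric] by (auto simp: in_set_conv_nth)
    then have "l < l' \<or> l = l'" by auto
    then show ?thesis
      using sorted_wrt_nth_less[OF sorted_positions _ l'(1), of l] l'
      by (auto simp: p_def)
  qed
  have take: "set (take (Suc l) (positions n)) = insert p (lead n k a)"
    using l by (simp add: take_Suc_conv_app_nth p_def ka)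
  show ?case
  proof (cases "a < n - k")
    case True
    have "k + (a + 1) \<le> n" using True by simp
    then have "p = (k, a + 1) \<or> lex_less p (k, a + 1)"
      using ka(1) by (intro least) (auto simp: set_positions lead_def)
    then have "p = (k, a + 1)"
      using p' np by (auto simp: lex_less_def)
    moreover have "insert (k, a + 1) (lead n k a) = lead n k (a + 1)"
      using True ka(1-3) by (auto simp: lead_def)
    ultimately show ?thesis
      using True ka u_explicit_step[of k n a] u_perm_Suc[of l n] Suc.prems take
      by (intro exI[of _ k] exI[of _ "a + 1"]) (simp add: p_def)
  next
    case False
    then have a: "a = n - k" using ka by simp
    have kk': "k < k'" using p' np a by (cases "k' = k") auto
    then have kn: "k + 2 \<le> n" using p' by simp
    have "p = (k + 1, 1) \<or> lex_less p (k + 1, 1)"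
      using kn by (intro least) (auto simp: set_positions lead_def)
    then have p1: "p = (k + 1, 1)"
      using p' kk' by (auto simp: lex_less_def)
    moreover have "insert (k + 1, 1) (lead n k a) = lead n (k + 1) 1"
      using a kn by (auto simp: lead_def)
    moreover have "u_perm n (Suc l) = u_explicit n (k + 1) 1"
      using u_perm_Suc[of l n] Suc.prems p1 u_explicit_step[of "k + 1" n 0] u_explicit_next_row[of k n]
        ka a kn by (simp add: p_def)
    ultimately show ?thesis
      using kn take by (intro exI[of _ "k + 1"] exI[of _ 1]) (simp add: p_def)
  qed
qed

text \<open>This serves twice: it places \<open>lead\<close> inside the diagram, and it makes the
  rank condition for \<open>p = j\<close> and \<open>q = i\<close> demand the full dimension
  \<open>j\<close>.\<close>

lemma u_explicit_greater:
  assumes "1 \<le> k" "k \<le> n" "a \<le> n - k" "(i, j) \<in> lead n k a" "1 \<le> j'" "j' \<le> j"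
  shows "i < u_explicit n k a j'"
  using assms by (auto simp: lead_def u_explicit_def)

lemma diagram_u_explicit:
  assumes ka: "1 \<le> k" "k \<le> n" "a \<le> n - k" and bij: "bij (u_explicit n k a)"
  shows "diagram n (inv_into UNIV (u_explicit n k a)) = lead n k a"
proof -
  let ?u = "u_explicit n k a"
  have D: "diagram n (inv_into UNIV ?u) =
      {(i, j). i \<in> {1..n} \<and> j \<in> {1..n} \<and> i < ?u j \<and> (\<forall>j'\<in>{1..j}. ?u j' \<noteq> i)}"
    (is "_ = ?R")
  proof (rule Set.set_eqI)
    fix x :: "nat \<times> nat"
    obtain i j where x: "x = (i, j)" by (cases x)
    have "x \<in> diagram n (inv_into UNIV ?u) \<longleftrightarrow> i \<in> {1..n} \<and> j \<in> {1..n} \<and>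
        (\<forall>k\<in>{1..n}. \<not> (i = ?u k \<and> k \<le> j) \<and> \<not> (j = k \<and> ?u k \<le> i))"
      unfolding diagram_def inv_inv_eq[OF bij] Let_def x by blast
    also have "\<dots> \<longleftrightarrow> x \<in> ?R" unfolding x by (auto simp: not_le)
    finally show "x \<in> diagram n (inv_into UNIV ?u) \<longleftrightarrow> x \<in> ?R" .
  qed
  show ?thesis unfolding D
  proof (intro equalityI subsetI)
    fix x assume x: "x \<in> lead n k a"
    obtain i j where ij: "x = (i, j)" by (cases x)
    have "i < ?u j'" if "1 \<le> j'" "j' \<le> j" for j'
      using u_explicit_greater[OF ka] x that unfolding ij by blast
    then show "x \<in> {(i, j). i \<in> {1..n} \<and> j \<in> {1..n} \<and> i < ?u j \<and> (\<forall>j'\<in>{1..j}. ?u j' \<noteq> i)}"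
      using x unfolding ij by (fastforce simp: lead_def)
  next
    fix x assume x: "x \<in> {(i, j). i \<in> {1..n} \<and> j \<in> {1..n} \<and> i < ?u j \<and> (\<forall>j'\<in>{1..j}. ?u j' \<noteq> i)}"
    obtain i j where ij: "x = (i, j)" by (cases x)
    have i: "1 \<le> i" "i \<le> n" and j: "1 \<le> j" "j \<le> n" and lt: "i < ?u j"
      and ne: "\<And>j'. 1 \<le> j' \<Longrightarrow> j' \<le> j \<Longrightarrow> ?u j' \<noteq> i"
      using x ij by auto
    \<comment> \<open>The 1 of row \<open>i\<close> stands in column \<open>n + 1 - i\<close>,
      \<open>a + 1\<close>, \<open>i - k\<close> or \<open>i - k + 1\<close> respectively, and the
      cells from there on are removed. In the last two cases each cell to its left lies below the 1
      of its own column, so nothing of the row survives.\<close>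
    consider "i < k" | "i = k" | "k < i" "i \<le> k + a" | "k + a < i" by linarith
    then show "x \<in> lead n k a"
    proof cases
      case 1
      then have "?u (n + 1 - i) = i" using ka i by (auto simp: u_explicit_def)
      moreover have "1 \<le> n + 1 - i" using i by simp
      ultimately have "\<not> n + 1 - i \<le> j" using ne[of "n + 1 - i"] by blast
      then show ?thesis using 1 i j ij by (auto simp: lead_def)
    next
      case 2
      have "?u (a + 1) = k" using ka by (auto simp: u_explicit_def)
      then have "\<not> a + 1 \<le> j" using ne[of "a + 1"] 2 by auto
      then show ?thesis using 2 i j ij ka by (auto simp: lead_def)
    next
      case 3
      then have "?u (i - k) = i" using ka by (auto simp: u_explicit_def)
      then have "j < i - k" using ne[of "i - k"] 3 by force
      then show ?thesis using lt 3 j ka by (auto simp: u_explicit_def split: if_splits)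
    next
      case 4
      then have "?u (i - k + 1) = i" using ka i by (auto simp: u_explicit_def)
      then have "j < i - k + 1" using ne[of "i - k + 1"] 4 by force
      then show ?thesis using lt 4 i j ka by (auto simp: u_explicit_def split: if_splits)
    qed
  qed
qed

text \<open>For \<open>0 < a\<close> the last non-empty row is row \<open>k\<close>. A corner ends
  its row, so \<open>(k, a)\<close> is the only one there, and the other corners lie in higher
  rows.\<close>

lemma lowest_corner_lead:
  assumes ka: "1 \<le> k" "k \<le> n" "a \<le> n - k" "0 < a"
  shows "lowest_corner (lead n k a) = (k, a)"
  unfolding lowest_corner_def
proof (rule the_equality)
  show "(k, a) \<in> corners (lead n k a) \<and> (\<forall>c'\<in>corners (lead n k a). fst c' \<le> fst (k, a))"
    using ka by (auto simp: corners_def lead_def)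
next
  fix c assume c: "c \<in> corners (lead n k a) \<and> (\<forall>c'\<in>corners (lead n k a). fst c' \<le> fst c)"
  moreover have "(k, a) \<in> corners (lead n k a)" using ka by (auto simp: corners_def lead_def)
  ultimately have "k \<le> fst c" by force
  with c show "c = (k, a)" using ka by (cases c) (auto simp: corners_def lead_def)
qed

lemma lowest_corner_u_perm:
  assumes "1 \<le> n" "l \<in> {1..num_coords n}"
  shows "lowest_corner (diagram n (inv_into UNIV (u_perm n l))) = positions n ! (l - 1)"
proof -
  have "l \<le> num_coords n" "0 < l" using assms(2) by auto
  from first_positions[OF assms(1) this(1)] this(2)
  obtain k a where ka: "1 \<le> k" "k \<le> n" "a \<le> n - k" "u_perm n l = u_explicit n k a"
    "0 < a" "positions n ! (l - 1) = (k, a)" by blast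
  have "bij (u_explicit n k a)" using bij_word_perm by (simp add: u_perm_eq flip: ka(4))
  then show ?thesis using ka by (simp add: diagram_u_explicit lowest_corner_lead)
qed

section \<open>Flags of matrices\<close>

definition first_cols :: "nat \<Rightarrow> complex mat \<Rightarrow> complex mat" where
  "first_cols p M = mat (dim_row M) p (\<lambda>(i, j). M $$ (i, j))"

lemma first_cols_carrier [simp]: "M \<in> carrier_mat n m \<Longrightarrow> first_cols p M \<in> carrier_mat n p"
  by (simp add: first_cols_def)

lemma dim_first_cols [simp]: "dim_row (first_cols p M) = dim_row M" "dim_col (first_cols p M) = p"
  by (simp_all add: first_cols_def)

lemma flag_of_eq_range:
  assumes M: "M \<in> carrier_mat n n" and p: "p \<in> {1..n}"
  shows "flag_of n M p = mat_range (first_cols p M)"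
proof -
  have "set (cols (first_cols p M)) = col (first_cols p M) ` {0..<p}"
    using M by (simp add: cols_def first_cols_def)
  also have "\<dots> = col M ` {0..<p}"
    using M p by (intro image_cong) (auto simp: first_cols_def col_def)
  also have "\<dots> = (\<lambda>j. col M (j - 1)) ` {1..p}"
  proof -
    have "{0..<p} = (\<lambda>j. j - 1) ` {1..p}"
      by (auto simp: image_iff intro!: bexI[of _ "Suc _"])
    then show ?thesis by (simp add: image_image)
  qed
  finally show ?thesis
    using span_cols[of "first_cols p M"] M p by (simp add: flag_of_def)
qed

lemma first_cols_mult:
  assumes M: "M \<in> carrier_mat n n" and c: "c \<in> carrier_vec p" and p: "p \<le> n"
  shows "first_cols p M *\<^sub>v c = M *\<^sub>v vec n (\<lambda>t. if t < p then c $ t else 0)"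
proof
  fix i assume "i < dim_vec (M *\<^sub>v vec n (\<lambda>t. if t < p then c $ t else 0))"
  then have i: "i < n" using M by simp
  have "(\<Sum>t<n. M $$ (i, t) * (if t < p then c $ t else 0)) = (\<Sum>t<p. M $$ (i, t) * c $ t)"
    using p by (intro sum.mono_neutral_cong_right) auto
  then show "(first_cols p M *\<^sub>v c) $ i = (M *\<^sub>v vec n (\<lambda>t. if t < p then c $ t else 0)) $ i"
    using M c i by (simp add: first_cols_def scalar_prod_def atLeast0LessThan)
qed (use M in simp)

text \<open>Coefficient vectors are kept at full length \<open>n\<close> with zeros from index
  \<open>p\<close> on, so that members of a flag can be multiplied by square matrices without
  truncation.\<close>

lemma mem_flag_of:
  assumes M: "M \<in> carrier_mat n n" and p: "p \<in> {1..n}"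
  shows "v \<in> flag_of n M p \<longleftrightarrow>
    (\<exists>c\<in>carrier_vec n. (\<forall>t<n. p \<le> t \<longrightarrow> c $ t = 0) \<and> v = M *\<^sub>v c)"
proof
  assume "v \<in> flag_of n M p"
  then obtain c where c: "c \<in> carrier_vec p" "v = first_cols p M *\<^sub>v c"
    using flag_of_eq_range[OF assms] by auto
  then show "\<exists>c\<in>carrier_vec n. (\<forall>t<n. p \<le> t \<longrightarrow> c $ t = 0) \<and> v = M *\<^sub>v c"
    using first_cols_mult[OF M c(1)] p
    by (intro bexI[of _ "vec n (\<lambda>t. if t < p then c $ t else 0)"]) auto
next
  assume "\<exists>c\<in>carrier_vec n. (\<forall>t<n. p \<le> t \<longrightarrow> c $ t = 0) \<and> v = M *\<^sub>v c"
  then obtain c where c: "c \<in> carrier_vec n" "\<forall>t<n. p \<le> t \<longrightarrow> c $ t = 0" "v = M *\<^sub>v c" by blast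
  have "c = vec n (\<lambda>t. if t < p then vec p (\<lambda>t. c $ t) $ t else 0)" using c(1,2) by auto
  then have "v = first_cols p M *\<^sub>v vec p (\<lambda>t. c $ t)"
    using first_cols_mult[OF M, of "vec p (\<lambda>t. c $ t)" p] p c(3) by simp
  then show "v \<in> flag_of n M p" using flag_of_eq_range[OF assms] by auto
qed

lemma first_cols_inj:
  assumes M: "M \<in> carrier_mat n n" and p: "p \<le> n"
    and inj: "\<And>c. c \<in> carrier_vec n \<Longrightarrow> M *\<^sub>v c = 0\<^sub>v n \<Longrightarrow> c = 0\<^sub>v n"
    and c: "c \<in> carrier_vec p" "first_cols p M *\<^sub>v c = 0\<^sub>v n"
  shows "c = 0\<^sub>v p"
proof
  have z: "vec n (\<lambda>t. if t < p then c $ t else 0) = 0\<^sub>v n"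
    by (rule inj) (use c first_cols_mult[OF M c(1) p] in auto)
  fix i assume "i < dim_vec (0\<^sub>v p :: complex vec)"
  then have i: "i < p" by simp
  then have "vec n (\<lambda>t. if t < p then c $ t else 0) $ i = 0" using p unfolding z by simp
  then show "c $ i = 0\<^sub>v p $ i" using i p by simp
qed (use c in simp)

lemma flag_of_in_flags:
  assumes M: "M \<in> carrier_mat n n"
    and inj: "\<And>c. c \<in> carrier_vec n \<Longrightarrow> M *\<^sub>v c = 0\<^sub>v n \<Longrightarrow> c = 0\<^sub>v n"
  shows "flag_of n M \<in> flags n"
proof -
  have dim: "subspace_dim n (flag_of n M i) = i" if "i \<in> {1..n}" for i
    unfolding flag_of_eq_range[OF M that]
    by (rule subspace_dim_mat_range[OF first_cols_carrier[OF M]])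
      (use that in \<open>auto intro: first_cols_inj[OF M _ inj]\<close>)
  have "VectorSpace.subspace class_ring (flag_of n M i) (module_vec TYPE(complex) n)" if "i \<in> {1..n}" for i
    unfolding flag_of_eq_range[OF M that] by (rule subspace_mat_range[OF first_cols_carrier[OF M]])
  moreover have "flag_of n M i \<subset> flag_of n M (i + 1)" if i: "i \<in> {1..<n}" for i
  proof
    show "flag_of n M i \<subseteq> flag_of n M (i + 1)"
      using mem_flag_of[OF M, of i] mem_flag_of[OF M, of "i + 1"] i by fastforce
    show "flag_of n M i \<noteq> flag_of n M (i + 1)"
      using dim[of i] dim[of "i + 1"] i by auto
  qed
  ultimately show ?thesis
    using dim by (simp add: flags_def) (simp add: flag_of_def)
qed

lemma chart_matricesD:
  assumes "X \<in> chart_matrices n"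
  shows "X \<in> carrier_mat n n"
    and "i < n \<Longrightarrow> X $$ (i, n - 1 - i) = 1"
    and "i < n \<Longrightarrow> j < n \<Longrightarrow> n - 1 < i + j \<Longrightarrow> X $$ (i, j) = 0"
proof -
  show "X \<in> carrier_mat n n" using assms by (simp add: chart_matrices_def)
  have *: "\<forall>i\<in>{1..n}. entry X i (n + 1 - i) = 1"
    "\<forall>i\<in>{1..n}. \<forall>j\<in>{1..n}. n + 1 < i + j \<longrightarrow> entry X i j = 0"
    using assms by (auto simp: chart_matrices_def)
  show "X $$ (i, n - 1 - i) = 1" if "i < n"
    using bspec[OF *(1), of "Suc i"] that by simp
  show "X $$ (i, j) = 0" if "i < n" "j < n" "n - 1 < i + j"
    using bspec[OF bspec[OF *(2), of "Suc i"], of "Suc j"] that by simp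
qed

text \<open>Forward substitution: with indices from 0, row \<open>n - 1 - t\<close> of
  \<open>X\<close> vanishes beyond column \<open>t\<close> and has a 1 in it, so the equation of
  this row gives \<open>c $ t\<close> from the earlier entries.\<close>

lemma chart_matrix_inj:
  assumes X: "X \<in> chart_matrices n" and c: "c \<in> carrier_vec n" "X *\<^sub>v c = 0\<^sub>v n"
  shows "c = 0\<^sub>v n"
proof
  fix t assume "t < dim_vec (0\<^sub>v n :: complex vec)"
  then have "t < n" by simp
  then have "c $ t = 0"
  proof (induction t rule: less_induct)
    case (less t)
    let ?i = "n - 1 - t"
    have i: "?i < n" "n - 1 - ?i = t" using less.prems by auto
    have "0 = (\<Sum>s<n. X $$ (?i, s) * c $ s)"
      using arg_cong[OF c(2), of "\<lambda>v. v $ ?i"] i c(1) chart_matricesD(1)[OF X]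
      by (simp add: scalar_prod_def atLeast0LessThan)
    also have "\<dots> = X $$ (?i, t) * c $ t + (\<Sum>s\<in>{..<n} - {t}. X $$ (?i, s) * c $ s)"
      by (rule sum.remove) (use less.prems in auto)
    also have "(\<Sum>s\<in>{..<n} - {t}. X $$ (?i, s) * c $ s) = 0"
    proof (rule sum.neutral, rule ballI)
      fix s assume s: "s \<in> {..<n} - {t}"
      show "X $$ (?i, s) * c $ s = 0"
      proof (cases "s < t")
        case True
        then show ?thesis using less.IH s by simp
      next
        case False
        then show ?thesis using chart_matricesD(3)[OF X i(1), of s] s by auto
      qed
    qed
    finally show ?case using chart_matricesD(2)[OF X i(1)] i(2) by simp
  qed
  then show "c $ t = 0\<^sub>v n $ t" using \<open>t < n\<close> by simp
qed (use c in simp)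

section \<open>Dual Schubert conditions on the chart\<close>

lemma dual_flag_eq:
  assumes q: "q \<le> n"
  shows "dual_flag n (n - q) = {v \<in> carrier_vec n. \<forall>i<q. v $ i = 0}"
proof -
  let ?C = "mat n (n - q) (\<lambda>(i, j). if i = j + q then 1 else 0) :: complex mat"
  have "set (cols ?C) = col ?C ` {0..<n - q}" by (simp add: cols_def)
  also have "\<dots> = (\<lambda>k. unit_vec n (k - 1)) ` {n + 1 - (n - q)..n}"
  proof -
    have "col ?C j = unit_vec n (j + q)" if "j < n - q" for j
      by (rule eq_vecI) (use that in \<open>auto simp: unit_vec_def\<close>)
    moreover have "{n + 1 - (n - q)..n} = (\<lambda>j. j + q + 1) ` {0..<n - q}"
    proof (intro equalityI subsetI)
      fix x assume "x \<in> {n + 1 - (n - q)..n}"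
      then show "x \<in> (\<lambda>j. j + q + 1) ` {0..<n - q}"
        using q by (intro image_eqI[of _ _ "x - q - 1"]) auto
    qed (use q in auto)
    ultimately show ?thesis by (auto simp: image_image intro!: image_cong)
  qed
  finally have "dual_flag n (n - q) = mat_range ?C"
    using span_cols[of ?C] by (simp add: dual_flag_def)
  moreover have C: "(?C *\<^sub>v c) $ i = (if i < q then 0 else c $ (i - q))"
    if "c \<in> carrier_vec (n - q)" "i < n" for c i
  proof -
    have "(?C *\<^sub>v c) $ i = (\<Sum>j<n - q. if i = j + q then c $ j else 0)"
      using that by (auto simp: scalar_prod_def atLeast0LessThan intro!: sum.cong)
    also have "\<dots> = (\<Sum>j<n - q. if j = i - q then (if i < q then 0 else c $ j) else 0)"
      by (rule sum.cong) auto
    also have "\<dots> = (if i < q then 0 else c $ (i - q))"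
      using that by (subst sum.delta) auto
    finally show ?thesis .
  qed
  moreover have "v \<in> mat_range ?C" if v: "v \<in> carrier_vec n" "\<forall>i<q. v $ i = 0" for v
  proof -
    have "v = ?C *\<^sub>v vec (n - q) (\<lambda>j. v $ (j + q))"
      by (rule eq_vecI) (use v C[of "vec (n - q) (\<lambda>j. v $ (j + q))"] in \<open>auto simp del: index_mult_mat_vec\<close>)
    then show ?thesis by (rule image_eqI) simp
  qed
  moreover have "?C *\<^sub>v c \<in> carrier_vec n" for c by (rule carrier_vecI) simp
  ultimately show ?thesis using q by (fastforce simp del: index_mult_mat_vec)
qed

lemma flag_inter_dual_flag:
  assumes M: "M \<in> carrier_mat n n" and p: "p \<in> {1..n}" and q: "q \<le> n"
  shows "flag_of n M p \<inter> dual_flag n (n - q) = {v \<in> mat_range (first_cols p M). \<forall>i<q. v $ i = 0}"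
  using mult_mat_vec_carrier[OF first_cols_carrier[OF M]]
  by (auto simp: flag_of_eq_range[OF M p] dual_flag_eq[OF q])

text \<open>For \<open>1 \<le> r \<le> n\<close>, the column in which the permutation matrix of
  \<open>u_explicit n k a\<close> has the 1 of row \<open>r\<close>.\<close>

definition u_preimage :: "nat \<Rightarrow> nat \<Rightarrow> nat \<Rightarrow> nat \<Rightarrow> nat" where
  "u_preimage n k a r = (if r < k then n + 1 - r else if r = k then a + 1
     else if r \<le> k + a then r - k else r - k + 1)"

lemma u_explicit_preimage:
  assumes "1 \<le> k" "k \<le> n" "a \<le> n - k" "1 \<le> r" "r \<le> n"
  shows "u_explicit n k a (u_preimage n k a r) = r"
  using assms by (auto simp: u_preimage_def u_explicit_def)

text \<open>In the one-line notation of \<open>u_explicit n k a\<close> the values above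
  \<open>k\<close> appear in increasing order.\<close>

lemma u_preimage_le:
  assumes ka: "1 \<le> k" "k \<le> n" "a \<le> n - k" and r: "k < r" "r \<le> n"
    and i: "1 \<le> i" "i \<le> n" "r < u_explicit n k a i"
  shows "u_preimage n k a r \<le> i"
  using assms by (auto simp: u_preimage_def u_explicit_def split: if_splits)

text \<open>At a cell \<open>(i, j)\<close> of \<open>lead\<close> the condition for
  \<open>p = j\<close> and \<open>q = i\<close> forces the first \<open>j\<close> columns into the
  space of vectors whose first \<open>i\<close> entries vanish. Conversely, every row among the
  first \<open>q\<close> that is non-zero in the first \<open>p\<close> columns is matched with its
  own index at most \<open>p\<close> whose value is at most \<open>q\<close>; the number of linear
  conditions on the \<open>p\<close>-th flag member is therefore at most \<open>p\<close> minus the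
  required dimension.\<close>

lemma dual_schubert_flag_of:
  assumes ka: "1 \<le> k" "k \<le> n" "a \<le> n - k" and X: "X \<in> chart_matrices n"
  shows "flag_of n X \<in> dual_schubert n (u_explicit n k a) \<longleftrightarrow> (\<forall>(i, j)\<in>lead n k a. entry X i j = 0)"
proof
  note XC = chart_matricesD(1)[OF X]
  let ?u = "u_explicit n k a"
  assume dual: "flag_of n X \<in> dual_schubert n ?u"
  show "\<forall>(i, j)\<in>lead n k a. entry X i j = 0"
  proof (intro ballI, clarify)
    fix i j assume ij: "(i, j) \<in> lead n k a"
    then have i: "i \<in> {1..n}" and j: "j \<in> {1..n}" by (auto simp: lead_def)
    have "{i' \<in> {1..j}. i + 1 \<le> ?u i'} = {1..j}"
      using u_explicit_greater[OF ka ij] by (auto simp: Suc_le_eq)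
    then have "card {i' \<in> {1..j}. i + 1 \<le> ?u i'} = j" by simp
    moreover have "card {i' \<in> {1..j}. i + 1 \<le> ?u i'} \<le> subspace_dim n (flag_of n X j \<inter> dual_flag n (n - i))"
      using dual i j unfolding dual_schubert_def by blast
    moreover have "i \<le> n" using i by simp
    ultimately have "j \<le> subspace_dim n {v \<in> mat_range (first_cols j X). \<forall>t<i. v $ t = 0}"
      by (simp only: flag_inter_dual_flag[OF XC j])
    moreover have "col X (j - 1) \<in> mat_range (first_cols j X)"
    proof -
      have "col X (j - 1) = first_cols j X *\<^sub>v unit_vec j (j - 1)"
        using XC j by (intro eq_vecI) (auto simp: first_cols_def scalar_prod_right_unit)
      then show ?thesis by (rule image_eqI) simp
    qed
    moreover have "c = 0\<^sub>v j" if "c \<in> carrier_vec j" "first_cols j X *\<^sub>v c = 0\<^sub>v n" for c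
      by (rule first_cols_inj[OF XC _ chart_matrix_inj[OF X] that]) (use j in auto)
    moreover have "i - 1 < i" using i by simp
    ultimately have "col X (j - 1) $ (i - 1) = 0"
      using kernel_full_dim[OF first_cols_carrier[OF XC] _ \<open>i \<le> n\<close>] by blast
    then show "entry X i j = 0" using XC i j by auto
  qed
next
  note XC = chart_matricesD(1)[OF X]
  let ?u = "u_explicit n k a"
  assume zero: "\<forall>(i, j)\<in>lead n k a. entry X i j = 0"
  have "card {i \<in> {1..p}. q + 1 \<le> ?u i} \<le> subspace_dim n (flag_of n X p \<inter> dual_flag n (n - q))"
    if p: "p \<in> {1..n}" and q: "q \<in> {1..n}" for p q
  proof (cases "\<exists>i\<in>{1..p}. q + 1 \<le> ?u i")
    case False
    then have "{i \<in> {1..p}. q + 1 \<le> ?u i} = {}" by blast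
    then show ?thesis by (metis card.empty zero_le)
  next
    case True
    then obtain i0 where i0: "1 \<le> i0" "i0 \<le> p" "q < ?u i0" by auto
    \<comment> \<open>With rows numbered from 0, these are the rows among the first \<open>q\<close>
      that really impose a condition on the span of the first \<open>p\<close> columns.\<close>
    define R where "R = {r. r < q \<and> (\<exists>c<p. X $$ (r, c) \<noteq> 0)}"
    have R: "finite R" "R \<subseteq> {..<n}" using q by (auto simp: R_def)
    let ?L = "{i \<in> {1..p}. \<not> q + 1 \<le> ?u i}"
    have "u_preimage n k a (Suc r) \<in> ?L" if r: "r \<in> R" for r
    proof -
      obtain c where c: "c < p" "X $$ (r, c) \<noteq> 0" using r by (auto simp: R_def)
      have rq: "r < q" "Suc r \<le> n" "c < n" using r q p c by (auto simp: R_def)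
      have not_lead: "(Suc r, Suc c) \<notin> lead n k a"
        using zero c(2) by auto
      have not_zero: "\<not> n - 1 < r + c" using chart_matricesD(3)[OF X, of r c] rq c by auto
      have "1 \<le> u_preimage n k a (Suc r)" using rq by (auto simp: u_preimage_def)
      moreover have "u_preimage n k a (Suc r) \<le> p"
      proof -
        \<comment> \<open>Up to row \<open>k\<close>, the 1 of a row stands directly to the right of
          its cells in \<open>lead\<close>, and a non-zero entry cannot stand further to the left.
          Below row \<open>k\<close> the increasing order of the large values applies, compared with
          the index \<open>i0\<close> supplied by the case distinction.\<close>
        consider "Suc r \<le> k" | "k < Suc r" by linarith
        then show ?thesis
        proof cases
          case 1
          then show ?thesis
            using not_lead not_zero rq c ka by (auto simp: u_preimage_def lead_def)
        next
          case 2
          have "u_preimage n k a (Suc r) \<le> i0"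
            by (rule u_preimage_le[OF ka 2 rq(2)]) (use i0 p rq in auto)
          then show ?thesis using i0 by simp
        qed
      qed
      moreover have "?u (u_preimage n k a (Suc r)) = Suc r"
        using u_explicit_preimage[OF ka] rq by simp
      ultimately show ?thesis using rq by auto
    qed
    then have "(\<lambda>r. u_preimage n k a (Suc r)) ` R \<subseteq> ?L" by blast
    moreover have "inj_on (\<lambda>r. u_preimage n k a (Suc r)) R"
    proof (rule inj_onI)
      fix r s assume rs: "r \<in> R" "s \<in> R" "u_preimage n k a (Suc r) = u_preimage n k a (Suc s)"
      have "?u (u_preimage n k a (Suc t)) = Suc t" if "t \<in> R" for t
        by (rule u_explicit_preimage[OF ka]) (use that q in \<open>auto simp: R_def\<close>)
      from this[OF rs(1)] this[OF rs(2)] show "r = s" unfolding rs(3) by linarith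
    qed
    ultimately have cardR: "card R \<le> card ?L" by (intro card_inj_on_le) auto
    have split: "card {i \<in> {1..p}. q + 1 \<le> ?u i} + card ?L = p"
    proof -
      have "card {i \<in> {1..p}. q + 1 \<le> ?u i} + card ?L = card ({i \<in> {1..p}. q + 1 \<le> ?u i} \<union> ?L)"
        by (rule card_Un_disjoint[symmetric]) auto
      also have "{i \<in> {1..p}. q + 1 \<le> ?u i} \<union> ?L = {1..p}" by blast
      finally show ?thesis by simp
    qed
    have "{v \<in> mat_range (first_cols p X). \<forall>i<q. v $ i = 0} = {v \<in> mat_range (first_cols p X). \<forall>i\<in>R. v $ i = 0}"
    proof -
      have "v $ i = 0" if v: "v \<in> mat_range (first_cols p X)" and i: "i < q" "i \<notin> R" for v i
      proof -
        obtain c where c: "c \<in> carrier_vec p" "v = first_cols p X *\<^sub>v c" using v by auto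
        have "X $$ (i, t) = 0" if "t < p" for t using i that by (auto simp: R_def)
        then show ?thesis
          using c i q XC by (auto simp: first_cols_def scalar_prod_def intro!: sum.neutral)
      qed
      then show ?thesis by (auto simp: R_def)
    qed
    moreover have "p \<le> subspace_dim n {v \<in> mat_range (first_cols p X). \<forall>i\<in>R. v $ i = 0} + card R"
      by (rule subspace_dim_kernel_ge[OF first_cols_carrier[OF XC] _ R])
        (use p in \<open>auto intro: first_cols_inj[OF XC _ chart_matrix_inj[OF X]]\<close>)
    moreover have "q \<le> n" using q by simp
    ultimately have "p \<le> subspace_dim n (flag_of n X p \<inter> dual_flag n (n - q)) + card R"
      by (simp only: flag_inter_dual_flag[OF XC p])
    then show ?thesis using split cardR by linarith
  qed
  then show "flag_of n X \<in> dual_schubert n ?u"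
    using flag_of_in_flags[OF XC chart_matrix_inj[OF X]] by (simp add: dual_schubert_def)
qed

section \<open>The Hessenberg condition in terms of flags\<close>

lemma hessenberg_function_mono:
  assumes h: "hessenberg_function n h" and ij: "1 \<le> i" "i \<le> j" "j \<le> n"
  shows "h i \<le> h j"
  using ij(2,3)
proof (induction j rule: dec_induct)
  case (step j)
  have "h j \<le> h (Suc j)" using h step ij(1) by (auto simp: hessenberg_function_def)
  with step show ?case by simp
qed simp

text \<open>The definition only provides some representative \<open>M\<close> of the flag. Column
  \<open>j\<close> of \<open>X\<close> is a combination of the first \<open>j\<close> columns of
  \<open>M\<close>, and \<open>h\<close> is monotone, so \<open>N\<close> still sends it into flag
  member \<open>h j\<close>. In the other direction \<open>X\<close> itself is the
  representative.\<close>

lemma flag_of_in_hess: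
  assumes h: "hessenberg_function n h" and N: "N \<in> carrier_mat n n" and X: "X \<in> carrier_mat n n"
    and inj: "\<And>c. c \<in> carrier_vec n \<Longrightarrow> X *\<^sub>v c = 0\<^sub>v n \<Longrightarrow> c = 0\<^sub>v n"
  shows "flag_of n X \<in> hess n N h \<longleftrightarrow>
    (\<forall>j\<in>{1..n}. N *\<^sub>v col X (j - 1) \<in> flag_of n X (h j))"
proof
  assume "flag_of n X \<in> hess n N h"
  then obtain M M' where M: "M \<in> carrier_mat n n" and M': "M' \<in> carrier_mat n n"
    and inv: "inverts_mat M M'" and H: "M' * N * M \<in> hessenberg_space n h" and XM: "flag_of n X = flag_of n M"
    by (auto simp: hess_def)
  define A where "A = M' * N * M"
  have A: "A \<in> carrier_mat n n" using M M' N by (simp add: A_def)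
  have A0: "A $$ (i, j) = 0" if "i < n" "j < n" "h (Suc j) \<le> i" for i j
  proof -
    have "\<forall>i\<in>{1..n}. \<forall>j\<in>{1..n}. h j < i \<longrightarrow> entry A i j = 0"
      using H by (simp add: A_def hessenberg_space_def)
    from bspec[OF bspec[OF this, of "Suc i"], of "Suc j"] show ?thesis using that by simp
  qed
  have MA: "M * A = N * M"
  proof -
    have "M * A = (M * M') * N * M"
      using M M' N by (simp add: A_def assoc_mult_mat[of _ n n _ n _ n])
    also have "M * M' = 1\<^sub>m n" using inv M by (simp add: inverts_mat_def)
    finally show ?thesis using N by simp
  qed
  show "\<forall>j\<in>{1..n}. N *\<^sub>v col X (j - 1) \<in> flag_of n X (h j)"
  proof
    fix j assume j: "j \<in> {1..n}"
    have hj: "h j \<in> {1..n}" using h j unfolding hessenberg_function_def by blast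
    have "col X (j - 1) \<in> flag_of n X j"
      unfolding mem_flag_of[OF X j]
    proof (intro bexI[of _ "unit_vec n (j - 1)"] conjI)
      show "\<forall>t<n. j \<le> t \<longrightarrow> unit_vec n (j - 1) $ t = 0" using j by auto
      show "col X (j - 1) = X *\<^sub>v unit_vec n (j - 1)"
        using X j by (intro eq_vecI) (auto simp: scalar_prod_right_unit)
    qed simp
    then obtain c where c: "c \<in> carrier_vec n" "\<forall>t<n. j \<le> t \<longrightarrow> c $ t = 0" "col X (j - 1) = M *\<^sub>v c"
      unfolding XM mem_flag_of[OF M j] by blast
    have "N *\<^sub>v col X (j - 1) = M *\<^sub>v (A *\<^sub>v c)"
      unfolding c(3) using M N A c(1) MA by (simp flip: assoc_mult_mat_vec)
    moreover have "(A *\<^sub>v c) $ t = 0" if t: "t < n" "h j \<le> t" for t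
    proof -
      have "A $$ (t, s) * c $ s = 0" if s: "s < n" for s
      proof (cases "s < j")
        case True
        then have "h (Suc s) \<le> h j" using hessenberg_function_mono[OF h, of "Suc s" j] j by simp
        then show ?thesis using A0[of t s] s t by simp
      next
        case False
        then show ?thesis using c(2) s by simp
      qed
      then show ?thesis using A c(1) t by (auto simp: scalar_prod_def intro!: sum.neutral)
    qed
    ultimately show "N *\<^sub>v col X (j - 1) \<in> flag_of n X (h j)"
      unfolding XM mem_flag_of[OF M hj]
      using A c(1) by (intro bexI[of _ "A *\<^sub>v c"]) (auto simp del: index_mult_mat_vec)
  qed
next
  assume flag: "\<forall>j\<in>{1..n}. N *\<^sub>v col X (j - 1) \<in> flag_of n X (h j)"
  have "det X \<noteq> 0"
    using det_0_iff_vec_prod_zero_field[OF X] inj by blast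
  from det_non_zero_imp_unit[OF X this, of "()"]
  obtain X' where X': "X' \<in> carrier_mat n n" "X' * X = 1\<^sub>m n" "X * X' = 1\<^sub>m n"
    by (auto simp: Units_def ring_mat_simps)
  have "(X' * N * X) $$ (i - 1, j - 1) = 0" if i: "i \<in> {1..n}" and j: "j \<in> {1..n}" and ij: "h j < i" for i j
  proof -
    have hj: "h j \<in> {1..n}" using h j unfolding hessenberg_function_def by blast
    obtain c where c: "c \<in> carrier_vec n" "\<forall>t<n. h j \<le> t \<longrightarrow> c $ t = 0" "N *\<^sub>v col X (j - 1) = X *\<^sub>v c"
      using flag j unfolding mem_flag_of[OF X hj, symmetric] using mem_flag_of[OF X hj] by blast
    have "col (X' * N * X) (j - 1) = (X' * N) *\<^sub>v col X (j - 1)"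
      by (rule col_mult2) (use X X'(1) N j in auto)
    also have "\<dots> = X' *\<^sub>v (N *\<^sub>v col X (j - 1))"
      using X X'(1) N by (intro assoc_mult_mat_vec) auto
    also have "\<dots> = (X' * X) *\<^sub>v c"
      unfolding c(3) using X X'(1) c(1) by simp
    also have "\<dots> = c" using c(1) by (simp add: X'(2))
    finally have "col (X' * N * X) (j - 1) $ (i - 1) = 0" using c(2) i ij by auto
    then show ?thesis using X X'(1) i j by auto
  qed
  then have "X' * N * X \<in> hessenberg_space n h"
    using X X'(1) N by (simp add: hessenberg_space_def)
  moreover have "inverts_mat X X'" "inverts_mat X' X"
    using X X' by (simp_all add: inverts_mat_def)
  ultimately show "flag_of n X \<in> hess n N h"
    using X X'(1) by (auto simp: hess_def)
qed

section \<open>The Hessenberg chart and its strata\<close>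

text \<open>
  For a chart matrix \<open>x\<close> with columns \<open>X\<^sub>1, \<dots>, X\<^sub>n\<close>, reading \<open>N X\<^sub>j = \<Sum>\<^sub>t c\<^sub>t X\<^sub>t\<close> from the bottom row
  upwards forces \<open>c\<^sub>t = 0\<close> for \<open>t \<le> j\<close> and determines the remaining \<open>c\<^sub>t\<close> one after the other, because
  \<open>X\<^sub>t\<close> has its lowest non-zero entry, a \<open>1\<close>, in row \<open>n + 1 - t\<close>.
\<close>

fun chart_coeff :: "nat \<Rightarrow> (nat \<Rightarrow> nat \<Rightarrow> complex) \<Rightarrow> nat \<Rightarrow> nat \<Rightarrow> complex" where
  "chart_coeff n x j t =
     x (n + 2 - t) j - (\<Sum>s\<in>{j<..<t}. chart_coeff n x j s * x (n + 1 - t) s)"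

declare chart_coeff.simps [simp del]

text \<open>Row \<open>n + 1 - t\<close> is the row in which column \<open>t\<close> has its 1 and
  all later columns vanish.\<close>

lemma antitriangular_row_sum:
  fixes x :: "nat \<Rightarrow> nat \<Rightarrow> complex"
  assumes one: "\<And>i. 1 \<le> i \<Longrightarrow> i \<le> n \<Longrightarrow> x i (n + 1 - i) = 1"
    and zero: "\<And>i j. n + 1 < i + j \<Longrightarrow> x i j = 0"
    and t: "1 \<le> t" "t \<le> m" "m \<le> n"
  shows "(\<Sum>s=1..m. c s * x (n + 1 - t) s) = c t + (\<Sum>s=1..<t. c s * x (n + 1 - t) s)"
proof -
  have "(\<Sum>s=1..m. c s * x (n + 1 - t) s) = (\<Sum>s\<in>insert t {1..<t}. c s * x (n + 1 - t) s)"
    by (rule sum.mono_neutral_right) (use t in \<open>auto simp: zero\<close>)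
  also have "\<dots> = c t * x (n + 1 - t) t + (\<Sum>s=1..<t. c s * x (n + 1 - t) s)"
    by (rule sum.insert) auto
  finally show ?thesis using one[of "n + 1 - t"] t by simp
qed

text \<open>The \<open>m\<close> bottom rows \<open>n + 1 - t\<close>, for
  \<open>t = 1, ..., m\<close>, determine the coefficients one by one and impose nothing else. The
  rows \<open>1, ..., n - m\<close> are the actual conditions.\<close>

lemma shifted_column_in_span_iff:
  fixes x :: "nat \<Rightarrow> nat \<Rightarrow> complex"
  assumes one: "\<And>i. 1 \<le> i \<Longrightarrow> i \<le> n \<Longrightarrow> x i (n + 1 - i) = 1"
    and zero: "\<And>i j. n + 1 < i + j \<Longrightarrow> x i j = 0"
    and m: "j \<le> m" "m \<le> n"
  shows "(\<exists>c. \<forall>i\<in>{1..n}. x (i + 1) j = (\<Sum>t=1..m. c t * x i t)) \<longleftrightarrow>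
    (\<forall>i\<in>{1..n - m}. x (i + 1) j = (\<Sum>t\<in>{j<..m}. chart_coeff n x j t * x i t))"
proof
  note row = antitriangular_row_sum[of n x, OF one zero]
  assume "\<exists>c. \<forall>i\<in>{1..n}. x (i + 1) j = (\<Sum>t=1..m. c t * x i t)"
  then obtain c where c: "\<And>i. i \<in> {1..n} \<Longrightarrow> x (i + 1) j = (\<Sum>t=1..m. c t * x i t)" by blast
  have ct: "c t = (if j < t then chart_coeff n x j t else 0)" if "1 \<le> t" "t \<le> m" for t
    using that
  proof (induction t rule: less_induct)
    case (less t)
    have "x (n + 2 - t) j = c t + (\<Sum>s=1..<t. c s * x (n + 1 - t) s)"
      using c[of "n + 1 - t"] row[of t m c] less.prems m by (simp add: Suc_diff_le)
    also have "(\<Sum>s=1..<t. c s * x (n + 1 - t) s) =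
        (\<Sum>s=1..<t. if j < s then chart_coeff n x j s * x (n + 1 - t) s else 0)"
      by (rule sum.cong) (use less in auto)
    also have "\<dots> = (\<Sum>s\<in>{j<..<t}. chart_coeff n x j s * x (n + 1 - t) s)"
      by (rule sum.mono_neutral_cong_right) auto
    \<comment> \<open>For \<open>t \<le> j\<close> the sum is empty and row \<open>n + 2 - t\<close>
      of column \<open>j\<close> lies beyond the antidiagonal, so the coefficient is zero.\<close>
    finally show ?case
      using zero[of "n + 2 - t" j] less.prems m
      by (cases "j < t") (simp_all add: chart_coeff.simps[of n x j t])
  qed
  show "\<forall>i\<in>{1..n - m}. x (i + 1) j = (\<Sum>t\<in>{j<..m}. chart_coeff n x j t * x i t)"
  proof
    fix i assume "i \<in> {1..n - m}"
    then have "i \<in> {1..n}" by auto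
    then have "x (i + 1) j = (\<Sum>t=1..m. c t * x i t)" by (rule c)
    also have "\<dots> = (\<Sum>t\<in>{j<..m}. chart_coeff n x j t * x i t)"
      by (rule sum.mono_neutral_cong_right) (auto simp: ct)
    finally show "x (i + 1) j = (\<Sum>t\<in>{j<..m}. chart_coeff n x j t * x i t)" .
  qed
next
  note row = antitriangular_row_sum[of n x, OF one zero]
  assume eq: "\<forall>i\<in>{1..n - m}. x (i + 1) j = (\<Sum>t\<in>{j<..m}. chart_coeff n x j t * x i t)"
  define c where "c t = (if j < t then chart_coeff n x j t else 0)" for t
  have "x (i + 1) j = (\<Sum>t=1..m. c t * x i t)" if i: "i \<in> {1..n}" for i
  proof (cases "i \<le> n - m")
    case True
    then have "x (i + 1) j = (\<Sum>t\<in>{j<..m}. chart_coeff n x j t * x i t)" using eq i by simp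
    also have "\<dots> = (\<Sum>t=1..m. c t * x i t)"
      by (rule sum.mono_neutral_cong_left) (auto simp: c_def)
    finally show ?thesis .
  next
    case False
    define t where "t = n + 1 - i"
    have t: "1 \<le> t" "t \<le> m" "n + 1 - t = i" "n + 2 - t = i + 1" using False i m by (auto simp: t_def)
    have "(\<Sum>s=1..<t. c s * x i s) = (\<Sum>s\<in>{j<..<t}. chart_coeff n x j s * x i s)"
      by (rule sum.mono_neutral_cong_right) (auto simp: c_def)
    then have "(\<Sum>s=1..m. c s * x i s) = c t + (\<Sum>s\<in>{j<..<t}. chart_coeff n x j s * x i s)"
      using row[of t m c] t m by simp
    also have "\<dots> = x (i + 1) j"
    proof (cases "j < t")
      case True
      then show ?thesis using chart_coeff.simps[of n x j t] t by (simp add: c_def)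
    next
      case False
      then show ?thesis using zero[of "i + 1" j] t i by (simp add: c_def t_def)
    qed
    finally show ?thesis by simp
  qed
  then show "\<exists>c. \<forall>i\<in>{1..n}. x (i + 1) j = (\<Sum>t=1..m. c t * x i t)" by blast
qed

lemma chart_coeff_cong:
  assumes col: "\<And>i s. j < s \<Longrightarrow> x i s = y i s"
    and low: "\<And>t. j < t \<Longrightarrow> t \<le> m \<Longrightarrow> x (n + 2 - t) j = y (n + 2 - t) j"
    and t: "j < t" "t \<le> m"
  shows "chart_coeff n x j t = chart_coeff n y j t"
  using t
proof (induction t rule: less_induct)
  case (less t)
  have "(\<Sum>s\<in>{j<..<t}. chart_coeff n x j s * x (n + 1 - t) s) =
      (\<Sum>s\<in>{j<..<t}. chart_coeff n y j s * y (n + 1 - t) s)"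
    by (rule sum.cong) (use less col in auto)
  then show ?case
    using low[OF less.prems] by (simp add: chart_coeff.simps[of n x j t] chart_coeff.simps[of n y j t])
qed

lemma chart_coeff_poly:
  assumes "\<And>i s. (\<lambda>v. x v i s) \<in> poly_funs m"
  shows "(\<lambda>v. chart_coeff n (x v) j t) \<in> poly_funs m"
proof (induction t rule: less_induct)
  case (less t)
  then show ?case
    unfolding chart_coeff.simps[of n _ j t]
    by (intro poly_funs_diff poly_funs_sum poly_funs.mult assms) auto
qed

section \<open>Coordinates on the chart and the resulting equations\<close>

definition position_index :: "nat \<Rightarrow> nat \<times> nat \<Rightarrow> nat" where
  "position_index n = the_inv_into {..<num_coords n} (\<lambda>k. positions n ! k)"

lemma inj_on_positions: "inj_on (\<lambda>k. positions n ! k) {..<num_coords n}"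
  using distinct_positions[of n] by (auto simp: inj_on_def nth_eq_iff_index_eq length_positions)

lemma position_index_nth: "k < num_coords n \<Longrightarrow> position_index n (positions n ! k) = k"
  unfolding position_index_def by (simp add: the_inv_into_f_f[OF inj_on_positions])

lemma nth_position_index:
  assumes "p \<in> set (positions n)"
  shows "position_index n p < num_coords n" "positions n ! position_index n p = p"
proof -
  obtain k where "k < num_coords n" "p = positions n ! k"
    using assms by (auto simp: in_set_conv_nth length_positions)
  then show "position_index n p < num_coords n" "positions n ! position_index n p = p"
    by (simp_all add: position_index_nth)
qed

text \<open>Indices start at 1 and are unbounded above: beyond the antidiagonal the value is zero,
  in particular in row \<open>n + 1\<close>, which occurs when a column is shifted up by one
  row.\<close>

definition chart_entry :: "nat \<Rightarrow> complex vec \<Rightarrow> nat \<Rightarrow> nat \<Rightarrow> complex" where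
  "chart_entry n v i j =
     (if (i, j) \<in> set (positions n) then v $ position_index n (i, j) else if i + j = n + 1 then 1 else 0)"

lemma chart_entry_one: "1 \<le> i \<Longrightarrow> i \<le> n \<Longrightarrow> chart_entry n v i (n + 1 - i) = 1"
  by (simp add: chart_entry_def set_positions)

lemma chart_entry_zero: "n + 1 < i + j \<Longrightarrow> chart_entry n v i j = 0"
  by (simp add: chart_entry_def set_positions)

lemma chart_entry_nth: "k < num_coords n \<Longrightarrow> positions n ! k = (i, j) \<Longrightarrow> chart_entry n v i j = v $ k"
  using position_index_nth[of k n] nth_mem[of k "positions n"] by (simp add: chart_entry_def length_positions)

lemma chart_entry_poly: "(\<lambda>v. chart_entry n v i j) \<in> poly_funs (num_coords n)"
proof (cases "(i, j) \<in> set (positions n)")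
  case True
  then show ?thesis using nth_position_index(1) by (simp add: chart_entry_def poly_funs.coord)
qed (simp add: chart_entry_def poly_funs.const)

definition chart_mat :: "nat \<Rightarrow> complex vec \<Rightarrow> complex mat" where
  "chart_mat n v = mat n n (\<lambda>(i, j). chart_entry n v (i + 1) (j + 1))"

lemma entry_chart_mat:
  "i \<in> {1..n} \<Longrightarrow> j \<in> {1..n} \<Longrightarrow> entry (chart_mat n v) i j = chart_entry n v i j"
  by (auto simp: chart_mat_def)

lemma chart_mat_in_chart: "chart_mat n v \<in> chart_matrices n"
  unfolding chart_matrices_def
proof (intro CollectI conjI ballI impI)
  show "chart_mat n v \<in> carrier_mat n n" by (simp add: chart_mat_def)
  show "entry (chart_mat n v) i (n + 1 - i) = 1" if "i \<in> {1..n}" for i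
    using that chart_entry_one[of i n v] by (subst entry_chart_mat) auto
  show "entry (chart_mat n v) i j = 0" if "i \<in> {1..n}" "j \<in> {1..n}" "n + 1 < i + j" for i j
    using that chart_entry_zero[of n i j v] by (subst entry_chart_mat) auto
qed

lemma coordinates_carrier: "coordinates n X \<in> carrier_vec (num_coords n)"
  by (simp add: coordinates_def)

lemma coordinates_chart_mat:
  assumes "v \<in> carrier_vec (num_coords n)"
  shows "coordinates n (chart_mat n v) = v"
proof
  fix k assume "k < dim_vec v"
  then have k: "k < num_coords n" using assms by simp
  obtain i j where ij: "positions n ! k = (i, j)" by fastforce
  then have "(i, j) \<in> set (positions n)" using k by (metis length_positions nth_mem)
  then have "i \<in> {1..n}" "j \<in> {1..n}" by (auto simp: set_positions)
  then show "coordinates n (chart_mat n v) $ k = v $ k"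
    using k ij chart_entry_nth[OF k ij, of v] entry_chart_mat[of i n j v] by (simp add: coordinates_def)
qed (use assms in \<open>simp add: coordinates_def\<close>)

lemma chart_mat_coordinates:
  assumes X: "X \<in> chart_matrices n"
  shows "chart_mat n (coordinates n X) = X"
proof
  note XC = chart_matricesD(1)[OF X]
  fix i j assume "i < dim_row X" "j < dim_col X"
  then have i: "i < n" and j: "j < n" using XC by auto
  have "chart_entry n (coordinates n X) (i + 1) (j + 1) = X $$ (i, j)"
  proof -
    consider "i + j + 2 \<le> n" | "i + j + 2 = n + 1" | "n + 1 < i + j + 2" by linarith
    then show ?thesis
    proof cases
      case 1
      then have "(i + 1, j + 1) \<in> set (positions n)" by (auto simp: set_positions)
      then show ?thesis
        using nth_position_index[of "(i + 1, j + 1)" n] by (simp add: chart_entry_def coordinates_def)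
    next
      case 2
      then have j': "j = n - 1 - i" "j + 1 = n + 1 - (i + 1)" by simp_all
      have "chart_entry n (coordinates n X) (i + 1) (j + 1) = 1"
        unfolding j'(2) by (rule chart_entry_one) (use i in auto)
      then show ?thesis using chart_matricesD(2)[OF X i] j'(1) by simp
    next
      case 3
      then have "n - 1 < i + j" using i by linarith
      then show ?thesis using chart_matricesD(3)[OF X i j] chart_entry_zero[of n "i + 1" "j + 1"] 3 by simp
    qed
  qed
  then show "chart_mat n (coordinates n X) $$ (i, j) = X $$ (i, j)" using i j by (simp add: chart_mat_def)
qed (use chart_matricesD(1)[OF X] in \<open>auto simp: chart_mat_def\<close>)

lemma in_coords_eq: "in_coords n Z = {v \<in> carrier_vec (num_coords n). flag_of n (chart_mat n v) \<in> Z}"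
proof (intro equalityI subsetI)
  fix v assume "v \<in> in_coords n Z"
  then obtain X where X: "X \<in> chart_matrices n" "flag_of n X \<in> Z" "v = coordinates n X"
    by (auto simp: in_coords_def)
  then show "v \<in> {v \<in> carrier_vec (num_coords n). flag_of n (chart_mat n v) \<in> Z}"
    using chart_mat_coordinates[OF X(1)] coordinates_carrier by simp
next
  fix v assume v: "v \<in> {v \<in> carrier_vec (num_coords n). flag_of n (chart_mat n v) \<in> Z}"
  then have "v = coordinates n (chart_mat n v)" using coordinates_chart_mat[of v n] by simp
  then show "v \<in> in_coords n Z"
    unfolding in_coords_def using v chart_mat_in_chart[of n v] by (intro image_eqI[of v]) auto
qed

lemma chart_eq: "chart n = (\<lambda>v. flag_of n (chart_mat n v)) ` carrier_vec (num_coords n)"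
proof (intro equalityI subsetI)
  fix V assume "V \<in> chart n"
  then obtain X where X: "X \<in> chart_matrices n" "V = flag_of n X" by (auto simp: chart_def)
  then have "V = flag_of n (chart_mat n (coordinates n X))" by (simp add: chart_mat_coordinates)
  then show "V \<in> (\<lambda>v. flag_of n (chart_mat n v)) ` carrier_vec (num_coords n)"
    using coordinates_carrier by blast
next
  fix V assume "V \<in> (\<lambda>v. flag_of n (chart_mat n v)) ` carrier_vec (num_coords n)"
  then show "V \<in> chart n" using chart_mat_in_chart by (auto simp: chart_def)
qed

lemma chart_mat_in_dual_schubert:
  assumes "1 \<le> n" "l \<le> num_coords n"
  shows "flag_of n (chart_mat n v) \<in> dual_schubert n (u_perm n l) \<longleftrightarrow> (\<forall>k<l. v $ k = 0)"
proof -
  obtain k a where ka: "1 \<le> k" "k \<le> n" "a \<le> n - k" "u_perm n l = u_explicit n k a"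
    "set (take l (positions n)) = lead n k a"
    using first_positions[OF assms] by blast
  have l: "l \<le> length (positions n)" using assms(2) by (simp add: length_positions)
  have "flag_of n (chart_mat n v) \<in> dual_schubert n (u_perm n l) \<longleftrightarrow>
      (\<forall>(i, j)\<in>lead n k a. entry (chart_mat n v) i j = 0)"
    unfolding ka(4) by (rule dual_schubert_flag_of[OF ka(1-3) chart_mat_in_chart])
  also have "\<dots> \<longleftrightarrow> (\<forall>(i, j)\<in>lead n k a. chart_entry n v i j = 0)"
    by (intro ball_cong refl) (auto simp: lead_def entry_chart_mat[simplified])
  also have "\<dots> \<longleftrightarrow> (\<forall>(i, j)\<in>set (take l (positions n)). chart_entry n v i j = 0)"
    by (simp only: ka(5))
  also have "\<dots> \<longleftrightarrow> (\<forall>k<l. case positions n ! k of (i, j) \<Rightarrow> chart_entry n v i j = 0)"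
    unfolding all_set_conv_all_nth using l by simp
  also have "\<dots> \<longleftrightarrow> (\<forall>k<l. v $ k = 0)"
  proof -
    have "(case positions n ! k of (i, j) \<Rightarrow> chart_entry n v i j = 0) \<longleftrightarrow> v $ k = 0" if "k < l" for k
      using chart_entry_nth[of k n] that assms(2) by (cases "positions n ! k") auto
    then show ?thesis by (intro arg_cong[where f = All] ext imp_cong refl)
  qed
  finally show ?thesis .
qed

text \<open>The nilpotent matrix shifts each column up by one row, so its action on column
  \<open>j\<close> is the situation of \<open>shifted_column_in_span_iff\<close> with
  \<open>m = h j\<close>.\<close>

lemma chart_mat_in_hess:
  assumes h: "hessenberg_function n h"
  shows "flag_of n (chart_mat n v) \<in> hess n (jordan_block n 0) h \<longleftrightarrow>
    (\<forall>j\<in>{1..n}. \<forall>i\<in>{1..n - h j}. chart_entry n v (i + 1) j =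
       (\<Sum>t\<in>{j<..h j}. chart_coeff n (chart_entry n v) j t * chart_entry n v i t))"
proof -
  let ?X = "chart_mat n v" and ?N = "jordan_block n 0 :: complex mat" and ?x = "chart_entry n v"
  have X: "?X \<in> carrier_mat n n" by (simp add: chart_mat_def)
  have N: "?N \<in> carrier_mat n n" by (simp add: jordan_block_def)
  have col: "?N *\<^sub>v col ?X (j - 1) \<in> flag_of n ?X (h j) \<longleftrightarrow>
      (\<forall>i\<in>{1..n - h j}. ?x (i + 1) j = (\<Sum>t\<in>{j<..h j}. chart_coeff n ?x j t * ?x i t))"
    if j: "j \<in> {1..n}" for j
  proof -
    have hj: "h j \<in> {1..n}" "j \<le> h j" using h j unfolding hessenberg_function_def by blast+
    \<comment> \<open>Here \<open>i\<close> counts from 0. In the bottom row the superdiagonal has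
      no 1, and \<open>?x (n + 1) j\<close> is zero because it lies beyond the antidiagonal.\<close>
    have Nx: "(?N *\<^sub>v col ?X (j - 1)) $ i = ?x (i + 2) j" if i: "i < n" for i
    proof -
      have "(?N *\<^sub>v col ?X (j - 1)) $ i = (\<Sum>k<n. (if Suc i = k then 1 else 0) * ?x (k + 1) j)"
        using i j by (auto simp: scalar_prod_def chart_mat_def atLeast0LessThan intro!: sum.cong)
      also have "\<dots> = (\<Sum>k<n. if k = Suc i then ?x (k + 1) j else 0)"
        by (rule sum.cong) auto
      also have "\<dots> = (if Suc i < n then ?x (i + 2) j else 0)"
        by (simp add: sum.delta)
      also have "\<dots> = ?x (i + 2) j"
        using chart_entry_zero[of n "i + 2" j v] i j by auto
      finally show ?thesis .
    qed
    have Xc: "(?X *\<^sub>v c) $ i = (\<Sum>t=1..h j. c $ (t - 1) * ?x (i + 1) t)"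
      if c: "c \<in> carrier_vec n" "\<forall>t<n. h j \<le> t \<longrightarrow> c $ t = 0" and i: "i < n" for c i
    proof -
      have "(?X *\<^sub>v c) $ i = (\<Sum>t<n. ?x (i + 1) (t + 1) * c $ t)"
        using i c(1) by (auto simp: scalar_prod_def chart_mat_def atLeast0LessThan intro!: sum.cong)
      also have "\<dots> = (\<Sum>t<h j. ?x (i + 1) (t + 1) * c $ t)"
        by (rule sum.mono_neutral_right) (use c(2) hj in auto)
      also have "\<dots> = (\<Sum>t=1..h j. c $ (t - 1) * ?x (i + 1) t)"
        by (rule sum.reindex_bij_witness[of _ "\<lambda>t. t - 1" Suc]) auto
      finally show ?thesis .
    qed
    have "?N *\<^sub>v col ?X (j - 1) \<in> flag_of n ?X (h j) \<longleftrightarrow>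
        (\<exists>c\<in>carrier_vec n. (\<forall>t<n. h j \<le> t \<longrightarrow> c $ t = 0) \<and> ?N *\<^sub>v col ?X (j - 1) = ?X *\<^sub>v c)"
      by (rule mem_flag_of[OF X hj(1)])
    also have "\<dots> \<longleftrightarrow> (\<exists>c. \<forall>i\<in>{1..n}. ?x (i + 1) j = (\<Sum>t=1..h j. c t * ?x i t))"
    proof
      assume "\<exists>c\<in>carrier_vec n. (\<forall>t<n. h j \<le> t \<longrightarrow> c $ t = 0) \<and> ?N *\<^sub>v col ?X (j - 1) = ?X *\<^sub>v c"
      then obtain c where c: "c \<in> carrier_vec n" "\<forall>t<n. h j \<le> t \<longrightarrow> c $ t = 0"
        "?N *\<^sub>v col ?X (j - 1) = ?X *\<^sub>v c" by blast
      have "?x (i + 1) j = (\<Sum>t=1..h j. c $ (t - 1) * ?x i t)" if "i \<in> {1..n}" for i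
        using Nx[of "i - 1"] Xc[OF c(1,2), of "i - 1"] that unfolding c(3) by auto
      then show "\<exists>c. \<forall>i\<in>{1..n}. ?x (i + 1) j = (\<Sum>t=1..h j. c t * ?x i t)"
        by (intro exI[of _ "\<lambda>t. c $ (t - 1)"]) blast
    next
      assume "\<exists>c. \<forall>i\<in>{1..n}. ?x (i + 1) j = (\<Sum>t=1..h j. c t * ?x i t)"
      then obtain c where c: "\<And>i. i \<in> {1..n} \<Longrightarrow> ?x (i + 1) j = (\<Sum>t=1..h j. c t * ?x i t)" by blast
      let ?c = "vec n (\<lambda>t. if t < h j then c (t + 1) else 0)"
      have sup: "\<forall>t<n. h j \<le> t \<longrightarrow> ?c $ t = 0" by simp
      have "?N *\<^sub>v col ?X (j - 1) = ?X *\<^sub>v ?c"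
      proof (rule eq_vecI)
        fix i assume "i < dim_vec (?X *\<^sub>v ?c)"
        then have i: "i < n" using X by simp
        have "(?X *\<^sub>v ?c) $ i = (\<Sum>t=1..h j. ?c $ (t - 1) * ?x (i + 1) t)"
          by (rule Xc[OF _ sup i]) simp
        also have "\<dots> = (\<Sum>t=1..h j. c t * ?x (i + 1) t)"
        proof (rule sum.cong[OF refl])
          fix t assume "t \<in> {1..h j}"
          then have "t - 1 < n" "t - 1 < h j" "t - 1 + 1 = t" using hj by auto
          then show "?c $ (t - 1) * ?x (i + 1) t = c t * ?x (i + 1) t" by simp
        qed
        also have "\<dots> = ?x (i + 2) j" using c[of "i + 1"] i by simp
        finally show "(?N *\<^sub>v col ?X (j - 1)) $ i = (?X *\<^sub>v ?c) $ i" using Nx[OF i] by simp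
      qed (use X N in simp)
      then show "\<exists>c\<in>carrier_vec n. (\<forall>t<n. h j \<le> t \<longrightarrow> c $ t = 0) \<and> ?N *\<^sub>v col ?X (j - 1) = ?X *\<^sub>v c"
        using sup by (intro bexI[of _ ?c]) auto
    qed
    also have "\<dots> \<longleftrightarrow> (\<forall>i\<in>{1..n - h j}. ?x (i + 1) j = (\<Sum>t\<in>{j<..h j}. chart_coeff n ?x j t * ?x i t))"
      by (rule shifted_column_in_span_iff) (use hj in \<open>auto intro: chart_entry_one[simplified] chart_entry_zero\<close>)
    finally show ?thesis .
  qed
  have "flag_of n ?X \<in> hess n ?N h \<longleftrightarrow> (\<forall>j\<in>{1..n}. ?N *\<^sub>v col ?X (j - 1) \<in> flag_of n ?X (h j))"
    by (rule flag_of_in_hess[OF h N X chart_matrix_inj[OF chart_mat_in_chart]])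
  then show ?thesis using col by blast
qed

text \<open>The equation in row \<open>i - 1\<close> of the Hessenberg condition has the entry in
  row \<open>i\<close> on its left-hand side; hence the index \<open>i - 1\<close> on the
  right.\<close>

definition nonfree_value :: "nat \<Rightarrow> (nat \<Rightarrow> nat) \<Rightarrow> nat \<Rightarrow> complex vec \<Rightarrow> complex" where
  "nonfree_value n h k v = (case positions n ! k of (i, j) \<Rightarrow>
     \<Sum>t\<in>{j<..h j}. chart_coeff n (chart_entry n v) j t * chart_entry n v (i - 1) t)"

lemma nonfree_value_poly: "nonfree_value n h k \<in> poly_funs (num_coords n)"
proof (cases "positions n ! k")
  case (Pair i j)
  have "(\<lambda>v. \<Sum>t\<in>{j<..h j}. chart_coeff n (chart_entry n v) j t * chart_entry n v (i - 1) t)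
      \<in> poly_funs (num_coords n)"
    by (intro poly_funs_sum poly_funs.mult chart_coeff_poly chart_entry_poly) auto
  then show ?thesis by (simp add: nonfree_value_def[abs_def] Pair)
qed

section \<open>Strata for a fixed indecomposable Hessenberg function\<close>

locale indecomposable_hessenberg =
  fixes n :: nat and h :: "nat \<Rightarrow> nat"
  assumes n: "1 \<le> n" and h: "hessenberg_function n h" and indec: "indecomposable n h"
begin

abbreviation "free k \<equiv> positions n ! k \<in> free_positions n h"

lemma h_last: "h n = n"
  using h n unfolding hessenberg_function_def by (metis atLeastAtMost_iff image_subset_iff le_antisym order_refl)

lemma h_le: "j \<in> {1..n} \<Longrightarrow> h j \<le> n"
  using h unfolding hessenberg_function_def by (meson atLeastAtMost_iff image_subset_iff)

lemma h_greater: "j \<in> {1..n - 1} \<Longrightarrow> j + 1 \<le> h j"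
  using indec unfolding indecomposable_def by blast

lemma not_free_iff:
  assumes "k < num_coords n" "positions n ! k = (i, j)"
  shows "\<not> free k \<longleftrightarrow> 2 \<le> i \<and> i \<le> n + 1 - h j"
proof -
  have "(i, j) \<in> set (positions n)" using assms by (metis length_positions nth_mem)
  then have "1 \<le> i" "1 \<le> j" "i + j \<le> n" by (auto simp: set_positions)
  then show ?thesis unfolding assms(2) by (auto simp: free_positions_def nonfree_positions_def)
qed

lemma position_bounds:
  assumes "k < num_coords n" "positions n ! k = (i, j)"
  shows "1 \<le> i" "1 \<le> j" "i + j \<le> n"
proof -
  have "(i, j) \<in> set (positions n)" using assms by (metis length_positions nth_mem)
  then show "1 \<le> i" "1 \<le> j" "i + j \<le> n" by (auto simp: set_positions)
qed

text \<open>The equation of row \<open>i\<close> and column \<open>j\<close> is the one of the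
  non-free position \<open>(i + 1, j)\<close>. Column \<open>n\<close> contributes none since
  \<open>h n = n\<close>, and for \<open>j < n\<close> indecomposability gives
  \<open>(i + 1) + j \<le> n\<close>, so the position does occur in the list.\<close>

lemma hess_equations_iff:
  "(\<forall>j\<in>{1..n}. \<forall>i\<in>{1..n - h j}. chart_entry n v (i + 1) j =
      (\<Sum>t\<in>{j<..h j}. chart_coeff n (chart_entry n v) j t * chart_entry n v i t)) \<longleftrightarrow>
   (\<forall>k<num_coords n. \<not> free k \<longrightarrow> v $ k = nonfree_value n h k v)" (is "?L \<longleftrightarrow> ?R")
proof
  assume L: ?L
  show ?R
  proof (intro allI impI)
    fix k assume k: "k < num_coords n" "\<not> free k"
    obtain i j where ij: "positions n ! k = (i, j)" by fastforce
    note b = position_bounds[OF k(1) ij]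
    have i: "2 \<le> i" "i \<le> n + 1 - h j" using not_free_iff[OF k(1) ij] k(2) by auto
    have "j \<in> {1..n}" "i - 1 \<in> {1..n - h j}" using b i by auto
    from L[rule_format, OF this] have "chart_entry n v i j = nonfree_value n h k v"
      using i by (simp add: nonfree_value_def ij)
    then show "v $ k = nonfree_value n h k v" using chart_entry_nth[OF k(1) ij] by simp
  qed
next
  assume R: ?R
  show ?L
  proof (intro ballI)
    fix j i assume j: "j \<in> {1..n}" and i: "i \<in> {1..n - h j}"
    have "j \<noteq> n" using h_last i by auto
    then have "j \<in> {1..n - 1}" using j by auto
    then have "j + 1 \<le> h j" by (rule h_greater)
    then have "(i + 1, j) \<in> set (positions n)" using i j by (auto simp: set_positions)
    from nth_position_index[OF this] obtain k where k: "k < num_coords n" "positions n ! k = (i + 1, j)" by blast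
    have "\<not> free k" using not_free_iff[OF k] i by auto
    then have "v $ k = nonfree_value n h k v" using R k(1) by blast
    then show "chart_entry n v (i + 1) j =
        (\<Sum>t\<in>{j<..h j}. chart_coeff n (chart_entry n v) j t * chart_entry n v i t)"
      using chart_entry_nth[OF k, of v] k(2) by (simp add: nonfree_value_def)
  qed
qed

lemma stratum_iff:
  assumes "l \<le> num_coords n" "v \<in> carrier_vec (num_coords n)"
  shows "flag_of n (chart_mat n v) \<in> stratum n h l \<longleftrightarrow>
    (\<forall>k<l. v $ k = 0) \<and> (\<forall>k<num_coords n. \<not> free k \<longrightarrow> v $ k = nonfree_value n h k v)"
proof -
  have "flag_of n (chart_mat n v) \<in> chart n" using assms(2) unfolding chart_eq by blast
  then show ?thesis
    unfolding stratum_def hess_chart_def Int_iff chart_mat_in_dual_schubert[OF n assms(1)]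
      chart_mat_in_hess[OF h] hess_equations_iff by blast
qed

lemma stratum_cases:
  assumes "V \<in> stratum n h l"
  obtains v where "v \<in> carrier_vec (num_coords n)" "V = flag_of n (chart_mat n v)"
  using assms unfolding stratum_def hess_chart_def chart_eq by blast

lemma nonfree_value_zero:
  assumes k: "k < num_coords n" "\<not> free k" and z: "\<And>k'. k' < k \<Longrightarrow> v $ k' = 0"
  shows "nonfree_value n h k v = 0"
proof -
  obtain i j where ij: "positions n ! k = (i, j)" by fastforce
  note b = position_bounds[OF k(1) ij]
  have i: "2 \<le> i" "i \<le> n + 1 - h j" using not_free_iff[OF k(1) ij] k(2) by auto
  have "chart_entry n v (i - 1) t = 0" if t: "t \<in> {j<..h j}" for t
  proof -
    \<comment> \<open>\<open>i - 1 \<le> n - h j\<close> and \<open>t \<le> h j\<close> add up to at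
      most \<open>n\<close>.\<close>
    have p: "(i - 1, t) \<in> set (positions n)" using i t b h_le[of j] by (auto simp: set_positions)
    note q = nth_position_index[OF p]
    have "position_index n (i - 1, t) < k"
    proof (rule ccontr)
      assume "\<not> ?thesis"
      then have "k = position_index n (i - 1, t) \<or> k < position_index n (i - 1, t)" by auto
      then have "(i, j) = (i - 1, t) \<or> lex_less (i, j) (i - 1, t)"
        using sorted_wrt_nth_less[OF sorted_positions, of k "position_index n (i - 1, t)" n] q ij
        by (auto simp: length_positions)
      then show False using i by (auto simp: lex_less_def)
    qed
    then show ?thesis using z p by (simp add: chart_entry_def)
  qed
  then show ?thesis by (simp add: nonfree_value_def ij)
qed

text \<open>Columns are eliminated from right to left, within a column the non-free entries come last.\<close>

definition elimination_rank :: "nat \<Rightarrow> nat" where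
  "elimination_rank k = (case positions n ! k of (i, j) \<Rightarrow> 2 * (n - j) + (if free k then 0 else 1))"

text \<open>The factor 2 in the rank lets every entry of a column further right, free or not,
  precede column \<open>j\<close>, while within a column the summand 1 puts the non-free entries
  after the free ones.\<close>

lemma nonfree_value_cong:
  assumes k: "k < num_coords n" "\<not> free k"
    and eq: "\<And>k'. k' < num_coords n \<Longrightarrow> elimination_rank k' < elimination_rank k \<Longrightarrow> v $ k' = w $ k'"
  shows "nonfree_value n h k v = nonfree_value n h k w"
proof -
  obtain i j where ij: "positions n ! k = (i, j)" by fastforce
  note b = position_bounds[OF k(1) ij]
  have i: "2 \<le> i" "i \<le> n + 1 - h j" using not_free_iff[OF k(1) ij] k(2) by auto
  have rank: "elimination_rank k = 2 * (n - j) + 1" using k(2) ij by (simp add: elimination_rank_def)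
  have entry_eq: "chart_entry n v i' j' = chart_entry n w i' j'"
    if *: "\<And>k'. k' < num_coords n \<Longrightarrow> positions n ! k' = (i', j') \<Longrightarrow> elimination_rank k' < elimination_rank k"
    for i' j'
  proof (cases "(i', j') \<in> set (positions n)")
    case True
    note q = nth_position_index[OF True]
    show ?thesis using eq[OF q(1) *[OF q]] True by (simp add: chart_entry_def)
  qed (simp add: chart_entry_def)
  have right: "chart_entry n v i' j' = chart_entry n w i' j'" if "j < j'" for i' j'
  proof (rule entry_eq)
    fix k' assume k': "k' < num_coords n" "positions n ! k' = (i', j')"
    have "elimination_rank k' \<le> 2 * (n - j') + 1" using k'(2) by (simp add: elimination_rank_def)
    then show "elimination_rank k' < elimination_rank k"
      using rank that position_bounds[OF k'] by simp
  qed
  have low: "chart_entry n v (n + 2 - t) j = chart_entry n w (n + 2 - t) j" if "j < t" "t \<le> h j" for t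
  proof (rule entry_eq)
    fix k' assume k': "k' < num_coords n" "positions n ! k' = (n + 2 - t, j)"
    \<comment> \<open>Row \<open>n + 2 - t\<close> with \<open>t \<le> h j\<close> lies strictly
      below the last non-free row \<open>n + 1 - h j\<close> of this column.\<close>
    have "free k'" using not_free_iff[OF k'] that h_le[of j] b by auto
    then show "elimination_rank k' < elimination_rank k"
      using rank k'(2) by (simp add: elimination_rank_def)
  qed
  have "chart_coeff n (chart_entry n v) j t = chart_coeff n (chart_entry n w) j t" if "t \<in> {j<..h j}" for t
    by (rule chart_coeff_cong[where m = "h j"]) (use that right low in auto)
  then show ?thesis using right by (auto simp: nonfree_value_def ij intro!: sum.cong)
qed

definition free_from :: "nat \<Rightarrow> nat set" where
  "free_from l = {k. l \<le> k \<and> k < num_coords n \<and> free k}"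

text \<open>Only the free coordinates with index below \<open>l\<close> are set to zero explicitly.
  The non-free ones with index below \<open>l\<close> keep their own equation and vanish by
  induction, which puts the stratum into the form of a triangular system.\<close>

lemma in_coords_stratum:
  assumes l: "l \<le> num_coords n"
  shows "in_coords n (stratum n h l) = {v \<in> carrier_vec (num_coords n). \<forall>k<num_coords n. k \<notin> free_from l \<longrightarrow>
    v $ k = (if free k then (\<lambda>v. 0) else nonfree_value n h k) v}" (is "_ = ?S")
proof (intro equalityI subsetI)
  fix v assume "v \<in> in_coords n (stratum n h l)"
  then have v: "v \<in> carrier_vec (num_coords n)" "flag_of n (chart_mat n v) \<in> stratum n h l"
    by (simp_all add: in_coords_eq)
  then show "v \<in> ?S" using stratum_iff[OF l v(1)] by (simp add: free_from_def)
next
  fix v assume v: "v \<in> ?S"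
  have "v $ k = 0" if "k < l" for k :: nat
    using that
  proof (induction k rule: less_induct)
    case (less k)
    have k: "k < num_coords n" "k \<notin> free_from l" using less.prems l by (auto simp: free_from_def)
    then have "v $ k = (if free k then (\<lambda>v. 0) else nonfree_value n h k) v" using v by blast
    then show ?case using nonfree_value_zero[OF k(1), of v] less by (auto split: if_splits)
  qed
  moreover have "v $ k = nonfree_value n h k v" if "k < num_coords n" "\<not> free k" for k
    using v that by (auto simp: free_from_def)
  ultimately show "v \<in> in_coords n (stratum n h l)"
    using v stratum_iff[OF l, of v] by (auto simp: in_coords_eq)
qed

lemma stratum_graph:
  assumes l: "l \<le> num_coords n"
  shows "\<exists>b G. graph_variety (num_coords n) (card (free_from l)) b G (in_coords n (stratum n h l))"
  unfolding in_coords_stratum[OF l]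
proof (rule triangular_system_graph[where r = elimination_rank])
  show "free_from l \<subseteq> {..<num_coords n}" by (auto simp: free_from_def)
  show "(if free k then (\<lambda>v. 0) else nonfree_value n h k) \<in> poly_funs (num_coords n)" for k
    by (simp add: poly_funs.const nonfree_value_poly)
  show "(if free k then (\<lambda>v. 0) else nonfree_value n h k) x = (if free k then (\<lambda>v. 0) else nonfree_value n h k) y"
    if "k < num_coords n" "\<And>j. j < num_coords n \<Longrightarrow> elimination_rank j < elimination_rank k \<Longrightarrow> x $ j = y $ j"
    for k x y
    using nonfree_value_cong[OF that(1) _ that(2)] by simp
qed

lemma stratum_antimono:
  assumes "l \<le> l'" "l' \<le> num_coords n"
  shows "stratum n h l' \<subseteq> stratum n h l"
proof
  fix V assume V: "V \<in> stratum n h l'"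
  then obtain v where v: "v \<in> carrier_vec (num_coords n)" "V = flag_of n (chart_mat n v)"
    by (rule stratum_cases)
  show "V \<in> stratum n h l"
    using V assms unfolding v(2) stratum_iff[OF assms(2) v(1)] stratum_iff[OF order_trans[OF assms] v(1)]
    by auto
qed

lemma stratum_0: "stratum n h 0 = hess_chart n h"
proof
  show "hess_chart n h \<subseteq> stratum n h 0"
    using chart_mat_in_dual_schubert[OF n, of 0] by (auto simp: stratum_def hess_chart_def chart_eq)
qed (simp add: stratum_def)

lemma chart_mat_0: "chart_mat n (0\<^sub>v (num_coords n)) = perm_matrix n (longest n)"
proof (rule eq_matI)
  fix i j assume "i < dim_row (perm_matrix n (longest n))" "j < dim_col (perm_matrix n (longest n))"
  then have "i < n" "j < n" by (auto simp: perm_matrix_def)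
  then show "chart_mat n (0\<^sub>v (num_coords n)) $$ (i, j) = perm_matrix n (longest n) $$ (i, j)"
    using nth_position_index(1)[of "(i + 1, j + 1)" n]
    by (auto simp: chart_mat_def chart_entry_def perm_matrix_def longest_def set_positions)
qed (auto simp: chart_mat_def perm_matrix_def)

text \<open>All coordinates vanish on the last stratum, so it has at most one point; its
  non-emptiness comes from the parametrization.\<close>

lemma stratum_last: "stratum n h (num_coords n) = {flag_of n (perm_matrix n (longest n))}"
proof -
  have eq: "V = flag_of n (perm_matrix n (longest n))" if V: "V \<in> stratum n h (num_coords n)" for V
  proof -
    obtain v where v: "v \<in> carrier_vec (num_coords n)" "V = flag_of n (chart_mat n v)"
      using V by (rule stratum_cases)
    have "\<forall>k<num_coords n. v $ k = 0" using V stratum_iff[OF order_refl v(1)] unfolding v(2) by blast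
    then have "v = 0\<^sub>v (num_coords n)" using v(1) by auto
    then show ?thesis using v(2) chart_mat_0 by simp
  qed
  obtain b G where "graph_variety (num_coords n) (card (free_from (num_coords n))) b G
      (in_coords n (stratum n h (num_coords n)))"
    using stratum_graph[OF order_refl] by blast
  then have "in_coords n (stratum n h (num_coords n)) \<noteq> {}"
    using graph_variety.S zero_carrier_vec by fastforce
  then have "stratum n h (num_coords n) \<noteq> {}" by (auto simp: in_coords_eq)
  then show ?thesis using eq by blast
qed

lemma variety_dim_stratum:
  assumes "l \<le> num_coords n"
  shows "variety_dim (num_coords n) (in_coords n (stratum n h l)) = card (free_from l)"
  using stratum_graph[OF assms] graph_variety.variety_dim_S by blast

text \<open>The set of parameters loses exactly the index \<open>l - 1\<close>. Since the dimensions
  are finite, the drop by one already forces the two strata to differ.\<close>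

lemma stratum_free_step:
  assumes l: "l \<in> {1..num_coords n}" and free: "free (l - 1)"
  shows "stratum n h (l - 1) \<noteq> stratum n h l"
    and "variety_dim (num_coords n) (in_coords n (stratum n h l)) =
      variety_dim (num_coords n) (in_coords n (stratum n h (l - 1))) - 1"
proof -
  have l': "l \<le> num_coords n" "l - 1 \<le> num_coords n" using l by auto
  have "free_from (l - 1) = insert (l - 1) (free_from l)"
    using l free by (auto simp: free_from_def)
  moreover have "l - 1 \<notin> free_from l" "finite (free_from l)" using l by (auto simp: free_from_def)
  ultimately have "card (free_from (l - 1)) = Suc (card (free_from l))" by simp
  then show dim: "variety_dim (num_coords n) (in_coords n (stratum n h l)) =
      variety_dim (num_coords n) (in_coords n (stratum n h (l - 1))) - 1"
    unfolding variety_dim_stratum[OF l'(1)] variety_dim_stratum[OF l'(2)] by (simp add: one_ereal_def)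
  show "stratum n h (l - 1) \<noteq> stratum n h l"
  proof
    assume "stratum n h (l - 1) = stratum n h l"
    then show False
      using dim unfolding variety_dim_stratum[OF l'(1)] by (simp add: variety_dim_stratum[OF l'(1)] one_ereal_def)
  qed
qed

lemma stratum_nonfree_step:
  assumes l: "l \<in> {1..num_coords n}" and nonfree: "\<not> free (l - 1)"
  shows "stratum n h (l - 1) = stratum n h l"
proof
  have l': "l - 1 \<le> num_coords n" "l \<le> num_coords n" "l - 1 < num_coords n" using l by auto
  show "stratum n h l \<subseteq> stratum n h (l - 1)" by (rule stratum_antimono) (use l in auto)
  show "stratum n h (l - 1) \<subseteq> stratum n h l"
  proof
    fix V assume V: "V \<in> stratum n h (l - 1)"
    then obtain v where v: "v \<in> carrier_vec (num_coords n)" "V = flag_of n (chart_mat n v)"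
      by (rule stratum_cases)
    have *: "\<forall>k<l - 1. v $ k = 0" "\<forall>k<num_coords n. \<not> free k \<longrightarrow> v $ k = nonfree_value n h k v"
      using V stratum_iff[OF l'(1) v(1)] unfolding v(2) by blast+
    then have "v $ (l - 1) = 0" using nonfree_value_zero[OF l'(3) nonfree, of v] nonfree l'(3) by simp
    then have "v $ k = 0" if "k < l" for k
      using that *(1) by (cases "k = l - 1") auto
    then show "V \<in> stratum n h l" using *(2) stratum_iff[OF l'(2) v(1)] unfolding v(2) by blast
  qed
qed

end

theorem theorem5p4:
  fixes n :: nat and h :: "nat \<Rightarrow> nat"
  assumes "1 \<le> n"
    and "hessenberg_function n h"
    and "indecomposable n h"
  shows
    "(stratum n h 0 = hess_chart n h \<and>
      (\<forall>l\<in>{1..num_coords n}. stratum n h l \<subseteq> stratum n h (l - 1)) \<and>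
      stratum n h (num_coords n) = {flag_of n (perm_matrix n (longest n))} \<and>
      (\<forall>l\<in>{0..num_coords n}.
         closedin (zariski (num_coords n)) (in_coords n (stratum n h l)))) \<and>
     (\<forall>l\<in>{1..num_coords n}.
       (if lowest_corner (diagram n (inv_into UNIV (u_perm n l))) \<in> free_positions n h
        then stratum n h (l - 1) \<noteq> stratum n h l \<and>
             \<bar>variety_dim (num_coords n) (in_coords n (stratum n h (l - 1)))\<bar> \<noteq> \<infinity> \<and>
             variety_dim (num_coords n) (in_coords n (stratum n h l)) =
               variety_dim (num_coords n) (in_coords n (stratum n h (l - 1))) - 1
        else stratum n h (l - 1) = stratum n h l)) \<and>
     (\<forall>l\<in>{0..num_coords n}.
       (\<exists>k. isomorphic_varieties (num_coords n) (in_coords n (stratum n h l)) k (carrier_vec k)) \<and>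
       nonsingular (num_coords n) (in_coords n (stratum n h l)) \<and>
       irreducible_space (subtopology (zariski (num_coords n)) (in_coords n (stratum n h l))))"
proof -
  interpret indecomposable_hessenberg n h using assms by unfold_locales
  have graph: "\<exists>d b G. graph_variety (num_coords n) d b G (in_coords n (stratum n h l))"
    if "l \<in> {0..num_coords n}" for l
    using stratum_graph[of l] that by auto
  show ?thesis
  proof (intro conjI ballI)
    show "stratum n h 0 = hess_chart n h" by (rule stratum_0)
    show "stratum n h (num_coords n) = {flag_of n (perm_matrix n (longest n))}" by (rule stratum_last)
  next
    fix l assume "l \<in> {1..num_coords n}"
    then show "stratum n h l \<subseteq> stratum n h (l - 1)" by (intro stratum_antimono) auto
  next
    fix l assume "l \<in> {0..num_coords n}"
    from graph[OF this] obtain d b G where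
      g: "graph_variety (num_coords n) d b G (in_coords n (stratum n h l))" by blast
    show "closedin (zariski (num_coords n)) (in_coords n (stratum n h l))"
      by (rule graph_variety.closedin_zariski_S[OF g])
    show "\<exists>k. isomorphic_varieties (num_coords n) (in_coords n (stratum n h l)) k (carrier_vec k)"
      using graph_variety.isomorphic_affine_space[OF g] by blast
    show "nonsingular (num_coords n) (in_coords n (stratum n h l))"
      by (rule graph_variety.nonsingular_S[OF g])
    show "irreducible_space (subtopology (zariski (num_coords n)) (in_coords n (stratum n h l)))"
      by (rule graph_variety.irreducible_S[OF g])
  next
    fix l assume l: "l \<in> {1..num_coords n}"
    have "l - 1 \<le> num_coords n" using l by auto
    from variety_dim_stratum[OF this]
    have "\<bar>variety_dim (num_coords n) (in_coords n (stratum n h (l - 1)))\<bar> \<noteq> \<infinity>" by simp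
    then show "if lowest_corner (diagram n (inv_into UNIV (u_perm n l))) \<in> free_positions n h
        then stratum n h (l - 1) \<noteq> stratum n h l \<and>
             \<bar>variety_dim (num_coords n) (in_coords n (stratum n h (l - 1)))\<bar> \<noteq> \<infinity> \<and>
             variety_dim (num_coords n) (in_coords n (stratum n h l)) =
               variety_dim (num_coords n) (in_coords n (stratum n h (l - 1))) - 1
        else stratum n h (l - 1) = stratum n h l"
      unfolding lowest_corner_u_perm[OF assms(1) l]
      using stratum_free_step[OF l] stratum_nonfree_step[OF l] by simp
  qed
qed

end
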